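(* Let $(\bar A,\bar b)$, $\bar A\in\{0,*\}^{n\times n}$, $\bar b\in\{0,*\}^{n\times 1}$, be structurally controllable and let $\bar F\in\{0,*\}^{n\times(n+1)}$ be a perturbation structure. For each edge $e=(x_j,x_i)\in{\cal E}_{\bar F}$, let $[\bar A^e,\bar b^e]=[\bar A,\bar b]\vee\bar F^{\{e\}}$, and let $\Omega_j$, ${\cal V}_k^+$ and ${\cal G}^{j_{\rm c}}_{ki^*}$ be constructed from the pair $(\bar A^e,\bar b^e)$ and the position $(i,j)$ as described in the context. Then $(\bar A,\bar b)$ is PTSC w.r.t. $\bar F$ if and only if for each edge $e=(x_j,x_i)\in{\cal E}_{\bar F}$ the following hold simultaneously: 1) ${\rm grank}(\bar H[{\cal J}_n,{\cal J}_{n+1}\backslash\{j\}])=n$ or ${\rm grank}(\bar H[{\cal J}_n\backslash\{i\},{\cal J}_{n+1}\backslash\{j\}])=n-2$, where $\bar H=[\bar A^e,\bar b^e]$; 2) $\Omega_j=\emptyset$, or for each $k\in\Omega_j$, ${\rm minWMM}({\cal G}^{j_{\rm c}}_{ki^*})=|{\cal V}_k^+|$.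
   Context: Structured matrices. ${\cal J}_p=\{1,\dots,p\}$; $M[{\cal I}_1,{\cal I}_2]$ is the submatrix with rows ${\cal I}_1$ and columns ${\cal I}_2$. A structured matrix has entries in $\{0,*\}$; for $\bar M\in\{0,*\}^{p\times q}$, ${\bf S}_{\bar M}=\{M\in\mathbb C^{p\times q}:M_{ij}=0\text{ if }\bar M_{ij}=0\}$. A generic realization of $\bar M$ has its $*$ entries replaced by independent free parameters; ${\rm grank}(\bar M)$ is the maximum rank over all realizations. $(\bar M\vee\bar N)_{ij}=*$ if $\bar M_{ij}=*$ or $\bar N_{ij}=*$, and $0$ otherwise. PTSC. A pair $(A,b)$ is controllable if $[b,Ab,\dots,A^{n-1}b]$ has rank $n$. $(\bar A,\bar b)$ is structurally controllable if it has a controllable realization; ${\bf CS}(\bar A,\bar b)$ is the set of controllable complex realizations. $(A,b)$ is PTC w.r.t. $\bar F$ if $(A+\Delta A,b+\Delta b)$ is controllable for all (complex) $[\Delta A,\Delta b]\in{\bf S}_{\bar F}$. A structurally controllable $(\bar A,\bar b)$ is perturbation-tolerantly structurally controllable (PTSC) w.r.t. $\bar F$ if almost all $(A,b)\in{\bf CS}(\bar A,\bar b)$ are PTC w.r.t. $\bar F$; "almost all" means all except a set of Lebesgue measure zero in the space of values of the $*$ entries of $[\bar A,\bar b]$. Edges of $\bar F$. ${\cal E}_{\bar F}=\{(x_j,x_i):\bar F_{ij}\neq0\}$, with $i\in{\cal J}_n$, $j\in{\cal J}_{n+1}$. For $e=(x_j,x_i)\in{\cal E}_{\bar F}$, $\bar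 F^{\{e\}}$ is $\bar F$ with its $(i,j)$th entry replaced by $0$. Construction of $\Omega_j$ and ${\cal G}^{j_{\rm c}}_{ki^*}$ from a structurally controllable pair (below denoted $(\bar A,\bar b)$; in the theorem it is $(\bar A^e,\bar b^e)$) and a position $(i,j)$. Let $[A,b]$ be a generic realization, $H_\lambda=[A-\lambda I,b]$, and $H_\lambda^{j_{\rm c}}=H_\lambda[{\cal J}_n,{\cal J}_{n+1}\backslash\{j\}]$. The bipartite graph ${\cal B}(H_\lambda)=({\cal V}^+,{\cal V}^-,{\cal E})$ has ${\cal V}^+=\{x_1,\dots,x_n\}$ (rows), ${\cal V}^-=\{v_1,\dots,v_{n+1}\}$ (columns), ${\cal E}={\cal E}_I\cup{\cal E}_{[\bar A,\bar b]}$ with ${\cal E}_I=\{(x_l,v_l):l=1,\dots,n\}$, ${\cal E}_{[\bar A,\bar b]}=\{(x_l,v_k):[\bar A,\bar b]_{lk}\neq0\}$ (no parallel edges). An edge in ${\cal E}_I$ is a $\lambda$-edge; an edge in ${\cal E}_I\cap{\cal E}_{[\bar A,\bar b]}$ is a self-loop (so also a $\lambda$-edge). Let ${\cal B}(H_\lambda^{j_{\rm c}})={\cal B}(H_\lambda)-\{v_j\}$ (it has a matching of size $n$). Let ${\cal G}^{j_{\rm c}}_k=({\cal V}_k^+,{\cal V}_k^-,{\cal E}_k)$, $k=1,\dots,d$, be the components of the Dulmage–Mendelsohn (DM) decomposition of ${\cal B}(H_\lambda^{j_{\rm c}})$ (both tails are empty): the ${\cal V}_k^+$ (resp. ${\cal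 V}_k^-$) partition the left (resp. right) vertices, ${\cal E}_k$ is the set of edges between ${\cal V}_k^+$ and ${\cal V}_k^-$; ${\cal G}^{j_{\rm c}}_k$ has a maximum matching of size $|{\cal V}_k^+|=|{\cal V}_k^-|$ and each of its edges lies in some maximum matching of it; there are edges between ${\cal V}_k^+$ and ${\cal V}_l^-$ only if $k\le l$; an edge set ${\cal M}$ is a maximum matching of the whole graph iff ${\cal M}\subseteq\bigcup_k{\cal E}_k$ and each ${\cal M}\cap{\cal E}_k$ is a maximum matching of ${\cal G}^{j_{\rm c}}_k$; and the decomposition cannot be refined further with these properties. Let $i^*$ be the index with $x_i\in{\cal V}^+_{i^*}$. Let $\gamma_{\min}({\cal G}_k^{j_{\rm c}})$, $\gamma_{\max}({\cal G}_k^{j_{\rm c}})$ be the minimum and maximum number of $\lambda$-edges in a maximum matching of ${\cal G}_k^{j_{\rm c}}$. Set $\gamma_{\rm nz}({\cal G}_k^{j_{\rm c}})=1$ if $\gamma_{\max}({\cal G}_k^{j_{\rm c}})-\gamma_{\min}({\cal G}_k^{j_{\rm c}})>0$ or ${\cal G}_k^{j_{\rm c}}$ contains a self-loop, and $0$ otherwise. Define $\Omega_j=\{k\in\mathbb N:1\le k\le i^*,\ \gamma_{\rm nz}({\cal G}_k^{j_{\rm c}})=1\}$. For $k\in\Omega_j$, ${\cal G}^{j_{\rm c}}_{ki^*}$ is the weighted bipartite graph with left vertices $\bar{\cal V}^+_{ki^*}=({\cal V}_k^+\cup\cdots\cup{\cal V}_{i^*}^+)\backslash\{x_i\}$, right vertices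 $\bar{\cal V}^-_{ki^*}={\cal V}_k^-\cup\cdots\cup{\cal V}_{i^*}^-$, all edges of ${\cal E}$ between them, and edge weight $W(e)=1$ if $e\in{\cal E}_k$, $W(e)=0$ otherwise. ${\rm minWMM}(\cdot)$ is the minimum weight (sum of edge weights) over all maximum(-cardinality) matchings. *)

theory Defs
  imports
    "HOL-Analysis.Lebesgue_Measure"
    "Jordan_Normal_Form.DL_Rank"
    "Jordan_Normal_Form.DL_Submatrix"
begin

text \<open>
  All indices are 0-based: the index set \<open>{1,...,p}\<close> becomes \<open>{..<p}\<close>, and the last column
  of an \<open>n \<times> (n + 1)\<close> matrix \<open>[A, b]\<close>, which holds \<open>b\<close>, has index \<open>n\<close>.
  A structured matrix over the symbols \<open>0\<close> and \<open>*\<close> is a Boolean matrix; \<open>True\<close> stands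
  for \<open>*\<close> and \<open>False\<close> for \<open>0\<close>.
\<close>

type_synonym struct_mat = "bool mat"
type_synonym struct_vec = "bool vec"


section \<open>Structured matrices\<close>

definition pair_mat :: "'a mat \<Rightarrow> 'a vec \<Rightarrow> 'a mat" where
  "pair_mat A b =
     mat (dim_row A) (dim_col A + 1) (\<lambda>(i, j). if j < dim_col A then A $$ (i, j) else b $ i)"

definition stars :: "struct_mat \<Rightarrow> (nat \<times> nat) set" where
  "stars M = {(i, j). i < dim_row M \<and> j < dim_col M \<and> M $$ (i, j)}"

definition realizations :: "struct_mat \<Rightarrow> complex mat set" where
  "realizations Mbar =
     {M \<in> carrier_mat (dim_row Mbar) (dim_col Mbar).
        \<forall>i < dim_row Mbar. \<forall>j < dim_col Mbar. \<not> Mbar $$ (i, j) \<longrightarrow> M $$ (i, j) = 0}"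

definition grank :: "struct_mat \<Rightarrow> nat" where
  "grank Mbar = Max ((\<lambda>M. vec_space.rank (dim_row Mbar) M) ` realizations Mbar)"

definition struct_or :: "struct_mat \<Rightarrow> struct_mat \<Rightarrow> struct_mat" where
  "struct_or M N = mat (dim_row M) (dim_col M) (\<lambda>p. M $$ p \<or> N $$ p)"


section \<open>Perturbation-tolerant structural controllability\<close>

definition ctrb_mat :: "complex mat \<Rightarrow> complex vec \<Rightarrow> complex mat" where
  "ctrb_mat A b =
     mat_of_cols (dim_row A) (map (\<lambda>k. (A ^\<^sub>m k) *\<^sub>v b) [0..<dim_row A])"

definition controllable :: "complex mat \<Rightarrow> complex vec \<Rightarrow> bool" where
  "controllable A b \<longleftrightarrow> vec_space.rank (dim_row A) (ctrb_mat A b) = dim_row A"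

definition CS :: "struct_mat \<Rightarrow> struct_vec \<Rightarrow> (complex mat \<times> complex vec) set" where
  "CS Abar bbar =
     {(A, b). A \<in> carrier_mat (dim_row Abar) (dim_col Abar) \<and> b \<in> carrier_vec (dim_vec bbar) \<and>
        pair_mat A b \<in> realizations (pair_mat Abar bbar) \<and> controllable A b}"

definition struct_controllable :: "struct_mat \<Rightarrow> struct_vec \<Rightarrow> bool" where
  "struct_controllable Abar bbar \<longleftrightarrow> CS Abar bbar \<noteq> {}"

definition PTC :: "complex mat \<Rightarrow> complex vec \<Rightarrow> struct_mat \<Rightarrow> bool" where
  "PTC A b Fbar \<longleftrightarrow>
     (\<forall>dA \<in> carrier_mat (dim_row A) (dim_col A). \<forall>db \<in> carrier_vec (dim_vec b).
        pair_mat dA db \<in> realizations Fbar \<longrightarrow> controllable (A + dA) (b + db))"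

text \<open>The realization in which the \<open>*\<close> at each position \<open>p\<close> of \<open>[Abar, bbar]\<close> has value \<open>v p\<close>.\<close>

definition realize ::
  "struct_mat \<Rightarrow> struct_vec \<Rightarrow> (nat \<times> nat \<Rightarrow> complex) \<Rightarrow> complex mat \<times> complex vec" where
  "realize Abar bbar v =
     (mat (dim_row Abar) (dim_col Abar) (\<lambda>p. if Abar $$ p then v p else 0),
      vec (dim_vec bbar) (\<lambda>i. if bbar $ i then v (i, dim_col Abar) else 0))"

text \<open>
  The space of values of the \<open>*\<close> entries is the space of complex-valued functions on the finite
  set of \<open>*\<close> positions, with the product of the Lebesgue measures of the complex plane.
\<close>

definition PTSC :: "struct_mat \<Rightarrow> struct_vec \<Rightarrow> struct_mat \<Rightarrow> bool" where
  "PTSC Abar bbar Fbar \<longleftrightarrow>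
     struct_controllable Abar bbar \<and>
     (AE v in Pi\<^sub>M (stars (pair_mat Abar bbar)) (\<lambda>_. lborel :: complex measure).
        case realize Abar bbar v of (A, b) \<Rightarrow> (A, b) \<in> CS Abar bbar \<longrightarrow> PTC A b Fbar)"


section \<open>Edges of the perturbation structure\<close>

text \<open>The edge \<open>(j, i)\<close>, from \<open>x\<^sub>j\<close> to \<open>x\<^sub>i\<close>, belongs to the entry in row \<open>i\<close> and column \<open>j\<close>.\<close>

definition pert_edges :: "struct_mat \<Rightarrow> (nat \<times> nat) set" where
  "pert_edges Fbar = {(j, i). (i, j) \<in> stars Fbar}"

definition remove_edge :: "struct_mat \<Rightarrow> nat \<times> nat \<Rightarrow> struct_mat" where
  "remove_edge Fbar e =
     mat (dim_row Fbar) (dim_col Fbar) (\<lambda>(i, j). Fbar $$ (i, j) \<and> (j, i) \<noteq> e)"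

text \<open>The matrix \<open>[Abar\<^sup>e, bbar\<^sup>e]\<close>.\<close>

definition edge_mat :: "struct_mat \<Rightarrow> struct_vec \<Rightarrow> struct_mat \<Rightarrow> nat \<times> nat \<Rightarrow> struct_mat" where
  "edge_mat Abar bbar Fbar e = struct_or (pair_mat Abar bbar) (remove_edge Fbar e)"


section \<open>Bipartite graphs and matchings\<close>

text \<open>
  An edge is a pair (left vertex, right vertex). The two sides are told apart by the position in
  the pair only, so the same number may name a left and a right vertex.
\<close>

datatype bigraph = Bigraph (lverts: "nat set") (rverts: "nat set") (edges: "(nat \<times> nat) set")

definition induced :: "bigraph \<Rightarrow> nat set \<Rightarrow> nat set \<Rightarrow> bigraph" where
  "induced G L R = Bigraph L R (edges G \<inter> L \<times> R)"

definition matching :: "bigraph \<Rightarrow> (nat \<times> nat) set \<Rightarrow> bool" where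
  "matching G M \<longleftrightarrow> M \<subseteq> edges G \<and> inj_on fst M \<and> inj_on snd M"

definition max_matching :: "bigraph \<Rightarrow> (nat \<times> nat) set \<Rightarrow> bool" where
  "max_matching G M \<longleftrightarrow> matching G M \<and> (\<forall>M'. matching G M' \<longrightarrow> card M' \<le> card M)"

definition minWMM :: "bigraph \<Rightarrow> (nat \<times> nat \<Rightarrow> nat) \<Rightarrow> nat" where
  "minWMM G W = Min ((\<lambda>M. \<Sum>e\<in>M. W e) ` {M. max_matching G M})"


section \<open>Dulmage--Mendelsohn decomposition\<close>

text \<open>
  A decomposition is the list of the vertex sets \<open>(V\<^sub>k\<^sup>+, V\<^sub>k\<^sup>-)\<close> of its components. Only the case
  of graphs with a perfect matching (empty tails) is covered. The set of components is determined
  by the graph, but their order in general is not, hence a predicate and not a function.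
\<close>

type_synonym decomposition = "(nat set \<times> nat set) list"

definition component :: "bigraph \<Rightarrow> decomposition \<Rightarrow> nat \<Rightarrow> bigraph" where
  "component G D k = induced G (fst (D ! k)) (snd (D ! k))"

definition DM_properties :: "bigraph \<Rightarrow> decomposition \<Rightarrow> bool" where
  "DM_properties G D \<longleftrightarrow>
     (\<Union>k<length D. fst (D ! k)) = lverts G \<and>
     (\<Union>k<length D. snd (D ! k)) = rverts G \<and>
     (\<forall>k<length D. fst (D ! k) \<noteq> {} \<and> snd (D ! k) \<noteq> {}) \<and>
     (\<forall>k<length D. \<forall>l<length D. k \<noteq> l \<longrightarrow>
        fst (D ! k) \<inter> fst (D ! l) = {} \<and> snd (D ! k) \<inter> snd (D ! l) = {}) \<and>
     (\<forall>k<length D.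
        (\<exists>M. max_matching (component G D k) M \<and>
             card M = card (fst (D ! k)) \<and> card M = card (snd (D ! k))) \<and>
        (\<forall>e\<in>edges (component G D k). \<exists>M. max_matching (component G D k) M \<and> e \<in> M)) \<and>
     (\<forall>k<length D. \<forall>l<length D.
        edges G \<inter> fst (D ! k) \<times> snd (D ! l) \<noteq> {} \<longrightarrow> k \<le> l) \<and>
     (\<forall>M. max_matching G M \<longleftrightarrow>
        M \<subseteq> (\<Union>k<length D. edges (component G D k)) \<and>
        (\<forall>k<length D. max_matching (component G D k) (M \<inter> edges (component G D k))))"

definition refines :: "decomposition \<Rightarrow> decomposition \<Rightarrow> bool" where
  "refines D' D \<longleftrightarrow>
     (\<forall>P\<in>set D'. \<exists>Q\<in>set D. fst P \<subseteq> fst Q \<and> snd P \<subseteq> snd Q)"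

definition DM_decomposition :: "bigraph \<Rightarrow> decomposition \<Rightarrow> bool" where
  "DM_decomposition G D \<longleftrightarrow>
     DM_properties G D \<and>
     (\<forall>D'. DM_properties G D' \<and> refines D' D \<longrightarrow> set D' = set D)"

definition comp_index :: "decomposition \<Rightarrow> nat \<Rightarrow> nat" where
  "comp_index D i = (THE k. k < length D \<and> i \<in> fst (D ! k))"


section \<open>The graph of the matrix pencil\<close>

text \<open>
  Throughout, \<open>Hbar\<close> is the \<open>n \<times> (n + 1)\<close> structured matrix \<open>[Abar, bbar]\<close>. The graph of
  \<open>[A - \<lambda>I, b]\<close> for a generic realization depends on \<open>Hbar\<close> only.
\<close>

definition lambda_edges :: "struct_mat \<Rightarrow> (nat \<times> nat) set" where
  "lambda_edges Hbar = {(l, l) | l. l < dim_row Hbar}"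

definition self_loops :: "struct_mat \<Rightarrow> (nat \<times> nat) set" where
  "self_loops Hbar = lambda_edges Hbar \<inter> stars Hbar"

definition pencil_graph :: "struct_mat \<Rightarrow> bigraph" where
  "pencil_graph Hbar =
     Bigraph {..<dim_row Hbar} {..<dim_col Hbar} (lambda_edges Hbar \<union> stars Hbar)"

definition pencil_graph_del :: "struct_mat \<Rightarrow> nat \<Rightarrow> bigraph" where
  "pencil_graph_del Hbar j =
     induced (pencil_graph Hbar) {..<dim_row Hbar} ({..<dim_col Hbar} - {j})"

definition gamma_min :: "struct_mat \<Rightarrow> bigraph \<Rightarrow> nat" where
  "gamma_min Hbar G = Min ((\<lambda>M. card (M \<inter> lambda_edges Hbar)) ` {M. max_matching G M})"

definition gamma_max :: "struct_mat \<Rightarrow> bigraph \<Rightarrow> nat" where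
  "gamma_max Hbar G = Max ((\<lambda>M. card (M \<inter> lambda_edges Hbar)) ` {M. max_matching G M})"

definition gamma_nz :: "struct_mat \<Rightarrow> bigraph \<Rightarrow> nat" where
  "gamma_nz Hbar G =
     (if gamma_max Hbar G - gamma_min Hbar G > 0 \<or> edges G \<inter> self_loops Hbar \<noteq> {}
      then 1 else 0)"

text \<open>In the following, \<open>D\<close> is a decomposition of \<open>pencil_graph_del Hbar j\<close>.\<close>

definition Omega :: "struct_mat \<Rightarrow> decomposition \<Rightarrow> nat \<times> nat \<Rightarrow> nat set" where
  "Omega Hbar D = (\<lambda>(i, j).
     {k. k < length D \<and> k \<le> comp_index D i \<and>
         gamma_nz Hbar (component (pencil_graph_del Hbar j) D k) = 1})"

definition tail_graph :: "struct_mat \<Rightarrow> decomposition \<Rightarrow> nat \<times> nat \<Rightarrow> nat \<Rightarrow> bigraph" where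
  "tail_graph Hbar D = (\<lambda>(i, j) k.
     induced (pencil_graph Hbar)
       ((\<Union>l\<in>{k..comp_index D i}. fst (D ! l)) - {i})
       (\<Union>l\<in>{k..comp_index D i}. snd (D ! l)))"

definition tail_weight ::
  "struct_mat \<Rightarrow> decomposition \<Rightarrow> nat \<times> nat \<Rightarrow> nat \<Rightarrow> nat \<times> nat \<Rightarrow> nat" where
  "tail_weight Hbar D = (\<lambda>(i, j) k e.
     if e \<in> edges (component (pencil_graph_del Hbar j) D k) then 1 else 0)"

end

theory Submission
  imports Defs "HOL-Computational_Algebra.Fundamental_Theorem_Algebra"
begin

text \<open>
  Let \<open>P\<close> be the determinant of the controllability matrix, as a polynomial in the values of
  all stars of \<open>[Abar, bbar]\<close> and \<open>Fbar\<close> together. A perturbation gives arbitrary values to the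
  variables of \<open>Fbar\<close>, and a complex polynomial without zeros is constant. Hence almost every
  realization is tolerant iff \<open>P\<close> depends on no variable of \<open>Fbar\<close>
  (\<open>PTSC_iff_independent\<close>), and the entries of \<open>Fbar\<close> can be treated one at a time.

  Fix an entry \<open>(i, j)\<close>. By the eigenvector test (\<open>ctrb_det_nonzero_iff\<close>), a pair is
  uncontrollable iff some \<open>q \<noteq> 0\<close> satisfies \<open>q\<^sup>T [A - zI, b] = 0\<close> for some \<open>z\<close>. Only column \<open>j\<close>
  contains the perturbed entry, and it can be annihilated by a choice of that entry as soon as
  \<open>q i \<noteq> 0\<close>. So \<open>P\<close> is independent of the entry iff, for generic parameters and every \<open>z\<close>, each
  left null vector \<open>q\<close> of the pencil without column \<open>j\<close> has \<open>q i = 0\<close>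
  (\<open>independent_forces_zero\<close>, \<open>independent_if_forced_zero\<close>). At \<open>z = 0\<close> this is the rank
  condition.

  At \<open>z \<noteq> 0\<close>, fix a perfect matching \<open>\<pi>\<close> of the graph without column \<open>j\<close> and let row \<open>r\<close> point to
  row \<open>r'\<close> if there is an edge \<open>(r, \<pi> r')\<close>. The components of the Dulmage--Mendelsohn
  decomposition are the strongly connected components of this digraph (\<open>reach_in_component\<close>).
  A path from component \<open>k\<close> to row \<open>i\<close> is an alternating path; moving the matching along it removes
  row \<open>i\<close>, frees a column of component \<open>k\<close> and saves one edge of that component. So \<open>minWMM\<close> is
  smaller than the size of component \<open>k\<close> iff component \<open>k\<close> reaches \<open>i\<close> (\<open>minWMM_less\<close>,
  \<open>missing_if_minWMM_neq\<close>). It remains to see that null vectors with \<open>q i \<noteq> 0\<close> occur iff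
  a component with a nonzero root reaches \<open>i\<close>.

  The rows that reach \<open>i\<close> form, with the columns matched to them, a diagonal block of the pencil
  that shares these columns with no other row. If none of their components has a
  nonzero root, then its determinant is a power of \<open>z\<close> times a polynomial in the parameters, and \<open>q\<close>
  vanishes on these rows (\<open>left_null_vanishes_on_closed_rows\<close>). Conversely, in a component with
  nonzero roots some star \<open>x = (r, c)\<close> moves the roots (\<open>moves_roots_in_component\<close>): the determinant
  is \<open>v + x * u\<close> with \<open>u\<close> and \<open>v\<close> not proportional as functions of \<open>z\<close>. The minor without row \<open>i\<close>
  and column \<open>c\<close> does not contain \<open>x\<close>, and is not identically zero if the component reaches \<open>i\<close>. Now
  \<open>x = - v / u\<close> makes the determinant vanish at a generic \<open>z\<close> where this minor and \<open>P\<close> do not vanish,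
  which gives a null vector with \<open>q i \<noteq> 0\<close> (\<open>forced_zero_contradiction\<close>). The choice of the deleted
  column \<open>c\<close> is what makes the argument independent of the irreducibility of the determinants
  of the components.
\<close>

section \<open>Polynomial functions\<close>

text \<open>
  The functions generated by a set \<open>B\<close> of basic functions with complex constants. With the
  coordinates as basic functions these are the polynomials in several variables; one closure
  argument thus serves both the polynomials in the parameters and those in \<open>z\<close>.
\<close>

inductive poly_expr :: "('p \<Rightarrow> complex) set \<Rightarrow> ('p \<Rightarrow> complex) \<Rightarrow> bool" for B where
  poly_expr_const: "poly_expr B (\<lambda>_. c)"
| poly_expr_gen: "g \<in> B \<Longrightarrow> poly_expr B g"
| poly_expr_add: "poly_expr B f \<Longrightarrow> poly_expr B g \<Longrightarrow> poly_expr B (\<lambda>x. f x + g x)"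
| poly_expr_mult: "poly_expr B f \<Longrightarrow> poly_expr B g \<Longrightarrow> poly_expr B (\<lambda>x. f x * g x)"

abbreviation multi_poly :: "(('x \<Rightarrow> complex) \<Rightarrow> complex) \<Rightarrow> bool" where
  "multi_poly \<equiv> poly_expr (range (\<lambda>x a. a x))"

abbreviation uni_poly :: "(complex \<Rightarrow> complex) \<Rightarrow> bool" where
  "uni_poly \<equiv> poly_expr {\<lambda>t. t}"

lemma multi_poly_coord: "multi_poly (\<lambda>a. a x)"
  by (rule poly_expr_gen) auto

lemma uni_poly_id: "uni_poly (\<lambda>t. t)"
  by (rule poly_expr_gen) auto

lemma poly_expr_uminus: "poly_expr B f \<Longrightarrow> poly_expr B (\<lambda>x. - f x)"
  using poly_expr_mult[OF poly_expr_const[of B "-1"], of f] by simp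

lemma poly_expr_diff:
  "poly_expr B f \<Longrightarrow> poly_expr B g \<Longrightarrow> poly_expr B (\<lambda>x. f x - g x)"
  using poly_expr_add[OF _ poly_expr_uminus, of B f g] by simp

lemma poly_expr_if:
  "poly_expr B f \<Longrightarrow> poly_expr B g \<Longrightarrow> poly_expr B (\<lambda>x. if b then f x else g x)"
  by (cases b) auto

lemma poly_expr_sum: "(\<And>i. i \<in> I \<Longrightarrow> poly_expr B (f i)) \<Longrightarrow> poly_expr B (\<lambda>x. \<Sum>i\<in>I. f i x)"
  by (induction I rule: infinite_finite_induct) (auto intro: poly_expr.intros)

lemma poly_expr_prod: "(\<And>i. i \<in> I \<Longrightarrow> poly_expr B (f i)) \<Longrightarrow> poly_expr B (\<lambda>x. \<Prod>i\<in>I. f i x)"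
  by (induction I rule: infinite_finite_induct) (auto intro: poly_expr.intros)

lemma poly_expr_det:
  assumes "\<And>x. M x \<in> carrier_mat m m"
    and "\<And>r c. r < m \<Longrightarrow> c < m \<Longrightarrow> poly_expr B (\<lambda>x. M x $$ (r, c))"
  shows "poly_expr B (\<lambda>x. det (M x))"
proof -
  have "poly_expr B (\<lambda>x. \<Sum>p\<in>{p. p permutes {0..<m}}. signof p * (\<Prod>i=0..<m. M x $$ (i, p i)))"
  proof (intro poly_expr_sum poly_expr_mult poly_expr_const poly_expr_prod)
    fix p i assume "p \<in> {p. p permutes {0..<m}}" "i \<in> {0..<m}"
    then show "poly_expr B (\<lambda>x. M x $$ (i, p i))"
      using assms(2)[of i "p i"] permutes_in_image[of p "{0..<m}" i] by auto
  qed
  then show ?thesis using det_def'[OF assms(1)] by simp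
qed

lemma poly_expr_compose:
  assumes "poly_expr B f" "\<And>g. g \<in> B \<Longrightarrow> poly_expr C (\<lambda>x. g (h x))"
  shows "poly_expr C (\<lambda>x. f (h x))"
  using assms(1) by induction (auto intro: poly_expr.intros assms(2))

lemma multi_poly_compose:
  assumes "multi_poly f" "\<And>x. poly_expr C (\<lambda>y. h y x)"
  shows "poly_expr C (\<lambda>y. f (h y))"
  using assms(1) by (rule poly_expr_compose) (use assms(2) in auto)

lemma uni_poly_eq_poly: "uni_poly f \<Longrightarrow> \<exists>p. f = poly p"
proof (induction rule: poly_expr.induct)
  case (poly_expr_const c)
  show ?case by (rule exI[of _ "[:c:]"]) auto
next
  case (poly_expr_gen g)
  show ?case by (rule exI[of _ "[:0, 1:]"]) (use poly_expr_gen in auto)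
next
  case (poly_expr_add f g)
  then obtain p q where "f = poly p" "g = poly q" by auto
  then show ?case by (intro exI[of _ "p + q"]) auto
next
  case (poly_expr_mult f g)
  then obtain p q where "f = poly p" "g = poly q" by auto
  then show ?case by (intro exI[of _ "p * q"]) auto
qed

lemma uni_poly_finite_zeros:
  assumes "uni_poly f" "f s \<noteq> 0"
  shows "finite {t. f t = 0}"
proof -
  obtain p where p: "f = poly p" using uni_poly_eq_poly[OF assms(1)] by auto
  with assms(2) have "p \<noteq> 0" by auto
  then show ?thesis using poly_roots_finite p by auto
qed

lemma uni_poly_has_zero:
  assumes "uni_poly f" "f s \<noteq> f t"
  shows "\<exists>z. f z = 0"
proof -
  obtain p where p: "f = poly p" using uni_poly_eq_poly[OF assms(1)] by auto
  have "\<not> constant (poly p)" using assms(2) p unfolding constant_def by auto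
  then show ?thesis using fundamental_theorem_of_algebra p by auto
qed

lemma uni_poly_common_nonzero:
  assumes "finite I" "\<And>i. i \<in> I \<Longrightarrow> uni_poly (f i)" "\<And>i. i \<in> I \<Longrightarrow> \<exists>t. f i t \<noteq> 0"
  shows "\<exists>t. \<forall>i\<in>I. f i t \<noteq> 0"
proof -
  have "finite (\<Union>i\<in>I. {t. f i t = 0})"
    using assms uni_poly_finite_zeros by blast
  then obtain t where "t \<notin> (\<Union>i\<in>I. {t. f i t = 0})"
    using ex_new_if_finite[OF infinite_UNIV_char_0] by blast
  then show ?thesis by auto
qed

text \<open>
  Polynomials in several variables are compared on the line through two points, where they become
  univariate and have finitely many zeros.
\<close>

definition line :: "('x \<Rightarrow> complex) \<Rightarrow> ('x \<Rightarrow> complex) \<Rightarrow> complex \<Rightarrow> 'x \<Rightarrow> complex" where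
  "line a b t = (\<lambda>x. a x + t * (b x - a x))"

lemma line_0 [simp]: "line a b 0 = a" and line_1 [simp]: "line a b 1 = b"
  by (auto simp: line_def)

lemma uni_poly_line: "multi_poly f \<Longrightarrow> uni_poly (\<lambda>t. f (line a b t))"
  unfolding line_def
  by (erule multi_poly_compose)
    (intro poly_expr_add poly_expr_mult poly_expr_const uni_poly_id)

lemma uni_poly_upd: "multi_poly f \<Longrightarrow> uni_poly (\<lambda>y. f (a(x := y)))"
proof (erule multi_poly_compose)
  show "uni_poly (\<lambda>y. (a(x := y)) z)" for z
    by (cases "z = x") (auto intro: poly_expr_const uni_poly_id)
qed

lemma multi_poly_upd: "multi_poly f \<Longrightarrow> multi_poly (\<lambda>a. f (a(x := y)))"
proof (erule multi_poly_compose)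
  show "multi_poly (\<lambda>a. (a(x := y)) z)" for z
    by (cases "z = x") (auto intro: poly_expr_const multi_poly_coord)
qed

lemma multi_poly_common_nonzero:
  assumes "multi_poly f" "multi_poly g" "f a \<noteq> 0" "g b \<noteq> 0"
  shows "\<exists>c. f c \<noteq> 0 \<and> g c \<noteq> 0"
proof -
  have "\<exists>t. \<forall>i\<in>{f, g}. i (line a b t) \<noteq> 0"
  proof (rule uni_poly_common_nonzero)
    fix i assume "i \<in> {f, g}"
    then show "uni_poly (\<lambda>t. i (line a b t))"
      using assms(1,2) uni_poly_line by auto
    show "\<exists>t. i (line a b t) \<noteq> 0"
      using \<open>i \<in> {f, g}\<close> assms(3,4) line_0[of a b] line_1[of a b] by (metis insertE singletonD)
  qed auto
  then show ?thesis by auto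
qed

text \<open>
  Nonzero polynomials have a common point where neither vanishes, so an identity that holds
  generically holds everywhere.
\<close>

lemma multi_poly_zero_if_product_zero:
  assumes "multi_poly f" "multi_poly g" "g b \<noteq> 0" "\<And>a. g a \<noteq> 0 \<Longrightarrow> f a = 0"
  shows "f a = 0"
  using multi_poly_common_nonzero[OF assms(1,2) _ assms(3), of a] assms(4) by blast

lemma measurable_multi_poly:
  assumes "multi_poly f" "\<And>x. (\<lambda>w. h w x) \<in> borel_measurable M"
  shows "(\<lambda>w. f (h w)) \<in> borel_measurable M"
  using assms(1) by induction (use assms(2) in auto)

definition overwrite :: "('x \<Rightarrow> complex) \<Rightarrow> 'x set \<Rightarrow> ('x \<Rightarrow> complex) \<Rightarrow> 'x \<Rightarrow> complex" where
  "overwrite a0 S v = (\<lambda>x. if x \<in> S then v x else a0 x)"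

lemma measurable_overwrite:
  "(\<lambda>v. overwrite a0 S v x) \<in> borel_measurable (PiM S (\<lambda>_. lborel :: complex measure))"
  unfolding overwrite_def by (cases "x \<in> S") auto

text \<open>
  Fubini's theorem, one variable at a time: for almost all values of the other variables the
  polynomial is nonzero for some value of the next one, hence for all but finitely many.
\<close>

lemma AE_multi_poly_nonzero:
  assumes f: "multi_poly f" and "finite S" and "f a0 \<noteq> 0"
  shows "AE v in PiM S (\<lambda>_. lborel :: complex measure). f (overwrite a0 S v) \<noteq> 0"
  using \<open>finite S\<close>
proof induction
  case empty
  show ?case using assms by (auto simp: overwrite_def)
next
  case (insert x S)
  interpret product_sigma_finite "\<lambda>_. lborel :: complex measure" by standard
  let ?M = "PiM (insert x S) (\<lambda>_. lborel :: complex measure)"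
  have meas: "(\<lambda>v. f (overwrite a0 (insert x S) v)) \<in> borel_measurable ?M"
    by (rule measurable_multi_poly[OF f measurable_overwrite])
  let ?N = "\<lambda>v. if f (overwrite a0 (insert x S) v) = 0 then 1 else 0 :: ennreal"
  have N: "?N \<in> borel_measurable ?M"
    using meas by measurable
  have "(\<integral>\<^sup>+v. ?N v \<partial>?M)
      = (\<integral>\<^sup>+v. \<integral>\<^sup>+y. ?N (v(x := y)) \<partial>lborel \<partial>PiM S (\<lambda>_. lborel :: complex measure))"
    by (rule product_nn_integral_insert[OF insert.hyps(1,2) N])
  also have "\<dots> = (\<integral>\<^sup>+v. 0 \<partial>PiM S (\<lambda>_. lborel :: complex measure))"
  proof (rule nn_integral_cong_AE, use insert.IH in eventually_elim)
    fix v assume v: "f (overwrite a0 S v) \<noteq> 0"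
    have eq: "overwrite a0 (insert x S) (v(x := y)) = (overwrite a0 S v)(x := y)" for y
      by (auto simp: overwrite_def fun_eq_iff)
    have "finite {y. f ((overwrite a0 S v)(x := y)) = 0}"
      by (rule uni_poly_finite_zeros[OF uni_poly_upd[OF f], of _ _ "overwrite a0 S v x"]) (use v in simp)
    then have "{y. f ((overwrite a0 S v)(x := y)) = 0} \<in> null_sets lborel"
      by (rule finite_imp_null_set_lborel)
    then have "AE y in lborel. f ((overwrite a0 S v)(x := y)) \<noteq> 0"
      by (drule_tac AE_not_in) auto
    then have "AE y in lborel. ?N (v(x := y)) = 0"
      unfolding eq by eventually_elim auto
    then have "(\<integral>\<^sup>+y. ?N (v(x := y)) \<partial>lborel) = (\<integral>\<^sup>+y. 0 \<partial>(lborel :: complex measure))"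
      by (rule nn_integral_cong_AE)
    then show "(\<integral>\<^sup>+y. ?N (v(x := y)) \<partial>lborel) = 0" by simp
  qed
  finally have "(\<integral>\<^sup>+v. ?N v \<partial>?M) = 0" by simp
  then have "AE v in ?M. ?N v = 0"
    using nn_integral_0_iff_AE[OF N] by auto
  then show ?case by eventually_elim (auto split: if_splits)
qed

lemma not_AE_False_PiM_lborel:
  assumes "finite S"
  shows "\<not> (AE v in PiM S (\<lambda>_. lborel :: complex measure). False)"
proof
  interpret product_sigma_finite "\<lambda>_. lborel :: complex measure" by standard
  let ?M = "PiM S (\<lambda>_. lborel :: complex measure)"
  assume "AE v in ?M. False"
  then have "emeasure ?M (space ?M) = 0"
    by (simp add: AE_iff_measurable[of "space ?M"])
  moreover have "emeasure ?M (space ?M) = (\<Prod>i\<in>S. emeasure lborel (UNIV :: complex set))"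
    using emeasure_PiM[OF assms, of "\<lambda>_. UNIV"] by (simp add: space_PiM)
  ultimately show False using assms by (simp add: emeasure_lborel_UNIV)
qed

section \<open>The eigenvector test for controllability\<close>

text \<open>
  The relation \<open>q\<^sup>T (H - zI) = 0\<close>, restricted to the columns in \<open>C\<close>. The identity matrix occupies the
  first \<open>n\<close> columns of the \<open>n \<times> (n + 1)\<close> matrix \<open>H\<close>, so the test \<open>r = c\<close> never succeeds in the last
  column.
\<close>

definition left_null ::
  "nat \<Rightarrow> (nat \<Rightarrow> nat \<Rightarrow> complex) \<Rightarrow> complex \<Rightarrow> nat set \<Rightarrow> (nat \<Rightarrow> complex) \<Rightarrow> bool" where
  "left_null n H z C q \<longleftrightarrow> (\<forall>c\<in>C. (\<Sum>r<n. q r * (H r c - (if r = c then z else 0))) = 0)"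

text \<open>
  Coordinate \<open>r\<close> of \<open>A\<^sup>k b\<close>, where \<open>b\<close> is column \<open>n\<close> of \<open>H = [A, b]\<close>.
\<close>

fun krylov :: "nat \<Rightarrow> (nat \<Rightarrow> nat \<Rightarrow> complex) \<Rightarrow> nat \<Rightarrow> nat \<Rightarrow> complex" where
  "krylov n H 0 r = H r n"
| "krylov n H (Suc k) r = (\<Sum>c<n. H r c * krylov n H k c)"

definition ctrb_det :: "nat \<Rightarrow> (nat \<Rightarrow> nat \<Rightarrow> complex) \<Rightarrow> complex" where
  "ctrb_det n H = det (mat n n (\<lambda>(r, k). krylov n H k r))"

lemma krylov_cong:
  assumes "\<And>r c. r < n \<Longrightarrow> c \<le> n \<Longrightarrow> H r c = H' r c"
  shows "r < n \<Longrightarrow> krylov n H k r = krylov n H' k r"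
  by (induction k arbitrary: r) (auto simp: assms)

lemma ctrb_det_cong:
  assumes "\<And>r c. r < n \<Longrightarrow> c \<le> n \<Longrightarrow> H r c = H' r c"
  shows "ctrb_det n H = ctrb_det n H'"
  unfolding ctrb_det_def by (rule arg_cong[of _ _ det], rule eq_matI) (auto intro!: krylov_cong assms)

lemma pow_mat_Suc_left:
  assumes "A \<in> carrier_mat n n" shows "A ^\<^sub>m (Suc k) = A * A ^\<^sub>m k"
proof (induction k)
  case (Suc k)
  have "A ^\<^sub>m (Suc (Suc k)) = (A * A ^\<^sub>m k) * A" using Suc by simp
  also have "\<dots> = A * (A ^\<^sub>m k * A)"
    using assms by (intro assoc_mult_mat) (auto intro: pow_carrier_mat)
  finally show ?case by simp
qed (use assms in simp)

lemma krylov_pair_mat: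
  assumes A: "A \<in> carrier_mat n n" and b: "b \<in> carrier_vec n"
  shows "r < n \<Longrightarrow> ((A ^\<^sub>m k) *\<^sub>v b) $ r = krylov n (\<lambda>r c. pair_mat A b $$ (r, c)) k r"
proof (induction k arbitrary: r)
  case 0
  then show ?case using A b by (simp add: pair_mat_def)
next
  case (Suc k)
  have "(A ^\<^sub>m (Suc k)) *\<^sub>v b = A *\<^sub>v ((A ^\<^sub>m k) *\<^sub>v b)"
    unfolding pow_mat_Suc_left[OF A] using A b
    by (intro assoc_mult_mat_vec) (auto intro: pow_carrier_mat)
  moreover have "(A ^\<^sub>m k) *\<^sub>v b \<in> carrier_vec n"
    using A by (intro mult_mat_vec_carrier[OF _ b] pow_carrier_mat)
  ultimately have "((A ^\<^sub>m (Suc k)) *\<^sub>v b) $ r = (\<Sum>c<n. A $$ (r, c) * ((A ^\<^sub>m k) *\<^sub>v b) $ c)"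
    using A Suc.prems by (simp add: scalar_prod_def lessThan_atLeast0)
  also have "\<dots> = (\<Sum>c<n. pair_mat A b $$ (r, c) * krylov n (\<lambda>r c. pair_mat A b $$ (r, c)) k c)"
    using A Suc by (intro sum.cong) (auto simp: pair_mat_def)
  finally show ?case by simp
qed

lemma controllable_iff_ctrb_det:
  assumes A: "A \<in> carrier_mat n n" and b: "b \<in> carrier_vec n"
  shows "controllable A b \<longleftrightarrow> ctrb_det n (\<lambda>r c. pair_mat A b $$ (r, c)) \<noteq> 0"
proof -
  have "ctrb_mat A b = mat n n (\<lambda>(r, k). krylov n (\<lambda>r c. pair_mat A b $$ (r, c)) k r)"
    using A krylov_pair_mat[OF A b] unfolding ctrb_mat_def
    by (intro eq_matI) (auto simp: mat_of_cols_index)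
  moreover have "ctrb_mat A b \<in> carrier_mat n n" using calculation by simp
  ultimately show ?thesis
    unfolding controllable_def ctrb_det_def
    using vec_space.det_rank_iff[of "ctrb_mat A b" n] A by auto
qed

lemma det_zero_iff_left_kernel:
  fixes f :: "nat \<Rightarrow> nat \<Rightarrow> complex"
  shows "det (mat m m (\<lambda>(r, c). f r c)) = 0 \<longleftrightarrow>
    (\<exists>q. (\<exists>r<m. q r \<noteq> 0) \<and> (\<forall>c<m. (\<Sum>r<m. q r * f r c) = 0))" (is "det ?M = 0 \<longleftrightarrow> ?R")
proof -
  have "det ?M = det ?M\<^sup>T" by (simp add: det_transpose[of _ m])
  also have "\<dots> = 0 \<longleftrightarrow> (\<exists>v. v \<in> carrier_vec m \<and> v \<noteq> 0\<^sub>v m \<and> ?M\<^sup>T *\<^sub>v v = 0\<^sub>v m)"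
    by (rule det_0_iff_vec_prod_zero_field) simp
  also have "\<dots> \<longleftrightarrow> ?R"
  proof
    assume "\<exists>v. v \<in> carrier_vec m \<and> v \<noteq> 0\<^sub>v m \<and> ?M\<^sup>T *\<^sub>v v = 0\<^sub>v m"
    then obtain v where v: "v \<in> carrier_vec m" "v \<noteq> 0\<^sub>v m" "?M\<^sup>T *\<^sub>v v = 0\<^sub>v m" by auto
    have "\<exists>r<m. v $ r \<noteq> 0" using v(1,2) by (metis eq_vecI carrier_vecD index_zero_vec)
    moreover have "(\<Sum>r<m. v $ r * f r c) = 0" if "c < m" for c
    proof -
      have "(?M\<^sup>T *\<^sub>v v) $ c = (\<Sum>r<m. v $ r * f r c)"
        using that v(1) by (auto simp: scalar_prod_def lessThan_atLeast0 mult.commute intro!: sum.cong)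
      then show ?thesis using v(3) that by simp
    qed
    ultimately show ?R by blast
  next
    assume ?R
    then obtain q where q: "\<exists>r<m. q r \<noteq> 0" "\<And>c. c < m \<Longrightarrow> (\<Sum>r<m. q r * f r c) = 0" by auto
    have "?M\<^sup>T *\<^sub>v vec m q = 0\<^sub>v m"
    proof (rule eq_vecI)
      fix c assume c: "c < dim_vec (0\<^sub>v m :: complex vec)"
      then have "(?M\<^sup>T *\<^sub>v vec m q) $ c = (\<Sum>r<m. q r * f r c)"
        by (auto simp: scalar_prod_def lessThan_atLeast0 mult.commute intro!: sum.cong)
      then show "(?M\<^sup>T *\<^sub>v vec m q) $ c = 0\<^sub>v m $ c" using q(2) c by simp
    qed simp
    moreover have "vec m q \<noteq> 0\<^sub>v m" using q(1) by (metis index_vec index_zero_vec(1))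
    ultimately show "\<exists>v. v \<in> carrier_vec m \<and> v \<noteq> 0\<^sub>v m \<and> ?M\<^sup>T *\<^sub>v v = 0\<^sub>v m" by (metis vec_carrier)
  qed
  finally show ?thesis .
qed

lemma det_swap:
  fixes f :: "nat \<Rightarrow> nat \<Rightarrow> complex"
  shows "det (mat p p (\<lambda>(k, r). f r k)) = det (mat p p (\<lambda>(r, k). f r k))"
proof -
  have "mat p p (\<lambda>(k, r). f r k) = (mat p p (\<lambda>(r, k). f r k))\<^sup>T"
    by (rule eq_matI) auto
  then show ?thesis using det_transpose[of "mat p p (\<lambda>(r, k). f r k)" p] by simp
qed

lemma dependent_vectors:
  fixes y :: "nat \<Rightarrow> nat \<Rightarrow> complex"
  shows "\<exists>u. (\<exists>k\<le>n. u k \<noteq> 0) \<and> (\<forall>r<n. (\<Sum>k\<le>n. u k * y k r) = 0)"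
proof -
  let ?f = "\<lambda>k r. if r < n then y k r else 0"
  have "det (mat (Suc n) (Suc n) (\<lambda>(r, c). ?f c r)) = 0"
    unfolding det_zero_iff_left_kernel
    by (rule exI[of _ "\<lambda>r. if r = n then 1 else 0"]) (auto intro!: sum.neutral)
  then have "det (mat (Suc n) (Suc n) (\<lambda>(k, r). ?f k r)) = 0"
    unfolding det_swap[of "Suc n" "\<lambda>r k. ?f k r"] .
  then obtain u where u: "\<exists>k<Suc n. u k \<noteq> 0" "\<forall>r<Suc n. (\<Sum>k<Suc n. u k * ?f k r) = 0"
    unfolding det_zero_iff_left_kernel by blast
  have "(\<Sum>k\<le>n. u k * y k r) = 0" if "r < n" for r
    using u(2)[rule_format, of r] that by (simp add: lessThan_Suc_atMost)
  then show ?thesis using u(1) by (auto simp: less_Suc_eq_le)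
qed

text \<open>
  The Popov--Belevitch--Hautus test. A left eigenvector orthogonal to \<open>b\<close> is orthogonal to every
  \<open>A\<^sup>k b\<close>. Conversely, let \<open>q \<noteq> 0\<close> be orthogonal to \<open>b, \<dots>, A\<^sup>n\<^sup>-\<^sup>1 b\<close> and let \<open>p\<close> be a nonzero polynomial of
  least degree with \<open>q\<^sup>T p(A) = 0\<close>. For a root \<open>z\<close> of \<open>p = (x - z) p'\<close> the vector \<open>q\<^sup>T p'(A)\<close> is not
  zero, is a left eigenvector, and is orthogonal to \<open>b\<close> since \<open>p'\<close> has degree less than \<open>n\<close>.
\<close>

theorem ctrb_det_nonzero_iff:
  "ctrb_det n H \<noteq> 0 \<longleftrightarrow> (\<forall>z q. left_null n H z {..n} q \<longrightarrow> (\<forall>r<n. q r = 0))"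
proof -
  have "ctrb_det n H = 0 \<longleftrightarrow> (\<exists>z q. left_null n H z {..n} q \<and> (\<exists>r<n. q r \<noteq> 0))"
  proof
    assume "\<exists>z q. left_null n H z {..n} q \<and> (\<exists>r<n. q r \<noteq> 0)"
    then obtain z q where null: "left_null n H z {..n} q" and nz: "\<exists>r<n. q r \<noteq> 0" by auto
    have eig: "(\<Sum>r<n. q r * H r c) = z * q c" if "c < n" for c
    proof -
      have "(\<Sum>r<n. q r * (H r c - (if r = c then z else 0))) = 0"
        using null that unfolding left_null_def by auto
      moreover have "(\<Sum>r<n. q r * (H r c - (if r = c then z else 0)))
        = (\<Sum>r<n. q r * H r c) - (\<Sum>r<n. if r = c then z * q r else 0)"
        by (subst sum_subtractf[symmetric]) (auto intro!: sum.cong simp: algebra_simps)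
      ultimately show ?thesis using that by simp
    qed
    have "(\<Sum>r<n. q r * krylov n H k r) = 0" for k
    proof (induction k)
      case 0
      have "(\<Sum>r<n. q r * (H r n - (if r = n then z else 0))) = 0"
        using null unfolding left_null_def by (elim ballE[of _ _ n]) (auto simp del: mult_eq_0_iff)
      moreover have "(\<Sum>r<n. q r * (H r n - (if r = n then z else 0))) = (\<Sum>r<n. q r * H r n)"
        by (rule sum.cong) auto
      ultimately show ?case by simp
    next
      case (Suc k)
      have "(\<Sum>r<n. q r * krylov n H (Suc k) r) = (\<Sum>c<n. (\<Sum>r<n. q r * H r c) * krylov n H k c)"
        by (simp add: sum_distrib_left sum_distrib_right mult.assoc) (rule sum.swap)
      also have "\<dots> = (\<Sum>c<n. z * (q c * krylov n H k c))"
        by (intro sum.cong) (auto simp: eig)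
      also have "\<dots> = 0" using Suc by (simp flip: sum_distrib_left)
      finally show ?case .
    qed
    with nz show "ctrb_det n H = 0"
      unfolding ctrb_det_def det_zero_iff_left_kernel by blast
  next
    assume "ctrb_det n H = 0"
    then obtain q where nz: "\<exists>r<n. q r \<noteq> 0" and q: "\<forall>k<n. (\<Sum>r<n. q r * krylov n H k r) = 0"
      unfolding ctrb_det_def det_zero_iff_left_kernel by auto
    define y where "y = rec_nat q (\<lambda>_ v c. \<Sum>r<n. v r * H r c)"
    have y0: "y 0 = q" and ySuc: "y (Suc k) = (\<lambda>c. \<Sum>r<n. y k r * H r c)" for k
      by (simp_all add: y_def)
    have shift: "(\<Sum>r<n. y k r * krylov n H l r) = (\<Sum>r<n. q r * krylov n H (k + l) r)" for k l
    proof (induction k arbitrary: l)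
      case (Suc k)
      have "(\<Sum>c<n. y (Suc k) c * krylov n H l c) = (\<Sum>r<n. y k r * krylov n H (Suc l) r)"
        by (simp add: ySuc sum_distrib_left sum_distrib_right mult.assoc) (rule sum.swap)
      then show ?case using Suc[of "Suc l"] by (simp del: krylov.simps)
    qed (simp add: y0)
    define ev where "ev p r = (\<Sum>k\<le>n. coeff p k * y k r)" for p :: "complex poly" and r
    define Q where "Q p \<longleftrightarrow> p \<noteq> 0 \<and> degree p \<le> n \<and> (\<forall>r<n. ev p r = 0)" for p
    obtain u where u: "\<exists>k\<le>n. u k \<noteq> 0" "\<forall>r<n. (\<Sum>k\<le>n. u k * y k r) = 0"
      using dependent_vectors by blast
    define p0 where "p0 = (\<Sum>k\<le>n. monom (u k) k)"
    have cp0: "coeff p0 k = (if k \<le> n then u k else 0)" for k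
      by (simp add: p0_def coeff_sum coeff_monom)
    have "Q p0"
    proof -
      have "p0 \<noteq> 0" using u(1) cp0 by (metis coeff_0)
      moreover have "degree p0 \<le> n" by (rule degree_le) (simp add: cp0)
      ultimately show ?thesis using u(2) by (simp add: Q_def ev_def cp0)
    qed
    then obtain p where p: "Q p" and minp: "\<And>p'. degree p' < degree p \<Longrightarrow> \<not> Q p'"
      using ex_has_least_nat[of Q p0 degree] by (metis not_less)
    have "degree p \<noteq> 0"
    proof
      assume "degree p = 0"
      then obtain c where c: "p = [:c:]" by (rule degree_eq_zeroE)
      have "ev p r = c * q r" for r
      proof -
        have "ev p r = (\<Sum>k\<le>n. if k = 0 then c * y k r else 0)"
          unfolding ev_def c by (intro sum.cong) (auto simp: coeff_pCons split: nat.split)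
        then show ?thesis by (simp add: y0)
      qed
      then show False using p nz c unfolding Q_def by auto
    qed
    then obtain z where z: "poly p z = 0"
      using fundamental_theorem_of_algebra constant_degree by metis
    then obtain p' where p': "p = [:-z, 1:] * p'" unfolding poly_eq_0_iff_dvd by auto
    have p'0: "p' \<noteq> 0" using p p' unfolding Q_def by auto
    have deg: "degree p = Suc (degree p')"
      unfolding p' using p'0 by (subst degree_mult_eq) auto
    have "\<not> Q p'" using minp deg by simp
    then have nz': "\<exists>r<n. ev p' r \<noteq> 0" using p p'0 deg unfolding Q_def by auto
    have top: "coeff p' n = 0" using p deg unfolding Q_def by (intro coeff_eq_0) auto
    have evp: "ev p c = (\<Sum>r<n. ev p' r * H r c) - z * ev p' c" for c
    proof -
      have split: "p = pCons 0 p' - smult z p'" unfolding p' by simp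
      have "ev p c = (\<Sum>k\<le>n. coeff (pCons 0 p') k * y k c) - z * ev p' c"
        unfolding ev_def split by (simp add: algebra_simps sum_subtractf sum_distrib_left)
      also have "(\<Sum>k\<le>n. coeff (pCons 0 p') k * y k c) = (\<Sum>k\<le>n. coeff p' k * y (Suc k) c)"
      proof (cases n)
        case (Suc m)
        have "(\<Sum>k\<le>n. coeff (pCons 0 p') k * y k c) = (\<Sum>k\<le>m. coeff p' k * y (Suc k) c)"
          unfolding Suc sum.atMost_Suc_shift by simp
        also have "\<dots> = (\<Sum>k\<le>n. coeff p' k * y (Suc k) c)"
          using top unfolding Suc sum.atMost_Suc by simp
        finally show ?thesis .
      qed (use top in simp)
      also have "\<dots> = (\<Sum>r<n. ev p' r * H r c)"
        unfolding ev_def ySuc by (simp add: sum_distrib_left sum_distrib_right mult.assoc) (rule sum.swap)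
      finally show ?thesis .
    qed
    have evb: "(\<Sum>r<n. ev p' r * H r n) = 0"
    proof -
      have "(\<Sum>r<n. ev p' r * H r n) = (\<Sum>k\<le>n. coeff p' k * (\<Sum>r<n. y k r * H r n))"
        unfolding ev_def by (simp add: sum_distrib_left sum_distrib_right mult.assoc) (rule sum.swap)
      also have "\<dots> = 0"
      proof (rule sum.neutral, safe)
        fix k assume "k \<le> n"
        show "coeff p' k * (\<Sum>r<n. y k r * H r n) = 0"
          using top shift[of k 0] q \<open>k \<le> n\<close> by (cases "k = n") auto
      qed
      finally show ?thesis .
    qed
    have "left_null n H z {..n} (ev p')"
      unfolding left_null_def
    proof
      fix c assume "c \<in> {..n}"
      have "(\<Sum>r<n. ev p' r * (H r c - (if r = c then z else 0)))
        = (\<Sum>r<n. ev p' r * H r c) - (\<Sum>r<n. if r = c then z * ev p' r else 0)"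
        by (subst sum_subtractf[symmetric]) (auto intro!: sum.cong simp: algebra_simps)
      also have "\<dots> = 0"
      proof (cases "c < n")
        case True
        then show ?thesis using evp[of c] p unfolding Q_def by simp
      next
        case False
        then show ?thesis using evb \<open>c \<in> {..n}\<close> by simp
      qed
      finally show "(\<Sum>r<n. ev p' r * (H r c - (if r = c then z else 0))) = 0" .
    qed
    with nz' show "\<exists>z q. left_null n H z {..n} q \<and> (\<exists>r<n. q r \<noteq> 0)" by blast
  qed
  then show ?thesis by blast
qed

section \<open>Perturbation tolerance as independence of a polynomial from variables\<close>

text \<open>
  Matrices are functions here, so that the structures \<open>U\<close> to be compared can be taken as subsets of
  one set of positions with a common assignment \<open>a\<close> of values.
\<close>

definition star_fun ::
  "(nat \<times> nat) set \<Rightarrow> (nat \<times> nat \<Rightarrow> complex) \<Rightarrow> nat \<Rightarrow> nat \<Rightarrow> complex" where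
  "star_fun U a r c = (if (r, c) \<in> U then a (r, c) else 0)"

abbreviation ctrb_poly :: "nat \<Rightarrow> (nat \<times> nat) set \<Rightarrow> (nat \<times> nat \<Rightarrow> complex) \<Rightarrow> complex" where
  "ctrb_poly n U a \<equiv> ctrb_det n (star_fun U a)"

lemma multi_poly_star_fun: "multi_poly (\<lambda>a. star_fun U a r c)"
  unfolding star_fun_def by (cases "(r, c) \<in> U") (auto intro: multi_poly_coord poly_expr_const)

lemma multi_poly_ctrb_poly: "multi_poly (ctrb_poly n U)"
proof -
  have "multi_poly (\<lambda>a. krylov n (star_fun U a) k r)" for k r
    by (induction k arbitrary: r)
      (auto intro!: multi_poly_star_fun poly_expr_sum poly_expr_mult)
  then show ?thesis
    unfolding ctrb_det_def by (intro poly_expr_det[of _ n]) auto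
qed

lemma stars_carrier:
  assumes "M \<in> carrier_mat n (n + 1)"
  shows "stars M \<subseteq> {..<n} \<times> {..n}" "finite (stars M)"
proof -
  show "stars M \<subseteq> {..<n} \<times> {..n}" using assms unfolding stars_def by auto
  then show "finite (stars M)" by (rule finite_subset) auto
qed

lemma pair_mat_carrier:
  assumes "A \<in> carrier_mat n n" shows "pair_mat A b \<in> carrier_mat n (n + 1)"
  using assms by (auto simp: pair_mat_def)

lemma pair_mat_realize:
  assumes "Abar \<in> carrier_mat n n" "bbar \<in> carrier_vec n" "realize Abar bbar v = (A, b)"
    and "r < n" "c \<le> n"
  shows "pair_mat A b $$ (r, c) = star_fun (stars (pair_mat Abar bbar)) v r c"
  using assms by (auto simp: realize_def pair_mat_def star_fun_def stars_def)

lemma realize_carrier: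
  assumes "Abar \<in> carrier_mat n n" "bbar \<in> carrier_vec n" "realize Abar bbar v = (A, b)"
  shows "A \<in> carrier_mat n n" "b \<in> carrier_vec n"
  using assms by (auto simp: realize_def)

lemma realization_iff:
  assumes "N \<in> carrier_mat n m" "M \<in> carrier_mat n m"
  shows "M \<in> realizations N \<longleftrightarrow> (\<forall>r<n. \<forall>c<m. (r, c) \<notin> stars N \<longrightarrow> M $$ (r, c) = 0)"
  using assms unfolding realizations_def stars_def by auto

lemma realize_in_CS_iff:
  assumes "Abar \<in> carrier_mat n n" "bbar \<in> carrier_vec n" "realize Abar bbar v = (A, b)"
  shows "(A, b) \<in> CS Abar bbar \<longleftrightarrow> ctrb_poly n (stars (pair_mat Abar bbar)) v \<noteq> 0"
proof -
  note car = realize_carrier[OF assms]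
  have "pair_mat A b \<in> realizations (pair_mat Abar bbar)"
    using pair_mat_realize[OF assms]
    by (subst realization_iff[of _ n "n + 1"])
      (auto simp: pair_mat_carrier[simplified] assms(1) car star_fun_def less_Suc_eq_le)
  then have "(A, b) \<in> CS Abar bbar \<longleftrightarrow> controllable A b"
    using assms(1,2) car by (auto simp: CS_def)
  also have "\<dots> \<longleftrightarrow> ctrb_poly n (stars (pair_mat Abar bbar)) v \<noteq> 0"
    unfolding controllable_iff_ctrb_det[OF car]
    by (subst ctrb_det_cong[OF pair_mat_realize[OF assms]]) auto
  finally show ?thesis .
qed

lemma struct_controllable_iff:
  assumes "Abar \<in> carrier_mat n n" "bbar \<in> carrier_vec n"
  shows "struct_controllable Abar bbar \<longleftrightarrow> (\<exists>a. ctrb_poly n (stars (pair_mat Abar bbar)) a \<noteq> 0)"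
proof
  assume "struct_controllable Abar bbar"
  then obtain A b where "(A, b) \<in> CS Abar bbar" unfolding struct_controllable_def by auto
  then have A: "A \<in> carrier_mat n n" and b: "b \<in> carrier_vec n"
    and re: "pair_mat A b \<in> realizations (pair_mat Abar bbar)" and ctr: "controllable A b"
    using assms by (auto simp: CS_def)
  have "pair_mat A b $$ (r, c) = star_fun (stars (pair_mat Abar bbar)) (($$) (pair_mat A b)) r c"
    if "r < n" "c \<le> n" for r c
    using re that unfolding star_fun_def
    by (subst (asm) realization_iff[of _ n "n + 1"])
      (auto simp: pair_mat_carrier[simplified] assms(1) A less_Suc_eq_le)
  then have "ctrb_poly n (stars (pair_mat Abar bbar)) (($$) (pair_mat A b)) \<noteq> 0"
    using ctr unfolding controllable_iff_ctrb_det[OF A b]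
    by (metis (no_types, lifting) ctrb_det_cong)
  then show "\<exists>a. ctrb_poly n (stars (pair_mat Abar bbar)) a \<noteq> 0" by blast
next
  assume "\<exists>a. ctrb_poly n (stars (pair_mat Abar bbar)) a \<noteq> 0"
  then obtain a where a: "ctrb_poly n (stars (pair_mat Abar bbar)) a \<noteq> 0" by auto
  obtain A b where Ab: "realize Abar bbar a = (A, b)" by fastforce
  show "struct_controllable Abar bbar"
    using realize_in_CS_iff[OF assms Ab] a unfolding struct_controllable_def by auto
qed

text \<open>
  A perturbation overwrites the entries in \<open>F\<close> by arbitrary values, whether or not they were stars
  before, and leaves the other entries unchanged.
\<close>

lemma PTC_realize_iff:
  assumes "Abar \<in> carrier_mat n n" "bbar \<in> carrier_vec n" "Fbar \<in> carrier_mat n (n + 1)"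
    and Ab: "realize Abar bbar v = (A, b)"
    and S: "S = stars (pair_mat Abar bbar)" and F: "F = stars Fbar"
  shows "PTC A b Fbar \<longleftrightarrow> (\<forall>a. (\<forall>p\<in>S - F. a p = v p) \<longrightarrow> ctrb_poly n (S \<union> F) a \<noteq> 0)"
proof -
  note car = realize_carrier[OF assms(1,2,4)]
  have pert: "controllable (A + dA) (b + db) \<longleftrightarrow> ctrb_poly n (S \<union> F) a \<noteq> 0"
    if d: "dA \<in> carrier_mat n n" "db \<in> carrier_vec n"
      and eq: "\<And>r c. r < n \<Longrightarrow> c \<le> n \<Longrightarrow>
        star_fun S v r c + pair_mat dA db $$ (r, c) = star_fun (S \<union> F) a r c"
    for dA db a
  proof -
    have "pair_mat (A + dA) (b + db) $$ (r, c) = star_fun (S \<union> F) a r c" if rc: "r < n" "c \<le> n" for r c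
    proof -
      have "pair_mat (A + dA) (b + db) $$ (r, c) = pair_mat A b $$ (r, c) + pair_mat dA db $$ (r, c)"
        using car d rc by (auto simp: pair_mat_def)
      then show ?thesis using eq[OF rc] pair_mat_realize[OF assms(1,2,4) rc] S by simp
    qed
    moreover have "A + dA \<in> carrier_mat n n" "b + db \<in> carrier_vec n" using car d by auto
    ultimately show ?thesis
      using controllable_iff_ctrb_det[of "A + dA" n "b + db"]
        ctrb_det_cong[of n "\<lambda>r c. pair_mat (A + dA) (b + db) $$ (r, c)" "star_fun (S \<union> F) a"] by auto
  qed
  show ?thesis
  proof
    assume L: "PTC A b Fbar"
    show "\<forall>a. (\<forall>p\<in>S - F. a p = v p) \<longrightarrow> ctrb_poly n (S \<union> F) a \<noteq> 0"
    proof (intro allI impI)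
      fix a assume a: "\<forall>p\<in>S - F. a p = v p"
      define w where "w r c = star_fun (S \<union> F) a r c - star_fun S v r c" for r c
      let ?dA = "mat n n (\<lambda>(r, c). w r c)" and ?db = "vec n (\<lambda>r. w r n)"
      have ent: "pair_mat ?dA ?db $$ (r, c) = w r c" if "r < n" "c \<le> n" for r c
        using that by (auto simp: pair_mat_def)
      have "w r c = 0" if "(r, c) \<notin> F" for r c
        using a that by (auto simp: w_def star_fun_def)
      then have "pair_mat ?dA ?db \<in> realizations Fbar"
        using ent assms(3) F
        by (subst realization_iff[of _ n "n + 1"])
          (auto simp: pair_mat_carrier[simplified] less_Suc_eq_le)
      then have "controllable (A + ?dA) (b + ?db)"
        using L car unfolding PTC_def by auto
      then show "ctrb_poly n (S \<union> F) a \<noteq> 0"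
      proof (subst (asm) pert[of _ _ a])
        fix r c assume "r < n" "c \<le> n"
        then show "star_fun S v r c + pair_mat ?dA ?db $$ (r, c) = star_fun (S \<union> F) a r c"
          by (subst ent) (auto simp: w_def)
      qed auto
    qed
  next
    assume R: "\<forall>a. (\<forall>p\<in>S - F. a p = v p) \<longrightarrow> ctrb_poly n (S \<union> F) a \<noteq> 0"
    show "PTC A b Fbar"
      unfolding PTC_def
    proof (intro ballI impI)
      fix dA db assume dA: "dA \<in> carrier_mat (dim_row A) (dim_col A)"
        and db: "db \<in> carrier_vec (dim_vec b)" and re: "pair_mat dA db \<in> realizations Fbar"
      have d: "dA \<in> carrier_mat n n" "db \<in> carrier_vec n" using dA db car by auto
      define a where "a = (\<lambda>(r, c). star_fun S v r c + pair_mat dA db $$ (r, c))"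
      have out: "pair_mat dA db $$ (r, c) = 0" if "(r, c) \<notin> F" "r < n" "c \<le> n" for r c
        using re that F d
        by (subst (asm) realization_iff[of _ n "n + 1"]) (auto simp: pair_mat_carrier[simplified] assms(3)[simplified])
      have Sub: "S \<subseteq> {..<n} \<times> {..n}"
        unfolding S by (rule stars_carrier[OF pair_mat_carrier[OF assms(1)]])
      have "\<forall>p\<in>S - F. a p = v p" using out Sub by (auto simp: a_def star_fun_def)
      then have "ctrb_poly n (S \<union> F) a \<noteq> 0" using R by blast
      then show "controllable (A + dA) (b + db)"
        by (subst pert[OF d, of a]) (use out in \<open>auto simp: a_def star_fun_def\<close>)
    qed
  qed
qed

text \<open>
  If \<open>P\<close> depends on the variable of some \<open>e \<in> F\<close>, then for almost all values of the remaining variables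
  it is a nonconstant polynomial in that variable, so it has a zero and the realization is not
  tolerant. If \<open>P\<close> depends on no variable of \<open>F\<close>, no perturbation changes its value.
\<close>

theorem PTSC_iff_independent:
  assumes Abar: "Abar \<in> carrier_mat n n" and bbar: "bbar \<in> carrier_vec n"
    and Fbar: "Fbar \<in> carrier_mat n (n + 1)" and sc: "struct_controllable Abar bbar"
    and S: "S = stars (pair_mat Abar bbar)" and F: "F = stars Fbar"
  shows "PTSC Abar bbar Fbar \<longleftrightarrow>
    (\<forall>e\<in>F. \<forall>a y. ctrb_poly n (S \<union> F) (a(e := y)) = ctrb_poly n (S \<union> F) a)"
proof -
  let ?P = "ctrb_poly n (S \<union> F)"
  have finS: "finite S" unfolding S by (rule stars_carrier[OF pair_mat_carrier[OF Abar]])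
  have finF: "finite F" unfolding F by (rule stars_carrier[OF Fbar])
  have ext: "star_fun (S \<union> F) (overwrite (\<lambda>_. 0) S v) = star_fun S v" for v
    by (auto simp: star_fun_def overwrite_def fun_eq_iff)
  show ?thesis
  proof
    assume PTSC: "PTSC Abar bbar Fbar"
    show "\<forall>e\<in>F. \<forall>a y. ?P (a(e := y)) = ?P a"
    proof (rule ccontr)
      assume "\<not> (\<forall>e\<in>F. \<forall>a y. ?P (a(e := y)) = ?P a)"
      then obtain e a0 y where e: "e \<in> F" and neq: "?P (a0(e := y)) - ?P a0 \<noteq> 0" by auto
      obtain a1 where a1: "ctrb_poly n S a1 \<noteq> 0"
        using sc struct_controllable_iff[OF Abar bbar] S by auto
      have "AE v in PiM S (\<lambda>_. lborel :: complex measure).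
          ?P ((overwrite a0 (S - F) v)(e := y)) - ?P (overwrite a0 (S - F) v) \<noteq> 0"
      proof -
        let ?g = "\<lambda>a. ?P ((overwrite a0 (S - F) a)(e := y)) - ?P (overwrite a0 (S - F) a)"
        have ov: "multi_poly (\<lambda>a. f (overwrite a0 (S - F) a))" if "multi_poly f" for f
        proof (rule multi_poly_compose[OF that])
          show "multi_poly (\<lambda>a. overwrite a0 (S - F) a p)" for p
            unfolding overwrite_def
            by (cases "p \<in> S - F") (simp_all only: if_True if_False poly_expr_const multi_poly_coord)
        qed
        have "multi_poly ?g"
          by (intro poly_expr_diff ov multi_poly_upd multi_poly_ctrb_poly)
        moreover have "?g a0 \<noteq> 0"
        proof -
          have "overwrite a0 (S - F) a0 = a0" by (auto simp: overwrite_def)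
          then show ?thesis using neq by simp
        qed
        ultimately have "AE v in PiM S (\<lambda>_. lborel :: complex measure). ?g (overwrite a0 S v) \<noteq> 0"
          using AE_multi_poly_nonzero[of ?g, OF _ finS] by blast
        moreover have "overwrite a0 (S - F) (overwrite a0 S v) = overwrite a0 (S - F) v" for v
          by (auto simp: overwrite_def fun_eq_iff)
        ultimately show ?thesis by simp
      qed
      moreover have "AE v in PiM S (\<lambda>_. lborel :: complex measure).
          ctrb_poly n S v \<noteq> 0"
      proof -
        have "?P (overwrite (\<lambda>_. 0) S a1) \<noteq> 0" using a1 ext by simp
        then have "AE v in PiM S (\<lambda>_. lborel :: complex measure).
            ?P (overwrite (overwrite (\<lambda>_. 0) S a1) S v) \<noteq> 0"
          by (rule AE_multi_poly_nonzero[OF multi_poly_ctrb_poly finS])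
        moreover have "overwrite (overwrite (\<lambda>_. 0) S a1) S v = overwrite (\<lambda>_. 0) S v" for v
          by (auto simp: overwrite_def)
        ultimately show ?thesis by (simp add: ext)
      qed
      moreover have "AE v in PiM S (\<lambda>_. lborel :: complex measure).
        case realize Abar bbar v of (A, b) \<Rightarrow> (A, b) \<in> CS Abar bbar \<longrightarrow> PTC A b Fbar"
        using PTSC unfolding PTSC_def S by auto
      ultimately have "AE v in PiM S (\<lambda>_. lborel :: complex measure). False"
      proof eventually_elim
        fix v
        let ?a = "overwrite a0 (S - F) v"
        assume neq: "?P (?a(e := y)) - ?P ?a \<noteq> 0" and ctr: "ctrb_poly n S v \<noteq> 0"
          and imp: "case realize Abar bbar v of (A, b) \<Rightarrow> (A, b) \<in> CS Abar bbar \<longrightarrow> PTC A b Fbar"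
        obtain A b where Ab: "realize Abar bbar v = (A, b)" by fastforce
        have "\<exists>z. ?P (?a(e := z)) = 0"
        proof (rule uni_poly_has_zero[OF uni_poly_upd[OF multi_poly_ctrb_poly]])
          show "?P (?a(e := y)) \<noteq> ?P (?a(e := ?a e))" using neq by simp
        qed
        then obtain z where "?P (?a(e := z)) = 0" by auto
        moreover have "\<forall>p\<in>S - F. (?a(e := z)) p = v p" using e by (auto simp: overwrite_def)
        ultimately have "\<not> PTC A b Fbar"
          using PTC_realize_iff[OF Abar bbar Fbar Ab S F] by blast
        moreover have "(A, b) \<in> CS Abar bbar"
          using realize_in_CS_iff[OF Abar bbar Ab] ctr S by simp
        ultimately show False using imp Ab by simp
      qed
      then show False using not_AE_False_PiM_lborel[OF finS] by blast
    qed
  next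
    assume ind: "\<forall>e\<in>F. \<forall>a y. ?P (a(e := y)) = ?P a"
    have indF: "?P (overwrite a T w) = ?P a" if "T \<subseteq> F" "finite T" for T a w
      using that(2,1)
    proof (induction T)
      case empty
      then show ?case by (simp add: overwrite_def)
    next
      case (insert x T)
      have "overwrite a (insert x T) w = (overwrite a T w)(x := w x)"
        by (auto simp: overwrite_def fun_eq_iff)
      then show ?case using insert.IH insert.prems ind by (metis insert_subset)
    qed
    have "(A, b) \<in> CS Abar bbar \<longrightarrow> PTC A b Fbar" if Ab: "realize Abar bbar v = (A, b)" for v A b
    proof
      assume "(A, b) \<in> CS Abar bbar"
      then have nz: "?P (overwrite (\<lambda>_. 0) S v) \<noteq> 0"
        using realize_in_CS_iff[OF Abar bbar Ab] ext S by simp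
      show "PTC A b Fbar"
        unfolding PTC_realize_iff[OF Abar bbar Fbar Ab S F]
      proof (intro allI impI)
        fix a assume a: "\<forall>p\<in>S - F. a p = v p"
        have "star_fun (S \<union> F) (overwrite (overwrite (\<lambda>_. 0) S v) F a) = star_fun (S \<union> F) a"
          using a by (auto simp: star_fun_def overwrite_def fun_eq_iff)
        then show "?P a \<noteq> 0" using nz indF[OF subset_refl finF] by metis
      qed
    qed
    then show "PTSC Abar bbar Fbar" unfolding PTSC_def using sc by auto
  qed
qed

section \<open>Determinants of the bordered pencil\<close>

definition pencil :: "(nat \<times> nat) set \<Rightarrow> complex \<Rightarrow> (nat \<times> nat \<Rightarrow> complex) \<Rightarrow> nat \<Rightarrow> nat \<Rightarrow> complex" where
  "pencil U z a r c = star_fun U a r c - (if r = c then z else 0)"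

text \<open>
  Replacing row \<open>r\<close> by the unit vector at column \<open>\<tau> r\<close> deletes that row and that column from the
  determinant. An extra row \<open>n\<close> makes the \<open>n \<times> (n + 1)\<close> pencil square. In this way all minors are
  determinants of the same size and no columns have to be renumbered.
\<close>

definition bordered ::
  "(nat \<times> nat) set \<Rightarrow> nat set \<Rightarrow> (nat \<Rightarrow> nat) \<Rightarrow> complex \<Rightarrow> (nat \<times> nat \<Rightarrow> complex) \<Rightarrow> nat \<Rightarrow> nat \<Rightarrow> complex"
  where
  "bordered U Z \<tau> z a r c =
     (if r \<in> Z then (if c = \<tau> r then 1 else 0) else pencil U z a r c)"

definition bdet ::
  "nat \<Rightarrow> (nat \<times> nat) set \<Rightarrow> nat set \<Rightarrow> (nat \<Rightarrow> nat) \<Rightarrow> complex \<Rightarrow> (nat \<times> nat \<Rightarrow> complex) \<Rightarrow> complex"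
  where
  "bdet n U Z \<tau> z a = det (mat (Suc n) (Suc n) (\<lambda>(r, c). bordered U Z \<tau> z a r c))"

lemma det_Leibniz:
  fixes f :: "nat \<Rightarrow> nat \<Rightarrow> complex"
  shows "det (mat (Suc n) (Suc n) (\<lambda>(r, c). f r c)) =
    (\<Sum>p | p permutes {..n}. signof p * (\<Prod>r\<le>n. f r (p r)))"
proof -
  have "det (mat (Suc n) (Suc n) (\<lambda>(r, c). f r c)) =
    (\<Sum>p | p permutes {0..<Suc n}. signof p *
      (\<Prod>r = 0..<Suc n. mat (Suc n) (Suc n) (\<lambda>(r, c). f r c) $$ (r, p r)))"
    by (rule det_def') simp
  also have "\<dots> = (\<Sum>p | p permutes {0..<Suc n}. signof p * (\<Prod>r = 0..<Suc n. f r (p r)))"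
  proof (intro sum.cong refl arg_cong2[of _ _ _ _ "(*)"] prod.cong)
    fix p r assume "p \<in> {p. p permutes {0..<Suc n}}" "r \<in> {0..<Suc n}"
    then show "mat (Suc n) (Suc n) (\<lambda>(r, c). f r c) $$ (r, p r) = f r (p r)"
      using permutes_in_image[of p "{0..<Suc n}" r] by auto
  qed
  finally show ?thesis by (simp only: atLeast0LessThan lessThan_Suc_atMost)
qed

lemma bdet_Leibniz:
  "bdet n U Z \<tau> z a = (\<Sum>p | p permutes {..n}. signof p * (\<Prod>r\<le>n. bordered U Z \<tau> z a r (p r)))"
  unfolding bdet_def by (rule det_Leibniz)

lemma det_scale_rows:
  fixes f g :: "nat \<Rightarrow> nat \<Rightarrow> complex"
  assumes "\<And>r c. r \<le> n \<Longrightarrow> c \<le> n \<Longrightarrow> f r c = s r * g r c"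
  shows "det (mat (Suc n) (Suc n) (\<lambda>(r, c). f r c))
    = (\<Prod>r\<le>n. s r) * det (mat (Suc n) (Suc n) (\<lambda>(r, c). g r c))"
proof -
  have "(\<Prod>r\<le>n. f r (p r)) = (\<Prod>r\<le>n. s r) * (\<Prod>r\<le>n. g r (p r))" if "p permutes {..n}" for p
  proof -
    have "(\<Prod>r\<le>n. f r (p r)) = (\<Prod>r\<le>n. s r * g r (p r))"
      using permutes_in_image[OF that] by (intro prod.cong) (auto simp: assms)
    then show ?thesis by (simp add: prod.distrib)
  qed
  then show ?thesis
    unfolding det_Leibniz sum_distrib_left by (intro sum.cong) (auto simp: mult_ac)
qed

lemma multi_poly_bdet: "multi_poly (bdet n U Z \<tau> z)"
proof -
  have "multi_poly (\<lambda>a. bordered U Z \<tau> z a r c)" for r c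
    unfolding bordered_def pencil_def
    by (intro poly_expr_if poly_expr_const poly_expr_diff multi_poly_star_fun)
  then show ?thesis unfolding bdet_def by (intro poly_expr_det[of _ "Suc n"]) auto
qed

lemma uni_poly_bdet: "uni_poly (\<lambda>z. bdet n U Z \<tau> z a)"
proof -
  have "uni_poly (\<lambda>z. bordered U Z \<tau> z a r c)" for r c
    unfolding bordered_def pencil_def
    by (intro poly_expr_if poly_expr_const poly_expr_diff uni_poly_id)
  then show ?thesis unfolding bdet_def by (intro poly_expr_det[of _ "Suc n"]) auto
qed

text \<open>
  Each term of the Leibniz formula contains the entry \<open>x\<close> at most once.
\<close>

lemma bdet_affine:
  "bdet n U Z \<tau> z (a(x := y)) =
     bdet n U Z \<tau> z (a(x := 0)) + y * (bdet n U Z \<tau> z (a(x := 1)) - bdet n U Z \<tau> z (a(x := 0)))"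
proof -
  obtain r c where x: "x = (r, c)" by fastforce
  let ?b = "\<lambda>y. bordered U Z \<tau> z (a(x := y))"
  have other: "?b y r' c' = ?b y' r' c'" if "(r', c') \<noteq> x" for r' c' y y'
    using that by (auto simp: bordered_def pencil_def star_fun_def)
  have prod_eq: "(\<Prod>r\<le>n. ?b y r (p r)) = (\<Prod>r\<le>n. ?b 0 r (p r))
      + y * ((\<Prod>r\<le>n. ?b 1 r (p r)) - (\<Prod>r\<le>n. ?b 0 r (p r)))" for p
  proof (cases "r \<le> n \<and> p r = c")
    case True
    have rest: "(\<Prod>r'\<in>{..n} - {r}. ?b y r' (p r')) = (\<Prod>r'\<in>{..n} - {r}. ?b 0 r' (p r'))" for y
      by (intro prod.cong refl other) (auto simp: x)
    have row: "(\<Prod>r\<le>n. ?b y r (p r)) = ?b y r c * (\<Prod>r'\<in>{..n} - {r}. ?b 0 r' (p r'))" for y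
      using True rest[of y] by (subst prod.remove[of _ r]) auto
    have "?b y r c = ?b 0 r c + y * (?b 1 r c - ?b 0 r c)"
      by (auto simp: bordered_def pencil_def star_fun_def x)
    moreover have "(B + y * (C - B)) * R = B * R + y * (C * R - B * R)" for B C R :: complex
      by (simp add: algebra_simps)
    ultimately show ?thesis unfolding row[of y] row[of 0] row[of 1] by simp
  next
    case False
    have "(\<Prod>r\<le>n. ?b y r (p r)) = (\<Prod>r\<le>n. ?b 0 r (p r))" for y
      using False by (intro prod.cong refl other) (auto simp: x)
    from this[of y] this[of 1] show ?thesis by simp
  qed
  show ?thesis
    unfolding bdet_Leibniz
    by (subst prod_eq) (simp add: algebra_simps sum.distrib sum_subtractf sum_distrib_left)
qed

text \<open>
  A row \<open>e\<^sub>c\<close> removes column \<open>c\<close>, and with it every parameter in that column.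
\<close>

lemma bdet_independent:
  assumes "s \<in> Z" "s \<le> n" "\<tau> s = c"
  shows "bdet n U Z \<tau> z (a((r, c) := y)) = bdet n U Z \<tau> z a"
  unfolding bdet_Leibniz
proof (intro sum.cong refl arg_cong2[of _ _ _ _ "(*)"])
  fix p assume p: "p \<in> {p. p permutes {..n}}"
  show "(\<Prod>r'\<le>n. bordered U Z \<tau> z (a((r, c) := y)) r' (p r')) = (\<Prod>r'\<le>n. bordered U Z \<tau> z a r' (p r'))"
  proof (cases "r \<le> n \<and> p r = c \<and> r \<notin> Z")
    case True
    then have "r \<noteq> s" using assms(1) by auto
    then have "p s \<noteq> c" using True p permutes_inj[of p "{..n}"] by (auto dest: injD)
    then have "bordered U Z \<tau> z w s (p s) = 0" for w using assms by (simp add: bordered_def)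
    then have "(\<Prod>r'\<le>n. bordered U Z \<tau> z w r' (p r')) = 0" for w
      using assms(2) by (intro prod_zero) auto
    from this[of a] this[of "a((r, c) := y)"] show ?thesis by (simp only:)
  next
    case False
    then show ?thesis
      by (intro prod.cong) (auto simp: bordered_def pencil_def star_fun_def)
  qed
qed

abbreviation deleted_det :: "nat \<Rightarrow> (nat \<times> nat) set \<Rightarrow> nat \<Rightarrow> complex \<Rightarrow> (nat \<times> nat \<Rightarrow> complex) \<Rightarrow> complex"
  where "deleted_det n U j \<equiv> bdet n U {n} (\<lambda>_. j)"

abbreviation deleted_minor ::
  "nat \<Rightarrow> (nat \<times> nat) set \<Rightarrow> nat \<Rightarrow> nat \<Rightarrow> nat \<Rightarrow> complex \<Rightarrow> (nat \<times> nat \<Rightarrow> complex) \<Rightarrow> complex"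
  where "deleted_minor n U j i c \<equiv> bdet n U {n, i} (\<lambda>r. if r = n then j else c)"

abbreviation deleted_null ::
  "nat \<Rightarrow> (nat \<times> nat) set \<Rightarrow> nat \<Rightarrow> complex \<Rightarrow> (nat \<times> nat \<Rightarrow> complex) \<Rightarrow> (nat \<Rightarrow> complex) \<Rightarrow> bool"
  where "deleted_null n U j z a q \<equiv> left_null n (star_fun U a) z ({..n} - {j}) q"

lemma left_null_pencil:
  "left_null n (star_fun U a) z C q \<longleftrightarrow> (\<forall>c\<in>C. (\<Sum>r<n. q r * pencil U z a r c) = 0)"
  by (simp add: left_null_def pencil_def)

lemma bdet_zero_iff:
  "bdet n U Z \<tau> z a = 0 \<longleftrightarrow>
    (\<exists>q. (\<exists>r\<le>n. q r \<noteq> 0) \<and> (\<forall>c\<le>n. (\<Sum>r\<le>n. q r * bordered U Z \<tau> z a r c) = 0))"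
  unfolding bdet_def det_zero_iff_left_kernel by (simp add: less_Suc_eq_le lessThan_Suc_atMost)

lemma sum_atMost_split_last: "(\<Sum>r\<le>n. f r) = (\<Sum>r<n. f r) + (f n :: 'a :: comm_monoid_add)" for n :: nat
  by (simp flip: lessThan_Suc_atMost)

lemma deleted_det_zero_iff:
  assumes "j \<le> n"
  shows "deleted_det n U j z a = 0 \<longleftrightarrow> (\<exists>q. (\<exists>r<n. q r \<noteq> 0) \<and> deleted_null n U j z a q)"
proof -
  have sum: "(\<Sum>r\<le>n. q r * bordered U {n} (\<lambda>_. j) z a r c)
      = (\<Sum>r<n. q r * pencil U z a r c) + (if c = j then q n else 0)" for q c
    unfolding sum_atMost_split_last by (auto simp: bordered_def intro!: sum.cong)
  show ?thesis
  proof
    assume "deleted_det n U j z a = 0"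
    then obtain q where nz: "\<exists>r\<le>n. q r \<noteq> 0"
      and q: "\<forall>c\<le>n. (\<Sum>r<n. q r * pencil U z a r c) + (if c = j then q n else 0) = 0"
      unfolding bdet_zero_iff sum by auto
    have null: "deleted_null n U j z a q"
      unfolding left_null_pencil
    proof
      fix c assume "c \<in> {..n} - {j}"
      then show "(\<Sum>r<n. q r * pencil U z a r c) = 0" using q[rule_format, of c] by simp
    qed
    moreover have "\<exists>r<n. q r \<noteq> 0"
    proof (rule ccontr)
      assume no: "\<not> (\<exists>r<n. q r \<noteq> 0)"
      then have "q n = 0" using q assms by (auto dest!: spec[of _ j])
      then show False using no nz by (metis le_neq_implies_less)
    qed
    ultimately show "\<exists>q. (\<exists>r<n. q r \<noteq> 0) \<and> deleted_null n U j z a q" by blast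
  next
    assume "\<exists>q. (\<exists>r<n. q r \<noteq> 0) \<and> deleted_null n U j z a q"
    then obtain q where nz: "\<exists>r<n. q r \<noteq> 0" and q: "deleted_null n U j z a q" by auto
    let ?q = "q(n := - (\<Sum>r<n. q r * pencil U z a r j))"
    have "(\<Sum>r<n. ?q r * pencil U z a r c) = (\<Sum>r<n. q r * pencil U z a r c)" for c
      by (intro sum.cong) auto
    then have "\<forall>c\<le>n. (\<Sum>r<n. ?q r * pencil U z a r c) + (if c = j then ?q n else 0) = 0"
      using q unfolding left_null_pencil by auto
    moreover have "\<exists>r\<le>n. ?q r \<noteq> 0" using nz by (auto intro: less_imp_le)
    ultimately show "deleted_det n U j z a = 0" unfolding bdet_zero_iff sum by blast
  qed
qed

lemma deleted_minor_nonzero: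
  assumes "j \<le> n" "i < n" "deleted_minor n U j i c z a \<noteq> 0"
    and null: "deleted_null n U j z a q" and qi: "q i = 0" and r: "r < n"
  shows "q r = 0"
proof (rule ccontr)
  assume "q r \<noteq> 0"
  let ?q = "q(n := - (\<Sum>r<n. q r * pencil U z a r j))"
  have "(\<Sum>r\<le>n. ?q r * bordered U {n, i} (\<lambda>r. if r = n then j else c) z a r c') = 0" if "c' \<le> n" for c'
  proof -
    have "(\<Sum>r<n. ?q r * bordered U {n, i} (\<lambda>r. if r = n then j else c) z a r c')
        = (\<Sum>r<n. q r * pencil U z a r c')"
      using qi by (intro sum.cong) (auto simp: bordered_def)
    then show ?thesis
      unfolding sum_atMost_split_last using null that unfolding left_null_pencil
      by (auto simp: bordered_def)
  qed
  moreover have "\<exists>r\<le>n. ?q r \<noteq> 0" using \<open>q r \<noteq> 0\<close> r by (intro exI[of _ r]) auto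
  ultimately have "deleted_minor n U j i c z a = 0" unfolding bdet_zero_iff by blast
  with assms(3) show False by simp
qed

lemma deleted_null_nonzero_at:
  assumes "j \<le> n" "i < n" "deleted_det n U j z a = 0" "deleted_minor n U j i c z a \<noteq> 0"
  shows "\<exists>q. deleted_null n U j z a q \<and> q i \<noteq> 0"
  using assms deleted_det_zero_iff deleted_minor_nonzero by meson

section \<open>Permutations supported on the graph\<close>

definition indicator_of :: "(nat \<Rightarrow> nat) \<Rightarrow> nat \<times> nat \<Rightarrow> complex" where
  "indicator_of \<pi> = (\<lambda>(r, c). if c = \<pi> r then 1 else 0)"

text \<open>
  The permutations that can contribute to the Leibniz formula for \<open>bdet n U Z \<tau>\<close>: the edges of the
  graph are the stars and the diagonal positions, and the rows in \<open>Z\<close> are fixed.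
\<close>

definition supported :: "nat \<Rightarrow> (nat \<times> nat) set \<Rightarrow> nat set \<Rightarrow> (nat \<Rightarrow> nat) \<Rightarrow> (nat \<Rightarrow> nat) \<Rightarrow> bool" where
  "supported n U Z \<tau> \<pi> \<longleftrightarrow> \<pi> permutes {..n} \<and>
     (\<forall>r\<le>n. if r \<in> Z then \<pi> r = \<tau> r else (r, \<pi> r) \<in> U \<or> \<pi> r = r)"

lemma det_permutation:
  assumes "\<pi> permutes {..n}"
  shows "det (mat (Suc n) (Suc n) (\<lambda>(r, c). if c = \<pi> r then 1 else 0 :: complex)) = signof \<pi>"
proof -
  have "(\<Prod>r\<le>n. if p r = \<pi> r then 1 else 0 :: complex) = (if p = \<pi> then 1 else 0)"
    if "p permutes {..n}" for p
  proof (cases "p = \<pi>")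
    case False
    then obtain r where r: "p r \<noteq> \<pi> r" by auto
    then have "r \<le> n" using that assms unfolding permutes_def by (metis atMost_iff)
    then show ?thesis using r False by (subst prod_zero) auto
  qed auto
  then have "(\<Sum>p | p permutes {..n}. signof p * (\<Prod>r\<le>n. if p r = \<pi> r then 1 else 0 :: complex))
    = (\<Sum>p | p permutes {..n}. if p = \<pi> then signof p else 0)"
    by (intro sum.cong) auto
  also have "\<dots> = signof \<pi>" using assms by (simp add: finite_permutations)
  finally show ?thesis unfolding det_Leibniz .
qed

text \<open>
  With the parameters on \<open>\<pi>\<close> equal to one and all others zero, a row where \<open>\<pi>\<close> uses no star has \<open>- z\<close> as
  its only entry. Once these factors are taken out, the matrix becomes the permutation matrix of \<open>\<pi>\<close>
  at \<open>z = 0\<close>. So the order of the determinant at \<open>z = 0\<close> counts the edges of \<open>\<pi>\<close> that are not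
  stars.
\<close>

lemma bdet_indicator:
  assumes "supported n U Z \<tau> \<pi>"
  shows "\<exists>g. uni_poly g \<and> g 0 \<noteq> 0 \<and>
    (\<forall>z. bdet n U Z \<tau> z (indicator_of \<pi>) = (- z) ^ card {r. r \<le> n \<and> r \<notin> Z \<and> (r, \<pi> r) \<notin> U} * g z)"
proof -
  let ?L = "{r. r \<le> n \<and> r \<notin> Z \<and> (r, \<pi> r) \<notin> U}"
  let ?g = "\<lambda>z r c. (if c = \<pi> r then 1 else 0) - (if r \<notin> Z \<and> r \<notin> ?L \<and> r = c then z else 0) :: complex"
  have perm: "\<pi> permutes {..n}" using assms unfolding supported_def by auto
  have "uni_poly (\<lambda>z. det (mat (Suc n) (Suc n) (\<lambda>(r, c). ?g z r c)))"
  proof (intro poly_expr_det[of _ "Suc n"])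
    fix r c assume "r < Suc n" "c < Suc n"
    moreover have "uni_poly (\<lambda>z. ?g z r c)"
      by (intro poly_expr_if poly_expr_diff poly_expr_const uni_poly_id)
    ultimately show "uni_poly (\<lambda>z. mat (Suc n) (Suc n) (\<lambda>(r, c). ?g z r c) $$ (r, c))" by simp
  qed auto
  moreover have "det (mat (Suc n) (Suc n) (\<lambda>(r, c). ?g 0 r c)) \<noteq> 0"
    using det_permutation[OF perm] by (simp add: sign_def)
  moreover have "bdet n U Z \<tau> z (indicator_of \<pi>) = (- z) ^ card ?L * det (mat (Suc n) (Suc n) (\<lambda>(r, c). ?g z r c))" for z
  proof -
    have "bdet n U Z \<tau> z (indicator_of \<pi>)
      = (\<Prod>r\<le>n. if r \<in> ?L then - z else 1) * det (mat (Suc n) (Suc n) (\<lambda>(r, c). ?g z r c))"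
      unfolding bdet_def
    proof (rule det_scale_rows)
      fix r c assume rc: "r \<le> n" "c \<le> n"
      have "if r \<in> Z then \<pi> r = \<tau> r else (r, \<pi> r) \<in> U \<or> \<pi> r = r"
        using assms rc unfolding supported_def by auto
      then show "bordered U Z \<tau> z (indicator_of \<pi>) r c = (if r \<in> ?L then - z else 1) * ?g z r c"
        using rc by (auto simp: bordered_def pencil_def star_fun_def indicator_of_def)
    qed
    moreover have "(\<Prod>r\<le>n. if r \<in> ?L then - z else 1) = (- z) ^ card ?L"
    proof -
      have "(\<Prod>r\<le>n. if r \<in> ?L then - z else 1) = (\<Prod>r\<in>{..n} \<inter> ?L. - z)"
        by (subst prod.inter_restrict) auto
      also have "{..n} \<inter> ?L = ?L" by auto
      finally show ?thesis by simp
    qed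
    ultimately show ?thesis by simp
  qed
  ultimately show ?thesis by (intro exI[of _ "\<lambda>z. det (mat (Suc n) (Suc n) (\<lambda>(r, c). ?g z r c))"]) blast
qed

lemma bdet_nonzero_somewhere:
  assumes "supported n U Z \<tau> \<pi>" "finite X"
  shows "\<exists>z. z \<notin> X \<and> z \<noteq> 0 \<and> bdet n U Z \<tau> z (indicator_of \<pi>) \<noteq> 0"
proof -
  obtain g where g: "uni_poly g" "g 0 \<noteq> 0" and eq: "\<And>z. bdet n U Z \<tau> z (indicator_of \<pi>)
      = (- z) ^ card {r. r \<le> n \<and> r \<notin> Z \<and> (r, \<pi> r) \<notin> U} * g z"
    using bdet_indicator[OF assms(1)] by blast
  have "finite (insert 0 X \<union> {z. g z = 0})" using uni_poly_finite_zeros[OF g] assms(2) by auto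
  then obtain z where "z \<notin> insert 0 X \<union> {z. g z = 0}"
    using ex_new_if_finite[OF infinite_UNIV_char_0] by blast
  then show ?thesis using eq by auto
qed

section \<open>Entries that move the roots of the pencil\<close>

text \<open>
  Changing one coordinate after the other leads from \<open>a\<close> to \<open>b\<close>. Proportionality is transitive only
  where the intermediate values are nonzero, which can be arranged by moving \<open>a\<close> and \<open>b\<close> simultaneously
  towards a point \<open>w\<close> with \<open>f w \<noteq> 0\<close>.
\<close>

lemma proportional_if_coordinatewise:
  assumes "finite T" "multi_poly f" "multi_poly g" "f w \<noteq> 0"
    and step: "\<And>x a y y'. x \<in> T \<Longrightarrow>
      f (a(x := y)) * g (a(x := y')) = g (a(x := y)) * f (a(x := y'))"
    and agree: "\<And>p. p \<notin> T \<Longrightarrow> a p = b p"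
  shows "f a * g b = g a * f b"
  using assms(1) step agree
proof (induction T arbitrary: a b)
  case empty
  then have "a = b" by auto
  then show ?case by simp
next
  case (insert x T)
  let ?h = "\<lambda>a b. f a * g b - g a * f b"
  have vanish: "f (b(x := a x)) * ?h a b = 0" if "\<And>p. p \<notin> insert x T \<Longrightarrow> a p = b p" for a b
  proof -
    let ?b = "b(x := a x)"
    have "f a * g ?b = g a * f ?b"
      by (rule insert.IH) (use insert.prems(1) that in auto)
    moreover have "f ?b * g b = g ?b * f b"
      using insert.prems(1)[of x b "a x" "b x"] by (simp only: fun_upd_triv insertI1 simp_thms)
    moreover have "f' * (x * v - y * u) = 0" if "x * g' = y * f'" "f' * v = g' * u"
      for x y f' g' u v :: complex
    proof -
      have "f' * (x * v - y * u) = x * (f' * v) - (y * f') * u" by (simp add: algebra_simps)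
      then show ?thesis unfolding that(2) that(1)[symmetric] by simp
    qed
    ultimately show ?thesis by blast
  qed
  let ?b = "b(x := a x)"
  have line: "line ?b w t = (line b w t)(x := line a w t x)" for t
    by (auto simp: line_def fun_eq_iff)
  show ?case
  proof (rule ccontr)
    assume neq: "f a * g b \<noteq> g a * f b"
    let ?F = "\<lambda>t. f (line ?b w t)" and ?H = "\<lambda>t. ?h (line a w t) (line b w t)"
    have "\<exists>t. \<forall>i\<in>{?F, ?H}. i t \<noteq> 0"
    proof (rule uni_poly_common_nonzero)
      fix i assume i: "i \<in> {?F, ?H}"
      have "uni_poly ?F" by (rule uni_poly_line[OF assms(2)])
      moreover have "uni_poly ?H" by (intro poly_expr_diff poly_expr_mult uni_poly_line assms(2,3))
      ultimately show "uni_poly i" using i by auto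
      have "?F 1 \<noteq> 0" "?H 0 \<noteq> 0" using assms(4) neq by auto
      then show "\<exists>t. i t \<noteq> 0" using i by blast
    qed auto
    then obtain t where "?F t \<noteq> 0" "?H t \<noteq> 0" by auto
    moreover have "f ((line b w t)(x := line a w t x)) * ?H t = 0"
      by (rule vanish) (use insert.prems(2) in \<open>auto simp: line_def\<close>)
    ultimately show False using line[of t] by simp
  qed
qed

text \<open>
  By \<open>bdet_affine\<close> the determinant is \<open>v(z) + x * u(z)\<close> in the value of the entry \<open>x\<close>; the condition
  says that \<open>u\<close> and \<open>v\<close> are not proportional, so that its zeros in \<open>z\<close> vary with \<open>x\<close>.
\<close>

definition moves_roots ::
  "nat \<Rightarrow> (nat \<times> nat) set \<Rightarrow> nat set \<Rightarrow> (nat \<Rightarrow> nat) \<Rightarrow> nat \<times> nat \<Rightarrow> bool" where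
  "moves_roots n U Z \<tau> x \<longleftrightarrow> (\<exists>a z z'.
     bdet n U Z \<tau> z (a(x := 1)) * bdet n U Z \<tau> z' (a(x := 0)) \<noteq>
     bdet n U Z \<tau> z' (a(x := 1)) * bdet n U Z \<tau> z (a(x := 0)))"

lemma not_moves_roots_step:
  assumes "\<not> moves_roots n U Z \<tau> x"
  shows "bdet n U Z \<tau> z (a(x := y)) * bdet n U Z \<tau> z' (a(x := y'))
    = bdet n U Z \<tau> z' (a(x := y)) * bdet n U Z \<tau> z (a(x := y'))"
proof -
  let ?B = "\<lambda>z y. bdet n U Z \<tau> z (a(x := y))"
  have eq: "?B z 1 * ?B z' 0 = ?B z' 1 * ?B z 0"
    using assms unfolding moves_roots_def by blast
  have ring: "(v + y * (u - v)) * (v' + y' * (u' - v')) - (v' + y * (u' - v')) * (v + y' * (u - v))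
      = (y - y') * (u * v' - u' * v)" for u v u' v' :: complex
    by (simp add: algebra_simps)
  have affine: "?B z w = ?B z 0 + w * (?B z 1 - ?B z 0)" for z w by (rule bdet_affine)
  have "?B z y * ?B z' y' - ?B z' y * ?B z y' = (y - y') * (?B z 1 * ?B z' 0 - ?B z' 1 * ?B z 0)"
    unfolding affine[of z y] affine[of z y'] affine[of z' y] affine[of z' y'] by (rule ring)
  then show ?thesis using eq by simp
qed

text \<open>
  If no entry in \<open>T\<close> moved the roots, then the determinants at the indicators of \<open>\<pi>\<close> and \<open>\<sigma>\<close> would be
  proportional as functions of \<open>z\<close>; but they have different orders at \<open>z = 0\<close>.
\<close>

lemma moves_roots_if_order_differs:
  assumes "finite T" and \<pi>: "supported n U Z \<tau> \<pi>" and \<sigma>: "supported n U Z \<tau> \<sigma>"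
    and agree: "\<And>p. p \<notin> T \<Longrightarrow> indicator_of \<pi> p = indicator_of \<sigma> p"
    and less: "card {r. r \<le> n \<and> r \<notin> Z \<and> (r, \<pi> r) \<notin> U} < card {r. r \<le> n \<and> r \<notin> Z \<and> (r, \<sigma> r) \<notin> U}"
  shows "\<exists>x\<in>T. moves_roots n U Z \<tau> x"
proof (rule ccontr)
  assume no: "\<not> (\<exists>x\<in>T. moves_roots n U Z \<tau> x)"
  let ?B = "bdet n U Z \<tau>"
  define s t where "s = card {r. r \<le> n \<and> r \<notin> Z \<and> (r, \<pi> r) \<notin> U}"
    and "t = card {r. r \<le> n \<and> r \<notin> Z \<and> (r, \<sigma> r) \<notin> U}"
  obtain g where g: "uni_poly g" "g 0 \<noteq> 0" and eqg: "\<And>z. ?B z (indicator_of \<pi>) = (- z) ^ s * g z"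
    using bdet_indicator[OF \<pi>] unfolding s_def by blast
  obtain h where h: "uni_poly h" "h 0 \<noteq> 0" and eqh: "\<And>z. ?B z (indicator_of \<sigma>) = (- z) ^ t * h z"
    using bdet_indicator[OF \<sigma>] unfolding t_def by blast
  have eq: "?B z (indicator_of \<pi>) * ?B z' (indicator_of \<sigma>) = ?B z' (indicator_of \<pi>) * ?B z (indicator_of \<sigma>)"
    if "?B z (indicator_of \<pi>) \<noteq> 0" for z z'
  proof (rule proportional_if_coordinatewise[of T "?B z" "?B z'" "indicator_of \<pi>",
        OF assms(1) multi_poly_bdet multi_poly_bdet that])
    fix x a y y' assume "x \<in> T"
    then show "?B z (a(x := y)) * ?B z' (a(x := y')) = ?B z' (a(x := y)) * ?B z (a(x := y'))"
      using no not_moves_roots_step by blast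
  qed (rule agree)
  have st: "s < t" using less unfolding s_def t_def .
  have "finite ({z. g z = 0} \<union> {z. h z = 0} \<union> {0})"
    by (intro finite_UnI finite.intros uni_poly_finite_zeros[OF g] uni_poly_finite_zeros[OF h])
  then obtain \<zeta> where "\<zeta> \<notin> {z. g z = 0} \<union> {z. h z = 0} \<union> {0}"
    by (rule exE[OF ex_new_if_finite[OF infinite_UNIV_char_0]])
  then have \<zeta>: "g \<zeta> \<noteq> 0" "h \<zeta> \<noteq> 0" "\<zeta> \<noteq> 0" by auto
  define A B where "A = (- \<zeta>) ^ t * h \<zeta>" and "B = (- \<zeta>) ^ s * g \<zeta>"
  define k where "k = (\<lambda>z. g z * A - B * ((- z) ^ (t - s) * h z))"
  have k: "uni_poly k"
  proof -
    have "uni_poly (\<lambda>z. (- z) ^ m)" for m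
      by (induction m) (auto intro!: poly_expr_const poly_expr_mult poly_expr_uminus uni_poly_id)
    then show ?thesis unfolding k_def using g(1) h(1) by (intro poly_expr_diff poly_expr_mult poly_expr_const)
  qed
  have k0: "k 0 \<noteq> 0" using g(2) st \<zeta> by (simp add: A_def k_def power_0_left)
  have "finite ({z. k z = 0} \<union> {z. g z = 0} \<union> {0})"
    by (intro finite_UnI finite.intros uni_poly_finite_zeros[OF g] uni_poly_finite_zeros[OF k k0])
  then obtain z where "z \<notin> {z. k z = 0} \<union> {z. g z = 0} \<union> {0}"
    by (rule exE[OF ex_new_if_finite[OF infinite_UNIV_char_0]])
  then have z: "k z \<noteq> 0" "g z \<noteq> 0" "z \<noteq> 0" by auto
  have "(- z) ^ s * g z * A = B * ((- z) ^ t * h z)"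
    using eq[of z \<zeta>] z unfolding eqg eqh A_def B_def by simp
  also have "(- z) ^ t = (- z) ^ s * (- z) ^ (t - s)" using st by (simp flip: power_add)
  finally have "(- z) ^ s * k z = 0" by (simp add: algebra_simps k_def)
  then show False using z by simp
qed

text \<open>
  At the indicator of \<open>\<pi>\<close>, row \<open>l\<close> is zero except on the diagonal. If the self-loop is given the value
  \<open>y\<close>, the determinant is \<open>y - z\<close> times a factor that does not contain \<open>y\<close>.
\<close>

lemma moves_roots_self_loop:
  assumes \<pi>: "supported n U {n} \<tau> \<pi>" and l: "l < n" "\<pi> l = l" "(l, l) \<in> U"
  shows "moves_roots n U {n} \<tau> (l, l)"
proof -
  let ?B = "bdet n U {n} \<tau>" and ?C = "\<lambda>z. bdet n U {n, l} (\<tau>(l := l)) z (indicator_of \<pi>)"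
  have factor: "?B z ((indicator_of \<pi>)((l, l) := y)) = (y - z) * ?C z" for y z
  proof -
    have "?B z ((indicator_of \<pi>)((l, l) := y)) = (\<Prod>r\<le>n. if r = l then y - z else 1) * ?C z"
      unfolding bdet_def
      by (rule det_scale_rows)
        (use l in \<open>auto simp: bordered_def pencil_def star_fun_def indicator_of_def\<close>)
    then show ?thesis using l(1) by simp
  qed
  have sup: "supported n U {n, l} (\<tau>(l := l)) \<pi>"
    using \<pi> l unfolding supported_def by auto
  obtain z where z: "?C z \<noteq> 0" using bdet_nonzero_somewhere[OF sup, of "{}"] by auto
  obtain z' where z': "?C z' \<noteq> 0" "z' \<noteq> z" using bdet_nonzero_somewhere[OF sup, of "{z}"] by auto
  have "(1 - z) * ?C z * ((0 - z') * ?C z') - (1 - z') * ?C z' * ((0 - z) * ?C z)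
      = (z - z') * ?C z * ?C z'" by (simp add: algebra_simps)
  also have "\<dots> \<noteq> 0" using z z' by simp
  finally show ?thesis
    unfolding moves_roots_def
    by (intro exI[of _ "indicator_of \<pi>"] exI[of _ z] exI[of _ z']) (simp only: factor, simp)
qed

section \<open>Consequences for left null vectors\<close>

text \<open>
  The key step. The entry \<open>x = (r, c)\<close> lies in column \<open>c\<close>, so the minor without this column does not
  contain it. For generic other parameters and generic \<open>z\<close>, the value \<open>x = - v / u\<close> makes the
  determinant vanish while the minor stays nonzero. As \<open>z\<close> varies, this value avoids the finitely many
  zeros of \<open>P\<close>, because \<open>v + y * u\<close> is not identically zero in \<open>z\<close> for any fixed \<open>y\<close>.
\<close>

lemma forced_zero_contradiction:
  assumes jn: "j \<le> n" and i: "i < n"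
    and P: "multi_poly P" "P a0 \<noteq> 0"
    and forced: "\<And>a z q. P a \<noteq> 0 \<Longrightarrow> deleted_null n U j z a q \<Longrightarrow> q i = 0"
    and mv: "moves_roots n U {n} (\<lambda>_. j) (r, c)"
    and minor: "deleted_minor n U j i c z0 b0 \<noteq> 0"
  shows False
proof -
  let ?x = "(r, c)" and ?D = "deleted_det n U j" and ?m = "deleted_minor n U j i c"
  obtain b z1 z2 where W: "?D z1 (b(?x := 1)) * ?D z2 (b(?x := 0))
      - ?D z2 (b(?x := 1)) * ?D z1 (b(?x := 0)) \<noteq> 0"
    using mv unfolding moves_roots_def by auto
  define W where
    "W a = ?D z1 (a(?x := 1)) * ?D z2 (a(?x := 0)) - ?D z2 (a(?x := 1)) * ?D z1 (a(?x := 0))" for a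
  have mW: "multi_poly W"
    unfolding W_def by (intro poly_expr_diff poly_expr_mult multi_poly_upd multi_poly_bdet)
  have "W b \<noteq> 0" unfolding W_def by (rule W)
  then obtain a1 where a1: "W a1 \<noteq> 0" "P a1 \<noteq> 0"
    using multi_poly_common_nonzero[of W P b a0] mW P by blast
  have "multi_poly (\<lambda>a. W a * P a)" using mW P(1) by (rule poly_expr_mult)
  then obtain a where a: "W a \<noteq> 0" "P a \<noteq> 0" "?m z0 a \<noteq> 0"
    using multi_poly_common_nonzero[of "\<lambda>a. W a * P a" "?m z0" a1 b0] multi_poly_bdet minor a1
    by auto
  let ?v = "\<lambda>z. ?D z (a(?x := 0))" and ?u = "\<lambda>z. ?D z (a(?x := 1)) - ?D z (a(?x := 0))"
  have D: "?D z (a(?x := y)) = ?v z + y * ?u z" for z y by (rule bdet_affine)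
  have m: "?m z (a(?x := y)) = ?m z a" for z y
    using bdet_independent[of i "{n, i}" n "\<lambda>r. if r = n then j else c" c] i by auto
  let ?Y = "{y. P (a(?x := y)) = 0}"
  have finY: "finite ?Y"
    by (rule uni_poly_finite_zeros[OF uni_poly_upd[OF P(1)], of _ _ "a ?x"]) (use a in simp)
  define fs where "fs = {?u, \<lambda>z. ?m z a} \<union> (\<lambda>y z. ?v z + y * ?u z) ` ?Y"
  have "\<exists>z. \<forall>f\<in>fs. f z \<noteq> 0"
  proof (rule uni_poly_common_nonzero)
    show "finite fs" using finY by (simp add: fs_def)
    fix f assume f: "f \<in> fs"
    have "uni_poly ?u" "uni_poly (\<lambda>z. ?m z a)" "uni_poly (\<lambda>z. ?v z + y * ?u z)" for y
      by (intro poly_expr_diff poly_expr_add poly_expr_mult poly_expr_const uni_poly_bdet)+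
    then show "uni_poly f" using f unfolding fs_def by auto
    have "p * q' - p' * q = (p - q) * q' - (p' - q') * q" for p p' q q' :: complex
      by (simp add: algebra_simps)
    then have W': "W a = ?u z1 * ?v z2 - ?u z2 * ?v z1" unfolding W_def by blast
    have "\<exists>z. ?u z \<noteq> 0"
    proof (rule ccontr)
      assume "\<not> (\<exists>z. ?u z \<noteq> 0)"
      then have "?u z1 = 0" "?u z2 = 0" by blast+
      then have "W a = 0" unfolding W' by (simp only: mult_zero_left diff_self)
      then show False using a(1) by simp
    qed
    moreover have "\<exists>z. ?v z + y * ?u z \<noteq> 0" for y
    proof (rule ccontr)
      assume "\<not> (\<exists>z. ?v z + y * ?u z \<noteq> 0)"
      then have "?v z1 = - (y * ?u z1)" "?v z2 = - (y * ?u z2)" by (simp_all only: not_ex not_not add_eq_0_iff2)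
      moreover have "u1 * v2 - u2 * v1 = 0" if "v1 = - (y * u1)" "v2 = - (y * u2)"
        for u1 u2 v1 v2 :: complex
        unfolding that by simp
      ultimately have "W a = 0" unfolding W' by blast
      then show False using a(1) by simp
    qed
    ultimately show "\<exists>z. f z \<noteq> 0" using f a(3) unfolding fs_def by auto
  qed
  then obtain z where z: "\<And>f. f \<in> fs \<Longrightarrow> f z \<noteq> 0" by auto
  have u: "?u z \<noteq> 0" using z[of ?u] by (simp add: fs_def)
  have mz: "?m z a \<noteq> 0" using z[of "\<lambda>z. ?m z a"] by (simp add: fs_def)
  define y where "y = - ?v z / ?u z"
  have Dy: "?D z (a(?x := y)) = 0"
  proof -
    have root: "v + (- v / u) * u = 0" if "u \<noteq> 0" for u v :: complex using that by simp
    have "?v z + y * ?u z = 0" unfolding y_def by (rule root[OF u])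
    then show ?thesis by (rule trans[OF D])
  qed
  have "y \<notin> ?Y"
  proof
    assume "y \<in> ?Y"
    then have "(\<lambda>z. ?v z + y * ?u z) \<in> fs" unfolding fs_def by blast
    then have "?v z + y * ?u z \<noteq> 0" by (rule z)
    then show False using trans[OF D[symmetric] Dy] by contradiction
  qed
  then have Py: "P (a(?x := y)) \<noteq> 0" by simp
  have "?m z (a(?x := y)) \<noteq> 0" unfolding m using mz .
  from deleted_null_nonzero_at[OF jn i Dy this] forced[OF Py] show False by blast
qed

text \<open>
  Columns matched to rows in \<open>S\<close> meet no other rows, so \<open>q\<close> restricted to \<open>S\<close> is a null vector of the
  block with rows \<open>S\<close> and columns \<open>\<pi> ` S\<close>. All perfect matchings of this block have the same number \<open>s\<close>
  of diagonal edges and no self-loop, so its determinant is \<open>(- z)\<^sup>s\<close> times a polynomial in the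
  parameters.
\<close>

lemma left_null_vanishes_on_closed_rows:
  assumes \<pi>: "supported n U {n} (\<lambda>_. j) \<pi>" and S: "S \<subseteq> {..<n}"
    and closed: "\<And>r r'. r < n \<Longrightarrow> r' \<in> S \<Longrightarrow> (r, \<pi> r') \<in> U \<or> r = \<pi> r' \<Longrightarrow> r \<in> S"
    and no_loop: "\<And>\<sigma> r. supported n U {n} (\<lambda>_. j) \<sigma> \<Longrightarrow> \<forall>r. r \<notin> S \<longrightarrow> \<sigma> r = \<pi> r \<Longrightarrow>
      r \<in> S \<Longrightarrow> \<sigma> r = r \<Longrightarrow> (r, r) \<notin> U"
    and same: "\<And>\<sigma>. supported n U {n} (\<lambda>_. j) \<sigma> \<Longrightarrow> \<forall>r. r \<notin> S \<longrightarrow> \<sigma> r = \<pi> r \<Longrightarrow>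
      card {r \<in> S. \<sigma> r = r} = s"
  shows "\<exists>g b. multi_poly g \<and> g b \<noteq> 0 \<and>
    (\<forall>a z q. g a \<noteq> 0 \<longrightarrow> z \<noteq> 0 \<longrightarrow> deleted_null n U j z a q \<longrightarrow> (\<forall>r\<in>S. q r = 0))"
proof -
  define Z where "Z = - S"
  have nZ: "n \<in> Z" using S by (auto simp: Z_def)
  have perm: "\<pi> permutes {..n}" and \<pi>n: "\<pi> n = j" using \<pi> by (auto simp: supported_def)
  have finS: "finite S" using S finite_subset by blast
  have homog: "bdet n U Z \<pi> z a = (- z) ^ s * bdet n U Z \<pi> (-1) a" for z a
  proof -
    have "(\<Prod>r\<le>n. bordered U Z \<pi> z a r (p r)) = (- z) ^ s * (\<Prod>r\<le>n. bordered U Z \<pi> (-1) a r (p r))"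
      if p: "p permutes {..n}" for p
    proof (cases "supported n U Z \<pi> p")
      case False
      then obtain r where r: "r \<le> n" "\<not> (if r \<in> Z then p r = \<pi> r else (r, p r) \<in> U \<or> p r = r)"
        using p unfolding supported_def by auto
      have "bordered U Z \<pi> z a r (p r) = 0" for z
        using r(2) by (auto simp: bordered_def pencil_def star_fun_def split: if_splits)
      then have "(\<Prod>r\<le>n. bordered U Z \<pi> z a r (p r)) = 0" for z
        using r(1) by (intro prod_zero) auto
      from this[of z] this[of "-1"] show ?thesis by (simp only: mult_zero_right)
    next
      case True
      have off: "p r = \<pi> r" if "r \<notin> S" for r
        using True p perm that unfolding supported_def Z_def permutes_def
        by (cases "r \<le> n") (auto split: if_splits)
      have p': "supported n U {n} (\<lambda>_. j) p"
        unfolding supported_def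
      proof (intro conjI allI impI)
        fix r assume "r \<le> n"
        then show "if r \<in> {n} then p r = j else (r, p r) \<in> U \<or> p r = r"
          using True off[of r] nZ \<pi> \<pi>n unfolding supported_def Z_def
          by (cases "r \<in> S") auto
      qed (rule p)
      have "bordered U Z \<pi> z a r (p r) = (if r \<in> S \<and> p r = r then - z else 1) * bordered U Z \<pi> (-1) a r (p r)"
        if "r \<le> n" for r
      proof (cases "r \<in> S \<and> p r = r")
        case True
        then have "(r, r) \<notin> U" using no_loop[OF p'] off by blast
        then show ?thesis using True by (auto simp: bordered_def pencil_def star_fun_def Z_def)
      next
        case False
        then show ?thesis by (auto simp: bordered_def pencil_def star_fun_def Z_def)
      qed
      then have "(\<Prod>r\<le>n. bordered U Z \<pi> z a r (p r))
          = (\<Prod>r\<le>n. (if r \<in> S \<and> p r = r then - z else 1) * bordered U Z \<pi> (-1) a r (p r))"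
        by (intro prod.cong) auto
      also have "\<dots> = (\<Prod>r\<le>n. if r \<in> S \<and> p r = r then - z else 1) * (\<Prod>r\<le>n. bordered U Z \<pi> (-1) a r (p r))"
        by (rule prod.distrib)
      also have "(\<Prod>r\<le>n. if r \<in> S \<and> p r = r then - z else 1) = (- z) ^ card {r \<in> S. p r = r}"
      proof -
        have "{r \<in> S. p r = r} = {r \<in> {..n}. r \<in> S \<and> p r = r}" using S by auto
        then show ?thesis by (simp add: prod.inter_filter[symmetric])
      qed
      also have "\<dots> = (- z) ^ s" using same[OF p'] off by simp
      finally show ?thesis .
    qed
    then show ?thesis
      unfolding bdet_Leibniz sum_distrib_left by (intro sum.cong) (auto simp: mult_ac)
  qed
  have supZ: "supported n U Z \<pi> \<pi>" using \<pi> nZ unfolding supported_def by (auto split: if_splits)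
  obtain z0 where z0: "bdet n U Z \<pi> z0 (indicator_of \<pi>) \<noteq> 0"
    using bdet_nonzero_somewhere[OF supZ, of "{}"] by auto
  let ?g = "bdet n U Z \<pi> (-1)"
  have g_nonzero: "?g (indicator_of \<pi>) \<noteq> 0" using z0 homog[of z0 "indicator_of \<pi>"] by auto
  have "q r = 0"
    if ga: "?g a \<noteq> 0" and z: "z \<noteq> 0" and null: "deleted_null n U j z a q" and r: "r \<in> S" for a z q r
  proof (rule ccontr)
    assume qr: "q r \<noteq> 0"
    define \<rho> where "\<rho> = Hilbert_Choice.inv \<pi>"
    have \<rho>: "\<pi> (\<rho> c) = c" "\<rho> (\<pi> r) = r" "\<rho> c \<le> n \<longleftrightarrow> c \<le> n" for c r
      unfolding \<rho>_def using permutes_inverses[OF perm] permutes_in_image[OF permutes_inv[OF perm]] by auto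
    define t where "t c = (\<Sum>r\<in>S. q r * pencil U z a r c)" for c
    define q' where "q' r = (if r \<in> S then q r else - t (\<pi> r))" for r
    have "(\<Sum>r\<le>n. q' r * bordered U Z \<pi> z a r c) = 0" if c: "c \<le> n" for c
    proof -
      have "(\<Sum>r\<le>n. q' r * bordered U Z \<pi> z a r c)
          = (\<Sum>r\<in>S. q' r * bordered U Z \<pi> z a r c) + (\<Sum>r\<in>{..n} - S. q' r * bordered U Z \<pi> z a r c)"
        using S by (subst sum.subset_diff[of S "{..n}"]) (auto simp: add.commute)
      also have "(\<Sum>r\<in>S. q' r * bordered U Z \<pi> z a r c) = t c"
        unfolding t_def by (intro sum.cong) (auto simp: q'_def bordered_def Z_def)
      also have "(\<Sum>r\<in>{..n} - S. q' r * bordered U Z \<pi> z a r c)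
          = (\<Sum>r\<in>{..n} - S. if r = \<rho> c then - t c else 0)"
        using \<rho> by (intro sum.cong) (auto simp: q'_def bordered_def Z_def)
      also have "\<dots> = (if \<rho> c \<in> S then 0 else - t c)"
        using c \<rho>(3)[of c] by simp
      finally have eq: "(\<Sum>r\<le>n. q' r * bordered U Z \<pi> z a r c) = t c + (if \<rho> c \<in> S then 0 else - t c)" .
      have "t c = 0" if \<rho>S: "\<rho> c \<in> S"
      proof -
        have "c \<noteq> j"
        proof
          assume "c = j"
          then have "\<rho> c = n" using \<rho>(2)[of n] \<pi>n by simp
          then show False using \<rho>S S by auto
        qed
        then have "(\<Sum>r<n. q r * pencil U z a r c) = 0"
          using null c unfolding left_null_pencil by auto
        moreover have "(\<Sum>r<n. q r * pencil U z a r c) = t c"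
          unfolding t_def
        proof (rule sum.mono_neutral_right)
          show "\<forall>r\<in>{..<n} - S. q r * pencil U z a r c = 0"
          proof
            fix r assume r: "r \<in> {..<n} - S"
            then have "\<not> ((r, c) \<in> U \<or> r = c)"
              using closed[OF _ \<rho>S, of r] \<rho>(1)[of c] by auto
            then show "q r * pencil U z a r c = 0" by (auto simp: pencil_def star_fun_def)
          qed
        qed (use S in auto)
        ultimately show ?thesis by simp
      qed
      then show ?thesis unfolding eq by simp
    qed
    moreover have "r \<le> n \<and> q' r \<noteq> 0" using qr r S by (auto simp: q'_def)
    ultimately have "bdet n U Z \<pi> z a = 0" unfolding bdet_zero_iff by blast
    then show False using ga z homog[of z a] by simp
  qed
  then show ?thesis
    using g_nonzero by (intro exI[of _ ?g] exI[of _ "indicator_of \<pi>"] conjI allI impI ballI multi_poly_bdet)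
qed

section \<open>Matchings of the pencil graph\<close>

lemma matching_graph:
  assumes "finite A" "finite B" "edges G \<subseteq> A \<times> B" "matching G M" "card M = card A"
  shows "\<exists>f. inj_on f A \<and> f ` A \<subseteq> B \<and> (\<forall>r\<in>A. (r, f r) \<in> edges G) \<and> M = (\<lambda>r. (r, f r)) ` A"
proof -
  have M: "M \<subseteq> edges G" "inj_on fst M" "inj_on snd M" using assms(4) by (auto simp: matching_def)
  have "fst ` M \<subseteq> A" using M(1) assms(3) by auto
  moreover have "card (fst ` M) = card A" using card_image[OF M(2)] assms(5) by simp
  ultimately have fM: "fst ` M = A" using card_subset_eq assms(1) by blast
  define f where "f r = snd (the_inv_into M fst r)" for r
  have mem: "(r, f r) \<in> M" if "r \<in> A" for r
  proof -
    have "the_inv_into M fst r \<in> M" using that fM M(2) by (auto intro: the_inv_into_into)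
    moreover have "fst (the_inv_into M fst r) = r" using that fM M(2) by (auto intro: f_the_inv_into_f)
    ultimately show ?thesis unfolding f_def by (metis prod.collapse)
  qed
  have eq: "M = (\<lambda>r. (r, f r)) ` A"
  proof
    show "M \<subseteq> (\<lambda>r. (r, f r)) ` A"
    proof
      fix e assume e: "e \<in> M"
      then have "fst e \<in> A" using fM by auto
      then have "(fst e, f (fst e)) = e" using mem e M(2) by (metis fst_conv inj_onD)
      then show "e \<in> (\<lambda>r. (r, f r)) ` A" using \<open>fst e \<in> A\<close> by (metis imageI)
    qed
  qed (use mem in auto)
  have inj: "inj_on f A"
  proof (rule inj_onI)
    fix r r' assume "r \<in> A" "r' \<in> A" "f r = f r'"
    then have "(r, f r) = (r', f r')" using M(3) mem by (metis inj_onD snd_conv)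
    then show "r = r'" by simp
  qed
  have edge: "\<forall>r\<in>A. (r, f r) \<in> edges G" using mem M(1) by auto
  then have "f ` A \<subseteq> B" using assms(3) by auto
  then show ?thesis using inj edge eq by (intro exI[of _ f] conjI)
qed

lemma graph_matching:
  assumes "inj_on f A" "\<And>r. r \<in> A \<Longrightarrow> (r, f r) \<in> edges G"
  shows "matching G ((\<lambda>r. (r, f r)) ` A)" "card ((\<lambda>r. (r, f r)) ` A) = card A"
  using assms by (auto simp: matching_def inj_on_def intro!: card_image)

lemma matching_card_le:
  assumes "finite A" "edges G \<subseteq> A \<times> B" "matching G M"
  shows "card M \<le> card A"
proof -
  have "card M = card (fst ` M)" using assms(3) by (simp add: matching_def card_image)
  also have "\<dots> \<le> card A" using assms by (intro card_mono) (auto simp: matching_def)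
  finally show ?thesis .
qed

lemma max_matching_iff_perfect:
  assumes "finite A" "edges G \<subseteq> A \<times> B" "matching G M0" "card M0 = card A"
  shows "max_matching G M \<longleftrightarrow> matching G M \<and> card M = card A"
  using assms matching_card_le[OF assms(1,2)] unfolding max_matching_def by (metis le_antisym)

lemma closed_under_injection_onto:
  assumes "finite X" "inj_on \<rho> X" "\<rho> ` X \<subseteq> X" "y \<in> X"
  shows "\<exists>x\<in>X. \<rho> x = y"
proof -
  have "\<rho> ` X = X" using assms(1-3) by (simp add: card_image card_subset_eq)
  then show ?thesis using assms(4) by (metis imageE)
qed

lemma permutes_atMost_extend:
  fixes n :: nat
  assumes inj: "inj_on \<pi> {..<n}" and mem: "\<And>r. r < n \<Longrightarrow> \<pi> r \<le> n \<and> \<pi> r \<noteq> j"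
    and n: "\<pi> n = j" "j \<le> n" and out: "\<And>r. r > n \<Longrightarrow> \<pi> r = r"
  shows "\<pi> permutes {..n}"
proof (rule bij_imp_permutes)
  have ins: "{..n} = insert n {..<n}" by auto
  have "inj_on \<pi> {..n}"
    unfolding ins inj_on_insert using inj mem n(1) by fastforce
  moreover have "\<pi> ` {..n} \<subseteq> {..n}" unfolding ins using mem n by (fastforce simp: le_less)
  ultimately show "bij_betw \<pi> {..n} {..n}"
    using endo_inj_surj[of "{..n}" \<pi>] unfolding bij_betw_def by blast
qed (use out in auto)

text \<open>
  The pencil of \<open>Hbar\<close> without column \<open>j\<close>, with a decomposition \<open>D\<close> of its graph.
\<close>

locale deleted_graph =
  fixes n :: nat and Hbar :: struct_mat and j :: nat and D :: decomposition
  assumes Hbar: "Hbar \<in> carrier_mat n (n + 1)" and j: "j \<le> n"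
    and DM: "DM_decomposition (pencil_graph_del Hbar j) D"
begin

abbreviation "G \<equiv> pencil_graph_del Hbar j"
abbreviation "U \<equiv> stars Hbar"
abbreviation "L k \<equiv> fst (D ! k)"
abbreviation "R k \<equiv> snd (D ! k)"
text \<open>
  Perfect matchings are encoded as permutations of the rows and columns \<open>{..n}\<close>: the extra row \<open>n\<close>
  takes the deleted column \<open>j\<close>.
\<close>

abbreviation "perfect \<equiv> supported n U {n} (\<lambda>_. j)"
abbreviation "\<kappa> \<equiv> comp_index D"

lemma edges_G: "(r, c) \<in> edges G \<longleftrightarrow> r < n \<and> c \<le> n \<and> c \<noteq> j \<and> ((r, c) \<in> U \<or> c = r)"
  using Hbar by (auto simp: pencil_graph_del_def pencil_graph_def induced_def lambda_edges_def stars_def)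

lemma edges_component: "edges (component G D k) = edges G \<inter> L k \<times> R k"
  by (simp add: component_def induced_def)

lemma
  shows rows: "(\<Union>k<length D. L k) = {..<n}"
    and cols: "(\<Union>k<length D. R k) = {..<n + 1} - {j}"
    and nonempty: "k < length D \<Longrightarrow> L k \<noteq> {} \<and> R k \<noteq> {}"
    and disjoint: "k < length D \<Longrightarrow> l < length D \<Longrightarrow> k \<noteq> l \<Longrightarrow> L k \<inter> L l = {} \<and> R k \<inter> R l = {}"
    and perfect_comp: "k < length D \<Longrightarrow>
      \<exists>M. max_matching (component G D k) M \<and> card M = card (L k) \<and> card M = card (R k)"
    and edge_in_matching: "k < length D \<Longrightarrow> e \<in> edges (component G D k) \<Longrightarrow>
      \<exists>M. max_matching (component G D k) M \<and> e \<in> M"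
    and block_order: "k < length D \<Longrightarrow> l < length D \<Longrightarrow> edges G \<inter> L k \<times> R l \<noteq> {} \<Longrightarrow> k \<le> l"
    and max_iff: "max_matching G M \<longleftrightarrow> M \<subseteq> (\<Union>k<length D. edges (component G D k)) \<and>
      (\<forall>k<length D. max_matching (component G D k) (M \<inter> edges (component G D k)))"
proof -
  have P: "DM_properties G D" using DM by (simp add: DM_decomposition_def)
  note P' = P[unfolded DM_properties_def]
  show "(\<Union>k<length D. L k) = {..<n}"
    using P'[THEN conjunct1] Hbar by (simp add: pencil_graph_del_def induced_def)
  show "(\<Union>k<length D. R k) = {..<n + 1} - {j}"
    using P'[THEN conjunct2, THEN conjunct1] Hbar by (simp add: pencil_graph_del_def induced_def)
  note P3 = P'[THEN conjunct2, THEN conjunct2]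
  show "k < length D \<Longrightarrow> L k \<noteq> {} \<and> R k \<noteq> {}"
    using P3[THEN conjunct1] by simp
  note P4 = P3[THEN conjunct2]
  show "k < length D \<Longrightarrow> l < length D \<Longrightarrow> k \<noteq> l \<Longrightarrow> L k \<inter> L l = {} \<and> R k \<inter> R l = {}"
    using P4[THEN conjunct1] by simp
  note P5 = P4[THEN conjunct2]
  show "k < length D \<Longrightarrow>
      \<exists>M. max_matching (component G D k) M \<and> card M = card (L k) \<and> card M = card (R k)"
    using P5[THEN conjunct1] by simp
  show "k < length D \<Longrightarrow> e \<in> edges (component G D k) \<Longrightarrow>
      \<exists>M. max_matching (component G D k) M \<and> e \<in> M"
    using P5[THEN conjunct1] by simp
  note P6 = P5[THEN conjunct2]
  show "k < length D \<Longrightarrow> l < length D \<Longrightarrow> edges G \<inter> L k \<times> R l \<noteq> {} \<Longrightarrow> k \<le> l"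
    using P6[THEN conjunct1, rule_format] .
  show "max_matching G M \<longleftrightarrow> M \<subseteq> (\<Union>k<length D. edges (component G D k)) \<and>
      (\<forall>k<length D. max_matching (component G D k) (M \<inter> edges (component G D k)))"
    using P6[THEN conjunct2, THEN spec] .
qed

lemma L_sub: "k < length D \<Longrightarrow> L k \<subseteq> {..<n}" and R_sub: "k < length D \<Longrightarrow> R k \<subseteq> {..n} - {j}"
proof -
  show "k < length D \<Longrightarrow> L k \<subseteq> {..<n}" using rows by blast
  have "{..<n + 1} - {j} = {..n} - {j}" by auto
  then show "k < length D \<Longrightarrow> R k \<subseteq> {..n} - {j}" using cols by blast
qed

lemma finite_L: "k < length D \<Longrightarrow> finite (L k)"
  using L_sub by (rule finite_subset) auto

lemma finite_R: "k < length D \<Longrightarrow> finite (R k)"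
  using R_sub by (rule finite_subset) auto

lemma comp_index_eq:
  assumes "k < length D" "r \<in> L k" shows "\<kappa> r = k"
  unfolding comp_index_def using assms disjoint by (intro the_equality) blast+

lemma comp_index:
  assumes "r < n" shows "\<kappa> r < length D" "r \<in> L (\<kappa> r)"
proof -
  obtain k where "k < length D" "r \<in> L k" using rows assms by blast
  then show "\<kappa> r < length D" "r \<in> L (\<kappa> r)" using comp_index_eq by auto
qed

lemma R_unique: "k < length D \<Longrightarrow> l < length D \<Longrightarrow> c \<in> R k \<Longrightarrow> c \<in> R l \<Longrightarrow> k = l"
  using disjoint by blast

lemma card_LR: "k < length D \<Longrightarrow> card (L k) = card (R k)"
  using perfect_comp by metis

lemma component_edges_sub: "edges (component G D k) \<subseteq> L k \<times> R k"
  by (simp add: edges_component)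

lemma induced_max_iff:
  assumes A: "finite A" and f0: "bij_betw f0 A B" "\<And>r. r \<in> A \<Longrightarrow> (r, f0 r) \<in> edges G"
  shows "max_matching (induced G A B) M \<longleftrightarrow>
    (\<exists>f. bij_betw f A B \<and> (\<forall>r\<in>A. (r, f r) \<in> edges G) \<and> M = (\<lambda>r. (r, f r)) ` A)"
proof -
  have B: "finite B" using bij_betw_finite[OF f0(1)] A by simp
  have card: "card A = card B" using bij_betw_same_card[OF f0(1)] .
  have edges: "edges (induced G A B) = edges G \<inter> A \<times> B" by (simp add: induced_def)
  have sub: "edges (induced G A B) \<subseteq> A \<times> B" by (simp add: edges)
  have e: "(r, f r) \<in> edges (induced G A B)"
    if "bij_betw f A B" "\<And>r. r \<in> A \<Longrightarrow> (r, f r) \<in> edges G" "r \<in> A" for f r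
    using that bij_betwE[OF that(1)] by (simp add: edges)
  have m: "matching (induced G A B) ((\<lambda>r. (r, f r)) ` A)" "card ((\<lambda>r. (r, f r)) ` A) = card A"
    if "bij_betw f A B" "\<And>r. r \<in> A \<Longrightarrow> (r, f r) \<in> edges G" for f
    using graph_matching[OF bij_betw_imp_inj_on[OF that(1)] e[OF that]] by blast+
  note iff = max_matching_iff_perfect[OF A sub m[OF f0]]
  have "max_matching (induced G A B) M \<longleftrightarrow> matching (induced G A B) M \<and> card M = card A"
    by (rule iff)
  also have "\<dots> \<longleftrightarrow>
    (\<exists>f. bij_betw f A B \<and> (\<forall>r\<in>A. (r, f r) \<in> edges G) \<and> M = (\<lambda>r. (r, f r)) ` A)"
  proof (rule iffI)
    assume M: "matching (induced G A B) M \<and> card M = card A"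
    obtain f where f: "inj_on f A" "f ` A \<subseteq> B" "\<forall>r\<in>A. (r, f r) \<in> edges (induced G A B)"
      "M = (\<lambda>r. (r, f r)) ` A"
      using matching_graph[OF A B sub conjunct1[OF M] conjunct2[OF M]] by blast
    have "f ` A = B" using card_subset_eq[OF B f(2)] card_image[OF f(1)] card by simp
    then show "\<exists>f. bij_betw f A B \<and> (\<forall>r\<in>A. (r, f r) \<in> edges G) \<and> M = (\<lambda>r. (r, f r)) ` A"
      using f by (intro exI[of _ f]) (simp add: bij_betw_def edges)
  next
    assume "\<exists>f. bij_betw f A B \<and> (\<forall>r\<in>A. (r, f r) \<in> edges G) \<and> M = (\<lambda>r. (r, f r)) ` A"
    then obtain f where "bij_betw f A B" "\<And>r. r \<in> A \<Longrightarrow> (r, f r) \<in> edges G" "M = (\<lambda>r. (r, f r)) ` A"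
      by blast
    then show "matching (induced G A B) M \<and> card M = card A" using m by blast
  qed
  finally show ?thesis .
qed

lemma component_max_iff:
  assumes k: "k < length D"
  shows "max_matching (component G D k) M \<longleftrightarrow>
    (\<exists>f. bij_betw f (L k) (R k) \<and> (\<forall>r\<in>L k. (r, f r) \<in> edges G) \<and> M = (\<lambda>r. (r, f r)) ` L k)"
proof -
  obtain M0 where M0: "matching (component G D k) M0" "card M0 = card (L k)"
    using perfect_comp[OF k] by (auto simp: max_matching_def)
  obtain f where f: "inj_on f (L k)" "f ` L k \<subseteq> R k" "\<forall>r\<in>L k. (r, f r) \<in> edges (component G D k)"
    using matching_graph[OF finite_L[OF k] finite_R[OF k] component_edges_sub M0] by blast
  have "f ` L k = R k"
    using card_subset_eq[OF finite_R[OF k] f(2)] card_image[OF f(1)] card_LR[OF k] by simp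
  then have "bij_betw f (L k) (R k)" using f(1) by (simp add: bij_betw_def)
  moreover have "(r, f r) \<in> edges G" if "r \<in> L k" for r
    using f(3) that by (simp add: edges_component)
  ultimately show ?thesis
    unfolding component_def by (rule induced_max_iff[OF finite_L[OF k]])
qed

lemma perfectD:
  assumes "perfect \<pi>"
  shows "\<pi> permutes {..n}" "\<pi> n = j" "r < n \<Longrightarrow> (r, \<pi> r) \<in> edges G"
proof -
  show p: "\<pi> permutes {..n}" and pn: "\<pi> n = j" using assms by (auto simp: supported_def)
  show "(r, \<pi> r) \<in> edges G" if "r < n"
  proof -
    have "\<pi> r \<noteq> j" using pn permutes_inj[OF p] that by (metis injD less_irrefl)
    moreover have "\<pi> r \<le> n" using permutes_in_image[OF p, of r] that by simp
    moreover have "(r, \<pi> r) \<in> U \<or> \<pi> r = r" using assms that by (auto simp: supported_def)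
    ultimately show ?thesis using that by (auto simp: edges_G)
  qed
qed

lemma perfectI:
  assumes inj: "inj_on \<pi> {..<n}" and edge: "\<And>r. r < n \<Longrightarrow> (r, \<pi> r) \<in> edges G"
    and n: "\<pi> n = j" and out: "\<And>r. r > n \<Longrightarrow> \<pi> r = r"
  shows "perfect \<pi>"
proof -
  have "\<pi> permutes {..n}"
    by (rule permutes_atMost_extend[OF inj _ n j out]) (use edge in \<open>auto simp: edges_G\<close>)
  then show ?thesis using edge n by (auto simp: supported_def edges_G le_less)
qed

text \<open>
  A perfect matching of the whole graph uses only edges inside components.
\<close>

lemma perfect_in_component:
  assumes \<pi>: "perfect \<pi>" and r: "r < n"
  shows "\<pi> r \<in> R (\<kappa> r)"
proof -
  let ?M = "(\<lambda>r. (r, \<pi> r)) ` {..<n}"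
  have inj: "inj_on \<pi> {..<n}" using permutes_inj[OF perfectD(1)[OF \<pi>]] by (auto simp: inj_on_def)
  have sub: "edges G \<subseteq> {..<n} \<times> {..n}" using edges_G by auto
  have "matching G ?M" "card ?M = card {..<n}"
    using graph_matching[OF inj, of G] perfectD(3)[OF \<pi>] by auto
  then have "max_matching G ?M"
    using max_matching_iff_perfect[of "{..<n}" G "{..n}"] sub by blast
  then have "?M \<subseteq> (\<Union>k<length D. edges (component G D k))"
    by (rule iffD1[OF max_iff, THEN conjunct1])
  moreover have "(r, \<pi> r) \<in> ?M" using r by simp
  ultimately have "(r, \<pi> r) \<in> (\<Union>k<length D. edges (component G D k))"
    by (rule subsetD)
  then obtain k where "k < length D" "r \<in> L k" "\<pi> r \<in> R k" by (auto simp: edges_component)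
  then show ?thesis using comp_index_eq by auto
qed

lemma perfect_bij_component:
  assumes \<pi>: "perfect \<pi>" and k: "k < length D"
  shows "bij_betw \<pi> (L k) (R k)"
proof -
  have "inj_on \<pi> (L k)" using permutes_inj[OF perfectD(1)[OF \<pi>]] by (auto simp: inj_on_def)
  moreover have "\<pi> ` L k \<subseteq> R k"
    using perfect_in_component[OF \<pi>] L_sub[OF k] comp_index_eq[OF k] by fastforce
  ultimately show ?thesis
    unfolding bij_betw_def using card_LR[OF k] finite_R[OF k] by (metis card_image card_subset_eq)
qed

lemma perfect_exists: "\<exists>\<pi>. perfect \<pi>"
proof -
  have "\<forall>k. \<exists>f. k < length D \<longrightarrow> bij_betw f (L k) (R k) \<and> (\<forall>r\<in>L k. (r, f r) \<in> edges G)"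
    using perfect_comp component_max_iff by meson
  then obtain f where f: "\<And>k. k < length D \<Longrightarrow> bij_betw (f k) (L k) (R k)"
    "\<And>k r. k < length D \<Longrightarrow> r \<in> L k \<Longrightarrow> (r, f k r) \<in> edges G" by metis
  let ?\<pi> = "\<lambda>r. if r < n then f (\<kappa> r) r else if r = n then j else r"
  have mem: "f (\<kappa> r) r \<in> R (\<kappa> r)" if "r < n" for r
    using f(1)[OF comp_index(1)[OF that]] comp_index(2)[OF that] by (auto simp: bij_betw_def)
  have "perfect ?\<pi>"
  proof (rule perfectI)
    show "inj_on ?\<pi> {..<n}"
    proof (rule inj_onI)
      fix r r' assume r: "r \<in> {..<n}" "r' \<in> {..<n}" "?\<pi> r = ?\<pi> r'"
      then have eq: "f (\<kappa> r) r = f (\<kappa> r') r'" by simp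
      then have \<kappa>: "\<kappa> r = \<kappa> r'" using R_unique mem r comp_index(1) by (metis lessThan_iff)
      have "inj_on (f (\<kappa> r)) (L (\<kappa> r))" using f(1)[of "\<kappa> r"] comp_index(1) r by (simp add: bij_betw_def)
      moreover have "r \<in> L (\<kappa> r)" "r' \<in> L (\<kappa> r)" using comp_index(2)[of r] comp_index(2)[of r'] r \<kappa> by auto
      ultimately show "r = r'" using eq \<kappa> by (simp add: inj_on_eq_iff)
    qed
  qed (use f comp_index in auto)
  then show ?thesis by blast
qed

text \<open>
  A perfect matching may be changed inside one component, independently of the others.
\<close>

lemma perfect_replace:
  assumes \<pi>: "perfect \<pi>" and k: "k < length D"
    and f: "bij_betw f (L k) (R k)" "\<forall>r\<in>L k. (r, f r) \<in> edges G"
  shows "perfect (\<lambda>r. if r \<in> L k then f r else \<pi> r)"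
proof (rule perfectI)
  have fR: "f r \<in> R k" if "r \<in> L k" for r using f(1) that by (auto simp: bij_betw_def)
  have \<pi>R: "\<pi> r \<notin> R k" if "r < n" "r \<notin> L k" for r
    using perfect_in_component[OF \<pi> that(1)] comp_index[OF that(1)] R_unique[OF k] that by metis
  show "inj_on (\<lambda>r. if r \<in> L k then f r else \<pi> r) {..<n}"
  proof (rule inj_onI)
    fix r r' assume r: "r \<in> {..<n}" "r' \<in> {..<n}"
      and eq: "(if r \<in> L k then f r else \<pi> r) = (if r' \<in> L k then f r' else \<pi> r')"
    have inj: "inj_on f (L k)" "inj \<pi>"
      using f(1) permutes_inj[OF perfectD(1)[OF \<pi>]] by (auto simp: bij_betw_def)
    consider "r \<in> L k" "r' \<in> L k" | "r \<notin> L k" "r' \<notin> L k" | "r \<in> L k" "r' \<notin> L k" | "r \<notin> L k" "r' \<in> L k"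
      by blast
    then show "r = r'"
    proof cases
      case 1
      then show ?thesis using eq inj_onD[OF inj(1)] by simp
    next
      case 2
      then show ?thesis using eq injD[OF inj(2)] by simp
    next
      case 3
      then show ?thesis using eq fR[of r] \<pi>R[of r'] r by simp
    next
      case 4
      then show ?thesis using eq fR[of r'] \<pi>R[of r] r by simp
    qed
  qed
  have "n \<notin> L k" using L_sub[OF k] by auto
  then show "(if n \<in> L k then f n else \<pi> n) = j" using perfectD(2)[OF \<pi>] by simp
  show "(if r \<in> L k then f r else \<pi> r) = r" if "r > n" for r
    using that L_sub[OF k] perfectD(1)[OF \<pi>] by (auto simp: permutes_def)
qed (use f perfectD(3)[OF \<pi>] in auto)

section \<open>Alternating paths and the order of the components\<close>

text \<open>
  The digraph on the rows whose paths are the alternating paths of the matching \<open>\<pi>\<close>.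
\<close>

definition step :: "(nat \<Rightarrow> nat) \<Rightarrow> (nat \<times> nat) set" where
  "step \<pi> = {(r, r'). r < n \<and> r' < n \<and> (r, \<pi> r') \<in> edges G}"

lemma comp_index_step:
  assumes "perfect \<pi>" "(r, r') \<in> step \<pi>" shows "\<kappa> r \<le> \<kappa> r'"
proof -
  have r: "r < n" "r' < n" "(r, \<pi> r') \<in> edges G" using assms(2) by (auto simp: step_def)
  then have "edges G \<inter> L (\<kappa> r) \<times> R (\<kappa> r') \<noteq> {}"
    using perfect_in_component[OF assms(1) r(2)] comp_index[OF r(1)] by blast
  then show ?thesis using block_order comp_index r by blast
qed

lemma comp_index_reach:
  assumes "perfect \<pi>" "(r, r') \<in> (step \<pi>)\<^sup>*" shows "\<kappa> r \<le> \<kappa> r'"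
  using assms(2) by induction (use comp_index_step[OF assms(1)] in force)+

lemma reach_less: "(r, r') \<in> (step \<pi>)\<^sup>* \<Longrightarrow> r' < n \<Longrightarrow> r < n"
  by (erule converse_rtranclE) (auto simp: step_def)

lemma reach_less': "(r, r') \<in> (step \<pi>)\<^sup>* \<Longrightarrow> r < n \<Longrightarrow> r' < n"
  by (erule rtranclE) (auto simp: step_def)

text \<open>
  Matchings that avoid row \<open>i\<close> and column \<open>c\<close> but cover everything else. As a permutation, such a
  matching sends \<open>i\<close> to \<open>c\<close>, whether or not this is an edge.
\<close>

abbreviation "missing i c \<equiv> supported n U {n, i} (\<lambda>r. if r = n then j else c)"

lemma missingI:
  assumes i: "i < n" and inj: "inj_on \<sigma> {..<n}" and edge: "\<And>r. r < n \<Longrightarrow> r \<noteq> i \<Longrightarrow> (r, \<sigma> r) \<in> edges G"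
    and \<sigma>i: "\<sigma> i = c" "c \<le> n" "c \<noteq> j" and n: "\<sigma> n = j" and out: "\<And>r. r > n \<Longrightarrow> \<sigma> r = r"
  shows "missing i c \<sigma>"
proof -
  have mem: "\<sigma> r \<le> n \<and> \<sigma> r \<noteq> j" if "r < n" for r
    using edge[OF that] \<sigma>i by (cases "r = i") (auto simp: edges_G)
  have "\<sigma> permutes {..n}" by (rule permutes_atMost_extend[OF inj mem n j out])
  then show ?thesis using edge n \<sigma>i i by (auto simp: supported_def edges_G le_less)
qed

text \<open>
  On a path \<open>r0 \<rightarrow> r1 \<rightarrow> \<dots> \<rightarrow> i\<close> each row takes over the column of its successor. This frees the column
  of \<open>r0\<close> and leaves row \<open>i\<close> without a column; the result assigns to row \<open>i\<close> the freed column, which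
  turns it into a permutation. The path must be simple, hence the shortest one is used.
\<close>

lemma shift_along_path:
  assumes \<pi>: "perfect \<pi>" and path: "(r0, i) \<in> (step \<pi>)\<^sup>*" and i: "i < n"
  shows "\<exists>\<sigma>. missing i (\<pi> r0) \<sigma> \<and>
    (\<forall>r<n. r \<noteq> i \<longrightarrow> \<sigma> r = \<pi> r \<or> (\<exists>r'. (r, r') \<in> step \<pi> \<and> (r', i) \<in> (step \<pi>)\<^sup>* \<and> \<sigma> r = \<pi> r'))"
proof -
  define m where "m = (LEAST m. (r0, i) \<in> step \<pi> ^^ m)"
  have ex: "\<exists>m. (r0, i) \<in> step \<pi> ^^ m" using path by (simp add: rtrancl_power)
  then have m: "(r0, i) \<in> step \<pi> ^^ m" unfolding m_def by (rule LeastI_ex)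
  have least: "m \<le> m'" if "(r0, i) \<in> step \<pi> ^^ m'" for m'
    unfolding m_def using that by (rule Least_le)
  obtain f where f: "f 0 = r0" "f m = i" "\<And>t. t < m \<Longrightarrow> (f t, f (Suc t)) \<in> step \<pi>"
    using m unfolding relpow_fun_conv by auto
  have seg: "(f s, f t) \<in> step \<pi> ^^ (t - s)" if "s \<le> t" "t \<le> m" for s t
    unfolding relpow_fun_conv
    by (rule exI[of _ "\<lambda>u. f (s + u)"]) (use that f(3) in auto)
  have inj: "inj_on f {..m}"
  proof (rule linorder_inj_onI)
    fix s t assume st: "s < t" "s \<in> {..m}" "t \<in> {..m}"
    show "f s \<noteq> f t"
    proof
      assume "f s = f t"
      moreover have "(r0, f s) \<in> step \<pi> ^^ s" using seg[of 0 s] st f(1) by simp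
      moreover have "(f t, i) \<in> step \<pi> ^^ (m - t)" using seg[of t m] st f(2) by simp
      ultimately have "(r0, i) \<in> step \<pi> ^^ (s + (m - t))" unfolding relpow_add by auto
      then show False using least[of "s + (m - t)"] st by auto
    qed
  qed auto
  have f_less: "f t < n" if "t \<le> m" for t
  proof -
    have "(f t, i) \<in> (step \<pi>)\<^sup>*" using seg[of t m] that f(2) relpow_imp_rtrancl by fastforce
    then show ?thesis using reach_less i by blast
  qed
  define pos where "pos r = the_inv_into {..m} f r" for r
  have pos: "pos (f t) = t" if "t \<le> m" for t
    unfolding pos_def using inj that by (intro the_inv_into_f_f) auto
  define \<rho> where "\<rho> r = (if r \<in> f ` {..<m} then f (Suc (pos r)) else if r = i then r0 else r)" for r
  have \<rho>1: "\<rho> (f t) = f (Suc t)" if "t < m" for t using that pos by (simp add: \<rho>_def)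
  have i_out: "i \<notin> f ` {..<m}"
  proof
    assume "i \<in> f ` {..<m}"
    then obtain t where "t < m" "f t = f m" using f(2) by (metis imageE lessThan_iff)
    then show False using inj by (auto dest: inj_onD)
  qed
  have \<rho>i: "\<rho> i = r0" using i_out by (simp add: \<rho>_def)
  have \<rho>other: "\<rho> r = r" if "r \<notin> f ` {..m}" for r
    using that f(2) by (auto simp: \<rho>_def)
  have \<rho>in: "\<rho> r \<in> f ` {..m}" if r: "r \<in> f ` {..m}" for r
  proof -
    obtain t where t: "t \<le> m" "r = f t" using r by blast
    show ?thesis
    proof (cases "t = m")
      case True
      then have "\<rho> r = f 0" using t f(1,2) \<rho>i by simp
      then show ?thesis by auto
    next
      case False
      then show ?thesis using \<rho>1[of t] t by auto
    qed
  qed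
  have \<rho>inj: "inj \<rho>"
  proof -
    have "inj_on \<rho> (f ` {..m})"
    proof (rule eq_card_imp_inj_on)
      have "f t \<in> \<rho> ` f ` {..m}" if "t \<le> m" for t
      proof (cases t)
        case 0
        then have "f t = \<rho> (f m)" using f \<rho>i by simp
        then show ?thesis by auto
      next
        case (Suc s)
        then have "f t = \<rho> (f s)" using \<rho>1[of s] that by simp
        then show ?thesis using Suc that by auto
      qed
      then have "\<rho> ` f ` {..m} = f ` {..m}" using \<rho>in by auto
      then show "card (\<rho> ` f ` {..m}) = card (f ` {..m})" by simp
    qed auto
    then show ?thesis
      using \<rho>other \<rho>in by (intro injI) (metis inj_onD)
  qed
  have cases: "\<rho> r = r \<or> ((r, \<rho> r) \<in> step \<pi> \<and> (\<rho> r, i) \<in> (step \<pi>)\<^sup>*)" if "r \<noteq> i" for r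
  proof (cases "r \<in> f ` {..m}")
    case True
    then obtain t where t: "t \<le> m" "r = f t" by blast
    with \<open>r \<noteq> i\<close> f(2) have "t < m" by (cases "t = m") auto
    moreover have "(f (Suc t), i) \<in> (step \<pi>)\<^sup>*"
      using seg[of "Suc t" m] \<open>t < m\<close> f(2) relpow_imp_rtrancl by fastforce
    ultimately show ?thesis using \<rho>1 f(3) t by simp
  qed (use \<rho>other in simp)
  have \<rho>n: "\<rho> r = r" if "r \<ge> n" for r
  proof -
    have "r \<notin> f ` {..m}" using f_less that by fastforce
    then show ?thesis by (rule \<rho>other)
  qed
  have r0: "r0 < n" using reach_less[OF path i] .
  have "missing i (\<pi> r0) (\<lambda>r. \<pi> (\<rho> r))"
  proof (rule missingI[OF i])
    show "inj_on (\<lambda>r. \<pi> (\<rho> r)) {..<n}"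
    proof (rule inj_onI)
      fix r r' assume "\<pi> (\<rho> r) = \<pi> (\<rho> r')"
      then have "\<rho> r = \<rho> r'" by (rule injD[OF permutes_inj[OF perfectD(1)[OF \<pi>]]])
      then show "r = r'" by (rule injD[OF \<rho>inj])
    qed
    fix r assume "r < n" "r \<noteq> i"
    then show "(r, \<pi> (\<rho> r)) \<in> edges G"
      using cases[of r] perfectD(3)[OF \<pi>] by (auto simp: step_def)
  next
    show "\<pi> (\<rho> i) = \<pi> r0" using \<rho>i by simp
    show "\<pi> r0 \<le> n" "\<pi> r0 \<noteq> j" using perfectD(3)[OF \<pi> r0] by (auto simp: edges_G)
    show "\<pi> (\<rho> n) = j" using \<rho>n perfectD(2)[OF \<pi>] by simp
    show "\<pi> (\<rho> r) = r" if "r > n" for r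
      using \<rho>n[of r] that perfectD(1)[OF \<pi>] by (auto simp: permutes_def)
  qed
  moreover have "\<pi> (\<rho> r) = \<pi> r \<or> (\<exists>r'. (r, r') \<in> step \<pi> \<and> (r', i) \<in> (step \<pi>)\<^sup>* \<and> \<pi> (\<rho> r) = \<pi> r')"
    if "r \<noteq> i" for r
    using cases[OF that] by auto
  ultimately show ?thesis by (intro exI[of _ "\<lambda>r. \<pi> (\<rho> r)"]) simp
qed

text \<open>
  Compare \<open>\<sigma>\<close> with \<open>\<pi>\<close>: every row other than \<open>i\<close> points to the row whose column in \<open>\<pi>\<close> it takes in \<open>\<sigma>\<close>. If
  \<open>i\<close> were not reachable from \<open>r0\<close>, this injection would map the finite set of rows reachable from
  \<open>r0\<close> onto itself, but \<open>r0\<close> is already the image of \<open>i\<close>.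
\<close>

lemma path_if_missing:
  assumes \<pi>: "perfect \<pi>" and i: "i < n" and \<sigma>: "missing i (\<pi> r0) \<sigma>" and r0: "r0 < n"
  shows "(r0, i) \<in> (step \<pi>)\<^sup>*"
proof (rule ccontr)
  assume no: "(r0, i) \<notin> (step \<pi>)\<^sup>*"
  note p = perfectD[OF \<pi>]
  have s: "\<sigma> permutes {..n}" "\<sigma> n = j" "\<sigma> i = \<pi> r0"
    using \<sigma> i by (auto simp: supported_def split: if_splits)
  define X where "X = {r. (r0, r) \<in> (step \<pi>)\<^sup>*}"
  have X: "X \<subseteq> {..<n}" using reach_less' r0 unfolding X_def by auto
  define \<rho> where "\<rho> r = Hilbert_Choice.inv \<pi> (\<sigma> r)" for r
  have \<pi>\<rho>: "\<pi> (\<rho> r) = \<sigma> r" for r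
    unfolding \<rho>_def using permutes_inverses(1)[OF p(1)] .
  have inj\<rho>: "inj \<rho>"
    using \<pi>\<rho> permutes_inj[OF s(1)] by (metis injD injI)
  have "\<exists>x\<in>X. \<rho> x = r0"
  proof (rule closed_under_injection_onto)
    show "finite X" using X finite_subset by blast
    show "inj_on \<rho> X" using inj\<rho> by (rule inj_on_subset) auto
    show "\<rho> ` X \<subseteq> X"
    proof
      fix y assume "y \<in> \<rho> ` X"
      then obtain r where r: "r \<in> X" "y = \<rho> r" by auto
      have "r \<noteq> i" using no r by (auto simp: X_def)
      have rn: "r < n" using X r by auto
      have edge: "(r, \<sigma> r) \<in> U \<or> \<sigma> r = r" using \<sigma> rn \<open>r \<noteq> i\<close> by (auto simp: supported_def)
      have "\<sigma> r \<noteq> j" using s rn permutes_inj[OF s(1)] by (metis injD less_irrefl)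
      moreover have "\<sigma> r \<le> n" using permutes_in_image[OF s(1), of r] rn by simp
      ultimately have e: "(r, \<pi> (\<rho> r)) \<in> edges G" unfolding \<pi>\<rho> using edge rn by (auto simp: edges_G)
      have "\<rho> r \<le> n" using \<pi>\<rho>[of r] \<open>\<sigma> r \<le> n\<close> permutes_in_image[OF p(1), of "\<rho> r"] by simp
      moreover have "\<rho> r \<noteq> n" using \<pi>\<rho>[of r] p(2) \<open>\<sigma> r \<noteq> j\<close> by auto
      ultimately have "(r, \<rho> r) \<in> step \<pi>" using e rn by (auto simp: step_def)
      then show "y \<in> X" using r unfolding X_def by auto
    qed
    show "r0 \<in> X" by (simp add: X_def)
  qed
  then obtain x where x: "x \<in> X" "\<rho> x = r0" by auto
  then have "\<sigma> x = \<sigma> i" using \<pi>\<rho>[of x] s(3) by simp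
  then have "x = i" using permutes_inj[OF s(1)] by (auto dest: injD)
  then show False using x(1) no by (simp add: X_def)
qed

section \<open>Strong connectivity of the components\<close>

text \<open>
  Let \<open>X\<close> be the set of rows of the component that are reachable from \<open>r\<close>, and \<open>Y\<close> the rest. No edge
  leads from \<open>X\<close> to \<open>Y\<close>. An edge from \<open>Y\<close> to \<open>X\<close> would lie in a perfect matching of the component, hence
  on an alternating cycle, which would lead back from \<open>X\<close> to \<open>Y\<close>. So \<open>X\<close> and \<open>Y\<close> are not connected at all,
  and splitting the component into them refines the decomposition.
\<close>

lemma reach_in_component:
  assumes \<pi>: "perfect \<pi>" and k: "k < length D" and r: "r \<in> L k" and r': "r' \<in> L k"
  shows "(r, r') \<in> (step \<pi>)\<^sup>*"
proof (rule ccontr)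
  assume no: "(r, r') \<notin> (step \<pi>)\<^sup>*"
  define X Y where "X = {x \<in> L k. (r, x) \<in> (step \<pi>)\<^sup>*}" and "Y = L k - X"
  have XY: "X \<union> Y = L k" "X \<inter> Y = {}" "X \<subseteq> L k" "Y \<subseteq> L k" by (auto simp: X_def Y_def)
  have rX: "r \<in> X" and r'Y: "r' \<in> Y" using r r' no by (auto simp: X_def Y_def)
  have fin: "finite X" "finite Y" using finite_L[OF k] XY finite_subset by blast+
  have bij: "bij_betw \<pi> (L k) (R k)" by (rule perfect_bij_component[OF \<pi> k])
  have \<pi>R: "\<pi> x \<in> R k" if "x \<in> L k" for x using bij_betwE[OF bij] that by blast
  have less: "x < n" if "x \<in> L k" for x using L_sub[OF k] that by auto
  have \<pi>inj: "x = y" if "\<pi> x = \<pi> y" for x y using injD[OF permutes_inj[OF perfectD(1)[OF \<pi>]] that] .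
  have R_split: "R k = \<pi> ` X \<union> \<pi> ` Y" using bij XY(1) by (metis bij_betw_def image_Un)
  have R_disj: "\<pi> ` X \<inter> \<pi> ` Y = {}" using \<pi>inj XY(2) by blast
  have XYe: "(x, \<pi> y) \<notin> edges G" if "x \<in> X" "y \<in> Y" for x y
  proof
    assume "(x, \<pi> y) \<in> edges G"
    then have "(x, y) \<in> step \<pi>" using that XY less by (auto simp: step_def)
    then have "y \<in> X" using that XY(4) by (auto simp: X_def)
    then show False using that XY(2) by blast
  qed
  have YXe: "(y, \<pi> x) \<notin> edges G" if x: "x \<in> X" and y: "y \<in> Y" for x y
  proof
    assume e: "(y, \<pi> x) \<in> edges G"
    have "y \<in> L k" "x \<in> L k" using x y XY by auto
    then have "(y, \<pi> x) \<in> edges (component G D k)" using e \<pi>R by (simp add: edges_component)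
    then obtain M where M: "max_matching (component G D k) M" "(y, \<pi> x) \<in> M"
      using edge_in_matching[OF k] by blast
    obtain f where f: "bij_betw f (L k) (R k)" "\<forall>r\<in>L k. (r, f r) \<in> edges G"
      "M = (\<lambda>r. (r, f r)) ` L k"
      using iffD1[OF component_max_iff[OF k] M(1)] by blast
    have fy: "f y = \<pi> x" using M(2) f(3) by auto
    define \<rho> where "\<rho> z = inv_into (L k) \<pi> (f z)" for z
    have \<pi>\<rho>: "\<pi> (\<rho> z) = f z" "\<rho> z \<in> L k" if "z \<in> L k" for z
    proof -
      have "f z \<in> \<pi> ` L k" using bij_betwE[OF f(1)] that bij by (simp add: bij_betw_def)
      then show "\<pi> (\<rho> z) = f z" "\<rho> z \<in> L k" unfolding \<rho>_def by (rule f_inv_into_f, rule inv_into_into)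
    qed
    have inj: "inj_on \<rho> (L k)"
    proof (rule inj_onI)
      fix u v assume uv: "u \<in> L k" "v \<in> L k" "\<rho> u = \<rho> v"
      then have "f u = f v" using \<pi>\<rho>(1) by metis
      then show "u = v" using inj_onD[OF bij_betw_imp_inj_on[OF f(1)]] uv by blast
    qed
    have "\<exists>z\<in>X. \<rho> z = x"
    proof (rule closed_under_injection_onto[OF fin(1) inj_on_subset[OF inj XY(3)] _ x])
      show "\<rho> ` X \<subseteq> X"
      proof (rule image_subsetI)
        fix z assume z: "z \<in> X"
        then have zL: "z \<in> L k" using XY by blast
        have "(z, \<pi> (\<rho> z)) \<in> edges G" using f(2) zL \<pi>\<rho>(1) by simp
        then have "(z, \<rho> z) \<in> step \<pi>" using less[OF zL] less[OF \<pi>\<rho>(2)[OF zL]] by (simp add: step_def)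
        moreover have "(r, z) \<in> (step \<pi>)\<^sup>*" using z by (simp add: X_def)
        ultimately have "(r, \<rho> z) \<in> (step \<pi>)\<^sup>*" by (rule rtrancl_into_rtrancl[rotated])
        then show "\<rho> z \<in> X" using \<pi>\<rho>(2)[OF zL] by (simp add: X_def)
      qed
    qed
    then obtain z where z: "z \<in> X" "\<rho> z = x" by blast
    have "\<pi> (\<rho> y) = \<pi> x" using \<pi>\<rho>(1) \<open>y \<in> L k\<close> fy by simp
    then have "\<rho> y = \<rho> z" using \<pi>inj z(2) by simp
    then have "y = z" using inj_onD[OF inj] \<open>y \<in> L k\<close> z(1) XY(3) by blast
    then show False using z(1) y XY(2) by blast
  qed
  \<comment> \<open>Splitting component \<open>k\<close> into the two parts refines the decomposition.\<close>
  define D' where "D' = take k D @ [(X, \<pi> ` X), (Y, \<pi> ` Y)] @ drop (Suc k) D"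
  define \<phi> where "\<phi> a = (if a \<le> k then a else a - 1)" for a
  have len: "length D' = Suc (length D)" using k by (simp add: D'_def)
  have nth: "D' ! a = (if a = k then (X, \<pi> ` X) else if a = Suc k then (Y, \<pi> ` Y) else D ! \<phi> a)"
    if "a < length D'" for a
    using that k by (auto simp: D'_def nth_append \<phi>_def min_def nth_Cons' numeral_2_eq_2 Suc_diff_le
      intro!: arg_cong[of _ _ "(!) D"])
  have \<phi>_less: "\<phi> a < length D" if "a < length D'" for a
    using that k len by (auto simp: \<phi>_def)
  have \<phi>_eq: "a = b \<or> (a = k \<and> b = Suc k) \<or> (a = Suc k \<and> b = k)" if "\<phi> a = \<phi> b" for a b
    using that by (auto simp: \<phi>_def split: if_splits)
  have \<phi>_k: "\<phi> a \<noteq> k" if "a \<noteq> k" "a \<noteq> Suc k" for a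
    using that by (auto simp: \<phi>_def)
  have \<phi>k: "\<phi> k = k" "\<phi> (Suc k) = k" by (auto simp: \<phi>_def)
  have nthk: "D' ! k = (X, \<pi> ` X)" "D' ! Suc k = (Y, \<pi> ` Y)"
    using nth[of k] nth[of "Suc k"] len k by auto
  have nth_other: "D' ! a = D ! \<phi> a" if "a < length D'" "a \<noteq> k" "a \<noteq> Suc k" for a
    using nth[OF that(1)] that by simp
  have sub: "fst (D' ! a) \<subseteq> L (\<phi> a) \<and> snd (D' ! a) \<subseteq> R (\<phi> a)" if "a < length D'" for a
  proof -
    consider "a = k" | "a = Suc k" | "a \<noteq> k" "a \<noteq> Suc k" by blast
    then show ?thesis
      by cases (use nthk \<phi>k XY R_split nth_other[OF that] in auto)
  qed
  have index: "\<exists>a<length D'. D' ! a = D ! m" if "m < length D" "m \<noteq> k" for m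
  proof (cases "m < k")
    case True
    then have "D' ! m = D ! m" using nth_other[of m] len k by (simp add: \<phi>_def)
    then show ?thesis using that len by (intro exI[of _ m]) simp
  next
    case False
    then have "D' ! Suc m = D ! m" using nth_other[of "Suc m"] len that by (simp add: \<phi>_def)
    then show ?thesis using that len by (intro exI[of _ "Suc m"]) simp
  qed
  have kk: "k < length D'" "Suc k < length D'" using k len by auto
  have UnL: "(\<Union>a<length D'. fst (D' ! a)) = (\<Union>m<length D. L m)"
  proof (intro equalityI subsetI)
    fix x assume "x \<in> (\<Union>a<length D'. fst (D' ! a))"
    then show "x \<in> (\<Union>m<length D. L m)" using sub \<phi>_less by blast
  next
    fix x assume "x \<in> (\<Union>m<length D. L m)"
    then obtain m where m: "m < length D" "x \<in> L m" by blast
    show "x \<in> (\<Union>a<length D'. fst (D' ! a))"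
    proof (cases "m = k")
      case True
      then have "x \<in> fst (D' ! k) \<or> x \<in> fst (D' ! Suc k)" using m XY(1) nthk by auto
      then show ?thesis using kk by blast
    next
      case False
      then obtain a where "a < length D'" "D' ! a = D ! m" using index m by blast
      then show ?thesis using m by (intro UN_I[of a]) auto
    qed
  qed
  have UnR: "(\<Union>a<length D'. snd (D' ! a)) = (\<Union>m<length D. R m)"
  proof (intro equalityI subsetI)
    fix x assume "x \<in> (\<Union>a<length D'. snd (D' ! a))"
    then show "x \<in> (\<Union>m<length D. R m)" using sub \<phi>_less by blast
  next
    fix x assume "x \<in> (\<Union>m<length D. R m)"
    then obtain m where m: "m < length D" "x \<in> R m" by blast
    show "x \<in> (\<Union>a<length D'. snd (D' ! a))"
    proof (cases "m = k")
      case True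
      then have "x \<in> snd (D' ! k) \<or> x \<in> snd (D' ! Suc k)" using m R_split nthk by auto
      then show ?thesis using kk by blast
    next
      case False
      then obtain a where "a < length D'" "D' ! a = D ! m" using index m by blast
      then show ?thesis using m by (intro UN_I[of a]) auto
    qed
  qed
  have closed: "bij_betw f Z (\<pi> ` Z)"
    if Z: "Z = X \<or> Z = Y" and f: "bij_betw f (L k) (R k)" "\<forall>r\<in>L k. (r, f r) \<in> edges G" for f Z
  proof -
    have ZL: "Z \<subseteq> L k" "finite Z" using Z XY fin by auto
    have inj: "inj_on f Z" using bij_betw_imp_inj_on[OF f(1)] ZL(1) by (rule inj_on_subset)
    have "f ` Z \<subseteq> \<pi> ` Z"
    proof (rule image_subsetI)
      fix z assume z: "z \<in> Z"
      then have "f z \<in> \<pi> ` X \<union> \<pi> ` Y" using bij_betwE[OF f(1)] ZL R_split by blast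
      moreover have "(z, f z) \<in> edges G" using f(2) z ZL by blast
      ultimately show "f z \<in> \<pi> ` Z" using Z z XYe YXe by auto
    qed
    moreover have "card (f ` Z) = card (\<pi> ` Z)"
      using card_image[OF inj] card_image[of \<pi> Z] \<pi>inj by (simp add: inj_on_def)
    ultimately have "f ` Z = \<pi> ` Z" using ZL(2) by (simp add: card_subset_eq)
    then show ?thesis using inj by (simp add: bij_betw_def)
  qed
  have edges\<pi>: "\<forall>r\<in>L k. (r, \<pi> r) \<in> edges G" using perfectD(3)[OF \<pi>] less by blast
  have iffZ: "max_matching (induced G Z (\<pi> ` Z)) M \<longleftrightarrow>
    (\<exists>f. bij_betw f Z (\<pi> ` Z) \<and> (\<forall>r\<in>Z. (r, f r) \<in> edges G) \<and> M = (\<lambda>r. (r, f r)) ` Z)"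
    if Z: "Z = X \<or> Z = Y" for Z M
  proof (rule induced_max_iff)
    show "finite Z" using Z fin by auto
    show "bij_betw \<pi> Z (\<pi> ` Z)" by (rule closed[OF Z bij edges\<pi>])
    show "(r, \<pi> r) \<in> edges G" if "r \<in> Z" for r using edges\<pi> that Z XY by blast
  qed
  have compk: "component G D' k = induced G X (\<pi> ` X)" "component G D' (Suc k) = induced G Y (\<pi> ` Y)"
    using nthk by (simp_all add: component_def)
  have comp_other: "component G D' a = component G D (\<phi> a)" if "a < length D'" "a \<noteq> k" "a \<noteq> Suc k" for a
    using nth_other[OF that] by (simp add: component_def)
  have edgesZ: "edges (induced G Z (\<pi> ` Z)) = edges G \<inter> Z \<times> \<pi> ` Z" for Z by (simp add: induced_def)
  have graphZ: "(\<lambda>r. (r, f r)) ` L k \<inter> edges (induced G Z (\<pi> ` Z)) = (\<lambda>r. (r, f r)) ` Z"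
    if Z: "Z = X \<or> Z = Y" and f: "bij_betw f (L k) (R k)" "\<forall>r\<in>L k. (r, f r) \<in> edges G" for f Z
    using bij_betwE[OF closed[OF that]] f(2) Z XY unfolding edgesZ by auto
  have EkXY: "edges (component G D k) = edges (induced G X (\<pi> ` X)) \<union> edges (induced G Y (\<pi> ` Y))"
    unfolding edgesZ edges_component R_split XY(1)[symmetric] using XYe YXe by auto
  have part: "\<exists>M. max_matching (induced G Z (\<pi> ` Z)) M \<and> card M = card Z \<and> card M = card (\<pi> ` Z)"
    "e \<in> edges (induced G Z (\<pi> ` Z)) \<Longrightarrow> \<exists>M. max_matching (induced G Z (\<pi> ` Z)) M \<and> e \<in> M"
    if Z: "Z = X \<or> Z = Y" for Z e
  proof -
    have b: "bij_betw \<pi> Z (\<pi> ` Z)" by (rule closed[OF Z bij edges\<pi>])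
    have "\<forall>r\<in>Z. (r, \<pi> r) \<in> edges G" using edges\<pi> Z XY by blast
    then have "max_matching (induced G Z (\<pi> ` Z)) ((\<lambda>r. (r, \<pi> r)) ` Z)"
      using iffZ[OF Z] b by blast
    moreover have "card ((\<lambda>r. (r, \<pi> r)) ` Z) = card Z" by (rule card_image) (simp add: inj_on_def)
    moreover have "card (\<pi> ` Z) = card Z" using bij_betw_same_card[OF b] by simp
    ultimately show "\<exists>M. max_matching (induced G Z (\<pi> ` Z)) M \<and> card M = card Z \<and> card M = card (\<pi> ` Z)"
      by (intro exI[of _ "(\<lambda>r. (r, \<pi> r)) ` Z"]) simp
    assume e: "e \<in> edges (induced G Z (\<pi> ` Z))"
    then have "e \<in> edges (component G D k)" using EkXY Z by blast
    then obtain M where M: "max_matching (component G D k) M" "e \<in> M"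
      using edge_in_matching[OF k] by blast
    obtain f where f: "bij_betw f (L k) (R k)" "\<forall>r\<in>L k. (r, f r) \<in> edges G"
      "M = (\<lambda>r. (r, f r)) ` L k"
      using iffD1[OF component_max_iff[OF k] M(1)] by blast
    have "\<forall>r\<in>Z. (r, f r) \<in> edges G" using f(2) Z XY by blast
    then have "max_matching (induced G Z (\<pi> ` Z)) ((\<lambda>r. (r, f r)) ` Z)"
      using iffZ[OF Z] closed[OF Z f(1,2)] by blast
    moreover have "e \<in> (\<lambda>r. (r, f r)) ` Z" using graphZ[OF Z f(1,2)] M(2) e f(3) by blast
    ultimately show "\<exists>M. max_matching (induced G Z (\<pi> ` Z)) M \<and> e \<in> M" by blast
  qed
  have split_max: "max_matching (component G D k) (M \<inter> edges (component G D k)) \<longleftrightarrow>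
      max_matching (induced G X (\<pi> ` X)) (M \<inter> edges (induced G X (\<pi> ` X))) \<and>
      max_matching (induced G Y (\<pi> ` Y)) (M \<inter> edges (induced G Y (\<pi> ` Y)))" for M
  proof
    assume "max_matching (component G D k) (M \<inter> edges (component G D k))"
    then obtain f where f: "bij_betw f (L k) (R k)" "\<forall>r\<in>L k. (r, f r) \<in> edges G"
      "M \<inter> edges (component G D k) = (\<lambda>r. (r, f r)) ` L k"
      using iffD1[OF component_max_iff[OF k]] by blast
    have "max_matching (induced G Z (\<pi> ` Z)) (M \<inter> edges (induced G Z (\<pi> ` Z)))"
      if Z: "Z = X \<or> Z = Y" for Z
    proof -
      have "M \<inter> edges (induced G Z (\<pi> ` Z)) = (M \<inter> edges (component G D k)) \<inter> edges (induced G Z (\<pi> ` Z))"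
        using EkXY Z by blast
      also have "\<dots> = (\<lambda>r. (r, f r)) ` Z" unfolding f(3) by (rule graphZ[OF Z f(1,2)])
      finally have eq: "M \<inter> edges (induced G Z (\<pi> ` Z)) = (\<lambda>r. (r, f r)) ` Z" .
      have "\<forall>r\<in>Z. (r, f r) \<in> edges G" using f(2) Z XY by blast
      then show ?thesis unfolding eq using iffZ[OF Z] closed[OF Z f(1,2)] by blast
    qed
    then show "max_matching (induced G X (\<pi> ` X)) (M \<inter> edges (induced G X (\<pi> ` X))) \<and>
      max_matching (induced G Y (\<pi> ` Y)) (M \<inter> edges (induced G Y (\<pi> ` Y)))" by simp
  next
    assume "max_matching (induced G X (\<pi> ` X)) (M \<inter> edges (induced G X (\<pi> ` X))) \<and>
      max_matching (induced G Y (\<pi> ` Y)) (M \<inter> edges (induced G Y (\<pi> ` Y)))"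
    then have mX: "max_matching (induced G X (\<pi> ` X)) (M \<inter> edges (induced G X (\<pi> ` X)))"
      and mY: "max_matching (induced G Y (\<pi> ` Y)) (M \<inter> edges (induced G Y (\<pi> ` Y)))" by auto
    obtain f where f: "bij_betw f X (\<pi> ` X)" "\<forall>r\<in>X. (r, f r) \<in> edges G"
      "M \<inter> edges (induced G X (\<pi> ` X)) = (\<lambda>r. (r, f r)) ` X"
      using iffD1[OF iffZ mX] by blast
    obtain g where g: "bij_betw g Y (\<pi> ` Y)" "\<forall>r\<in>Y. (r, g r) \<in> edges G"
      "M \<inter> edges (induced G Y (\<pi> ` Y)) = (\<lambda>r. (r, g r)) ` Y"
      using iffD1[OF iffZ mY] by blast
    define h where "h r = (if r \<in> X then f r else g r)" for r
    have hX: "h r = f r" if "r \<in> X" for r using that by (simp add: h_def)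
    have hY: "h r = g r" if "r \<in> Y" for r using that XY(2) by (auto simp: h_def)
    have "bij_betw h X (\<pi> ` X)" using f(1) bij_betw_cong[of X h f] hX by blast
    moreover have "bij_betw h Y (\<pi> ` Y)" using g(1) bij_betw_cong[of Y h g] hY by blast
    ultimately have "bij_betw h (L k) (R k)"
      unfolding R_split XY(1)[symmetric] using R_disj by (rule bij_betw_combine)
    moreover have "\<forall>r\<in>L k. (r, h r) \<in> edges G"
      unfolding XY(1)[symmetric] using f(2) g(2) hX hY by auto
    moreover have "M \<inter> edges (component G D k) = (\<lambda>r. (r, h r)) ` L k"
    proof -
      have "M \<inter> edges (component G D k) = (\<lambda>r. (r, f r)) ` X \<union> (\<lambda>r. (r, g r)) ` Y"
        unfolding EkXY using f(3) g(3) by blast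
      also have "\<dots> = (\<lambda>r. (r, h r)) ` X \<union> (\<lambda>r. (r, h r)) ` Y" using hX hY by simp
      finally show ?thesis unfolding XY(1)[symmetric] image_Un .
    qed
    ultimately show "max_matching (component G D k) (M \<inter> edges (component G D k))"
      using iffD2[OF component_max_iff[OF k]] by blast
  qed
  have all_split: "(\<forall>a<length D'. Q (component G D' a)) \<longleftrightarrow>
      Q (induced G X (\<pi> ` X)) \<and> Q (induced G Y (\<pi> ` Y)) \<and> (\<forall>m<length D. m \<noteq> k \<longrightarrow> Q (component G D m))"
    for Q
  proof
    assume A: "\<forall>a<length D'. Q (component G D' a)"
    have "Q (component G D m)" if m: "m < length D" "m \<noteq> k" for m
    proof -
      obtain a where "a < length D'" "D' ! a = D ! m" using index[OF m] by blast
      then show ?thesis using A by (auto simp: component_def)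
    qed
    then show "Q (induced G X (\<pi> ` X)) \<and> Q (induced G Y (\<pi> ` Y)) \<and> (\<forall>m<length D. m \<noteq> k \<longrightarrow> Q (component G D m))"
      using A kk compk by metis
  next
    assume B: "Q (induced G X (\<pi> ` X)) \<and> Q (induced G Y (\<pi> ` Y)) \<and> (\<forall>m<length D. m \<noteq> k \<longrightarrow> Q (component G D m))"
    show "\<forall>a<length D'. Q (component G D' a)"
    proof (intro allI impI)
      fix a assume a: "a < length D'"
      consider "a = k" | "a = Suc k" | "a \<noteq> k" "a \<noteq> Suc k" by blast
      then show "Q (component G D' a)"
        by cases (use B compk comp_other[OF a] \<phi>_less[OF a] \<phi>_k in auto)
    qed
  qed
  have UnE: "(\<Union>a<length D'. edges (component G D' a)) = (\<Union>m<length D. edges (component G D m))"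
  proof -
    have "e \<notin> (\<Union>a<length D'. edges (component G D' a)) \<longleftrightarrow> e \<notin> (\<Union>m<length D. edges (component G D m))" for e
    proof -
      have "e \<notin> (\<Union>a<length D'. edges (component G D' a)) \<longleftrightarrow> (\<forall>a<length D'. e \<notin> edges (component G D' a))"
        by blast
      also have "\<dots> \<longleftrightarrow> e \<notin> edges (component G D k) \<and> (\<forall>m<length D. m \<noteq> k \<longrightarrow> e \<notin> edges (component G D m))"
        unfolding all_split[of "\<lambda>C. e \<notin> edges C"] EkXY by blast
      also have "\<dots> \<longleftrightarrow> (\<forall>m<length D. e \<notin> edges (component G D m))" using k by metis
      finally show ?thesis by blast
    qed
    then show ?thesis by blast
  qed
  have "DM_properties G D'"
    unfolding DM_properties_def
  proof (intro conjI)
    show "(\<Union>a<length D'. fst (D' ! a)) = lverts G"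
      unfolding UnL using rows Hbar by (simp add: pencil_graph_del_def induced_def)
    show "(\<Union>a<length D'. snd (D' ! a)) = rverts G"
      unfolding UnR using cols Hbar by (simp add: pencil_graph_del_def induced_def)
    show "\<forall>a<length D'. fst (D' ! a) \<noteq> {} \<and> snd (D' ! a) \<noteq> {}"
    proof (intro allI impI)
      fix a assume a: "a < length D'"
      consider "a = k" | "a = Suc k" | "a \<noteq> k" "a \<noteq> Suc k" by blast
      then show "fst (D' ! a) \<noteq> {} \<and> snd (D' ! a) \<noteq> {}"
        by cases (use nthk rX r'Y nth_other[OF a] nonempty[OF \<phi>_less[OF a]] in auto)
    qed
    show "\<forall>a<length D'. \<forall>b<length D'. a \<noteq> b \<longrightarrow>
        fst (D' ! a) \<inter> fst (D' ! b) = {} \<and> snd (D' ! a) \<inter> snd (D' ! b) = {}"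
    proof (intro allI impI)
      fix a b assume ab: "a < length D'" "b < length D'" "a \<noteq> b"
      show "fst (D' ! a) \<inter> fst (D' ! b) = {} \<and> snd (D' ! a) \<inter> snd (D' ! b) = {}"
      proof (cases "\<phi> a = \<phi> b")
        case True
        then have "(a = k \<and> b = Suc k) \<or> (a = Suc k \<and> b = k)" using \<phi>_eq ab by blast
        then show ?thesis using nthk XY(2) R_disj by auto
      next
        case False
        then have "L (\<phi> a) \<inter> L (\<phi> b) = {} \<and> R (\<phi> a) \<inter> R (\<phi> b) = {}"
          using disjoint \<phi>_less ab by simp
        then show ?thesis using sub[OF ab(1)] sub[OF ab(2)] by blast
      qed
    qed
    show "\<forall>a<length D'.
        (\<exists>M. max_matching (component G D' a) M \<and> card M = card (fst (D' ! a)) \<and> card M = card (snd (D' ! a))) \<and>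
        (\<forall>e\<in>edges (component G D' a). \<exists>M. max_matching (component G D' a) M \<and> e \<in> M)"
    proof (intro allI impI)
      fix a assume a: "a < length D'"
      consider "a = k" | "a = Suc k" | "a \<noteq> k" "a \<noteq> Suc k" by blast
      then show "(\<exists>M. max_matching (component G D' a) M \<and> card M = card (fst (D' ! a)) \<and> card M = card (snd (D' ! a))) \<and>
        (\<forall>e\<in>edges (component G D' a). \<exists>M. max_matching (component G D' a) M \<and> e \<in> M)"
      proof cases
        case 1
        show ?thesis unfolding 1 compk nthk fst_conv snd_conv using part[of X] by simp
      next
        case 2
        show ?thesis unfolding 2 compk nthk fst_conv snd_conv using part[of Y] by simp
      next
        case 3
        show ?thesis unfolding comp_other[OF a 3] nth_other[OF a 3]
          using perfect_comp[OF \<phi>_less[OF a]] edge_in_matching[OF \<phi>_less[OF a]] by simp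
      qed
    qed
    show "\<forall>a<length D'. \<forall>b<length D'. edges G \<inter> fst (D' ! a) \<times> snd (D' ! b) \<noteq> {} \<longrightarrow> a \<le> b"
    proof (intro allI impI, rule ccontr)
      fix a b assume a: "a < length D'" and b: "b < length D'"
        and ne: "edges G \<inter> fst (D' ! a) \<times> snd (D' ! b) \<noteq> {}" and "\<not> a \<le> b"
      have "edges G \<inter> L (\<phi> a) \<times> R (\<phi> b) \<noteq> {}" using ne sub[OF a] sub[OF b] by blast
      then have "\<phi> a \<le> \<phi> b" using block_order \<phi>_less a b by simp
      moreover have "\<phi> b \<le> \<phi> a" using \<open>\<not> a \<le> b\<close> by (auto simp: \<phi>_def)
      ultimately have "a = Suc k" "b = k" using \<phi>_eq[of a b] \<open>\<not> a \<le> b\<close> by auto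
      then show False using ne nthk YXe by auto
    qed
    show "\<forall>M. max_matching G M \<longleftrightarrow> M \<subseteq> (\<Union>a<length D'. edges (component G D' a)) \<and>
        (\<forall>a<length D'. max_matching (component G D' a) (M \<inter> edges (component G D' a)))"
    proof
      fix M
      have "(\<forall>a<length D'. max_matching (component G D' a) (M \<inter> edges (component G D' a))) \<longleftrightarrow>
          max_matching (component G D k) (M \<inter> edges (component G D k)) \<and>
          (\<forall>m<length D. m \<noteq> k \<longrightarrow> max_matching (component G D m) (M \<inter> edges (component G D m)))"
        unfolding all_split[of "\<lambda>C. max_matching C (M \<inter> edges C)"] split_max by simp
      also have "\<dots> \<longleftrightarrow> (\<forall>m<length D. max_matching (component G D m) (M \<inter> edges (component G D m)))"
        using k by metis
      finally show "max_matching G M \<longleftrightarrow> M \<subseteq> (\<Union>a<length D'. edges (component G D' a)) \<and>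
        (\<forall>a<length D'. max_matching (component G D' a) (M \<inter> edges (component G D' a)))"
        unfolding UnE by (simp only: max_iff)
    qed
  qed
  moreover have "refines D' D"
    unfolding refines_def
  proof
    fix P assume "P \<in> set D'"
    then obtain a where "a < length D'" "P = D' ! a" by (metis in_set_conv_nth)
    then show "\<exists>Q\<in>set D. fst P \<subseteq> fst Q \<and> snd P \<subseteq> snd Q"
      using sub \<phi>_less by (metis nth_mem)
  qed
  ultimately have "set D' = set D" using DM unfolding DM_decomposition_def by simp
  then have "D ! k \<in> set D'" using k by simp
  then obtain a where a: "a < length D'" "D' ! a = D ! k" by (metis in_set_conv_nth)
  consider "a = k" | "a = Suc k" | "a \<noteq> k" "a \<noteq> Suc k" by blast
  then show False
  proof cases
    case 1
    then have "L k = X" using a nthk by (metis fst_conv)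
    then show False using r'Y XY by blast
  next
    case 2
    then have "L k = Y" using a nthk by (metis fst_conv)
    then show False using rX XY by blast
  next
    case 3
    then have "L (\<phi> a) = L k" using a nth_other by metis
    then show False using disjoint[OF \<phi>_less[OF a(1)] k \<phi>_k[OF 3]] nonempty[OF k] by simp
  qed
qed

section \<open>The set Omega and the tail graph\<close>

lemma gamma_nz_iff:
  assumes k: "k < length D"
  shows "gamma_nz Hbar (component G D k) = 1 \<longleftrightarrow>
    (\<exists>l. (l, l) \<in> U \<and> (l, l) \<in> edges (component G D k)) \<or>
    (\<exists>M M'. max_matching (component G D k) M \<and> max_matching (component G D k) M' \<and>
      card (M \<inter> lambda_edges Hbar) < card (M' \<inter> lambda_edges Hbar))"
proof -
  let ?C = "component G D k" and ?c = "\<lambda>M. card (M \<inter> lambda_edges Hbar)"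
  let ?A = "?c ` {M. max_matching ?C M}"
  have "finite (edges ?C)"
    by (rule finite_subset[OF component_edges_sub finite_cartesian_product[OF finite_L[OF k] finite_R[OF k]]])
  then have "finite {M. max_matching ?C M}"
    by (rule finite_subset[rotated, OF iffD2[OF finite_Pow_iff]]) (auto simp: max_matching_def matching_def)
  then have fin: "finite ?A" by simp
  obtain M0 where M0: "max_matching ?C M0" using perfect_comp[OF k] by blast
  then have ne: "?A \<noteq> {}" by blast
  have "gamma_max Hbar ?C - gamma_min Hbar ?C > 0 \<longleftrightarrow> Min ?A < Max ?A"
    by (auto simp: gamma_max_def gamma_min_def)
  also have "\<dots> \<longleftrightarrow> (\<exists>x\<in>?A. \<exists>y\<in>?A. x < y)"
  proof
    assume "Min ?A < Max ?A"
    then show "\<exists>x\<in>?A. \<exists>y\<in>?A. x < y" using Min_in[OF fin ne] Max_in[OF fin ne] by blast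
  next
    assume "\<exists>x\<in>?A. \<exists>y\<in>?A. x < y"
    then obtain x y where "x \<in> ?A" "y \<in> ?A" "x < y" by blast
    then show "Min ?A < Max ?A"
      using Min_le[OF fin, of x] Max_ge[OF fin, of y] by linarith
  qed
  also have "\<dots> \<longleftrightarrow> (\<exists>M M'. max_matching ?C M \<and> max_matching ?C M' \<and> ?c M < ?c M')" by blast
  finally have gap: "gamma_max Hbar ?C - gamma_min Hbar ?C > 0 \<longleftrightarrow>
    (\<exists>M M'. max_matching ?C M \<and> max_matching ?C M' \<and> ?c M < ?c M')" .
  have loop: "edges ?C \<inter> self_loops Hbar \<noteq> {} \<longleftrightarrow> (\<exists>l. (l, l) \<in> U \<and> (l, l) \<in> edges ?C)"
    using Hbar by (auto simp: self_loops_def lambda_edges_def stars_def)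
  show ?thesis unfolding gamma_nz_def gap[symmetric] loop[symmetric] by auto
qed

lemma card_lambda_edges_graph:
  assumes "k < length D"
  shows "card ((\<lambda>r. (r, f r)) ` L k \<inter> lambda_edges Hbar) = card {r \<in> L k. f r = r}"
proof -
  have "(\<lambda>r. (r, f r)) ` L k \<inter> lambda_edges Hbar = (\<lambda>r. (r, f r)) ` {r \<in> L k. f r = r}"
    using L_sub[OF assms] Hbar by (auto simp: lambda_edges_def)
  then show ?thesis by (simp add: card_image inj_on_def)
qed

lemma Omega_iff:
  "k \<in> Omega Hbar D (i, j) \<longleftrightarrow>
     k < length D \<and> k \<le> \<kappa> i \<and> gamma_nz Hbar (component G D k) = 1"
  by (simp add: Omega_def)

definition tail_rows :: "nat \<Rightarrow> nat \<Rightarrow> nat set" where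
  "tail_rows i k = (\<Union>l\<in>{k..\<kappa> i}. L l) - {i}"

definition tail_cols :: "nat \<Rightarrow> nat \<Rightarrow> nat set" where
  "tail_cols i k = (\<Union>l\<in>{k..\<kappa> i}. R l)"

context
  fixes i k assumes i: "i < n" and ki: "k \<le> \<kappa> i"
begin

abbreviation "T \<equiv> tail_graph Hbar D (i, j) k"
abbreviation "W \<equiv> tail_weight Hbar D (i, j) k"
abbreviation "A \<equiv> tail_rows i k"
abbreviation "B \<equiv> tail_cols i k"

lemma k_less: "l \<le> \<kappa> i \<Longrightarrow> l < length D"
  using comp_index(1)[OF i] by simp

lemma mem_tail_rows: "r \<in> A \<longleftrightarrow> r < n \<and> r \<noteq> i \<and> k \<le> \<kappa> r \<and> \<kappa> r \<le> \<kappa> i"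
proof
  assume "r \<in> A"
  then obtain l where l: "l \<in> {k..\<kappa> i}" "r \<in> L l" "r \<noteq> i" unfolding tail_rows_def by blast
  then have "\<kappa> r = l" "r < n" using comp_index_eq[of l r] L_sub[of l] k_less[of l] by auto
  then show "r < n \<and> r \<noteq> i \<and> k \<le> \<kappa> r \<and> \<kappa> r \<le> \<kappa> i" using l by simp
next
  assume "r < n \<and> r \<noteq> i \<and> k \<le> \<kappa> r \<and> \<kappa> r \<le> \<kappa> i"
  then show "r \<in> A" unfolding tail_rows_def using comp_index(2)[of r] by auto
qed

lemma mem_tail_cols: "l \<le> \<kappa> i \<Longrightarrow> k \<le> l \<Longrightarrow> c \<in> R l \<Longrightarrow> c \<in> B"
  unfolding tail_cols_def by auto

lemma finite_tail: "finite A" "finite B"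
  using finite_L finite_R k_less unfolding tail_rows_def tail_cols_def by auto

lemma tail_edges: "edges T = edges G \<inter> A \<times> B"
proof -
  have Asub: "A \<subseteq> {..<n}" using mem_tail_rows by blast
  have Bsub: "B \<subseteq> {..n} - {j}" using R_sub k_less unfolding tail_cols_def by fastforce
  have "edges T = edges (pencil_graph Hbar) \<inter> A \<times> B"
    by (simp add: tail_graph_def induced_def tail_rows_def tail_cols_def)
  also have "\<dots> = edges G \<inter> A \<times> B"
    using Asub Bsub Hbar by (auto simp: pencil_graph_del_def induced_def)
  finally show ?thesis .
qed

lemma tail_edges_sub: "edges T \<subseteq> A \<times> B"
  by (simp add: tail_edges)

lemma tail_max_iff: "max_matching T M \<longleftrightarrow> matching T M \<and> card M = card A"
proof -
  obtain \<pi> where \<pi>: "perfect \<pi>" using perfect_exists by blast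
  have inj: "inj_on \<pi> A" using permutes_inj[OF perfectD(1)[OF \<pi>]] by (rule inj_on_subset) simp
  have e: "(r, \<pi> r) \<in> edges T" if "r \<in> A" for r
    using that mem_tail_rows[of r] perfectD(3)[OF \<pi>, of r] perfect_in_component[OF \<pi>, of r]
      mem_tail_cols[of "\<kappa> r" "\<pi> r"] by (simp add: tail_edges)
  show ?thesis
    using max_matching_iff_perfect[OF finite_tail(1) tail_edges_sub graph_matching[OF inj e]] .
qed

lemma tail_weight_eq:
  assumes "max_matching T M"
  shows "(\<Sum>e\<in>M. W e) = card (M \<inter> edges (component G D k))"
proof -
  have "M \<subseteq> edges T" using assms by (simp add: max_matching_def matching_def)
  then have "finite M"
    by (rule finite_subset[OF subset_trans[OF _ tail_edges_sub] finite_cartesian_product[OF finite_tail]])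
  then have "(\<Sum>e\<in>M. W e) = (\<Sum>e\<in>M \<inter> edges (component G D k). 1)"
    by (subst sum.inter_restrict) (simp_all add: tail_weight_def)
  then show ?thesis by simp
qed

lemma finite_tail_matchings: "finite {M. max_matching T M}"
proof -
  have "finite (edges T)"
    by (rule finite_subset[OF tail_edges_sub finite_cartesian_product[OF finite_tail]])
  then show ?thesis
    by (rule finite_subset[rotated, OF iffD2[OF finite_Pow_iff]]) (auto simp: max_matching_def matching_def)
qed

text \<open>
  An alternating path from component \<open>k\<close> to row \<open>i\<close> frees a column of component \<open>k\<close>, which saves one
  edge of this component. The path stays in the components \<open>k, \<dots>, \<kappa> i\<close> because edges never lead to an
  earlier component.
\<close>

lemma minWMM_less:
  assumes \<pi>: "perfect \<pi>" and r0: "r0 \<in> L k" and path: "(r0, i) \<in> (step \<pi>)\<^sup>*"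
  shows "minWMM T W < card (L k)"
proof -
  have k: "k < length D" using ki k_less by simp
  obtain \<sigma> where \<sigma>: "missing i (\<pi> r0) \<sigma>"
    and moves: "\<forall>r<n. r \<noteq> i \<longrightarrow> \<sigma> r = \<pi> r \<or> (\<exists>r'. (r, r') \<in> step \<pi> \<and> (r', i) \<in> (step \<pi>)\<^sup>* \<and> \<sigma> r = \<pi> r')"
    using shift_along_path[OF \<pi> path i] by blast
  have s: "\<sigma> permutes {..n}" "\<sigma> n = j" "\<sigma> i = \<pi> r0"
    using \<sigma> i by (auto simp: supported_def split: if_splits)
  have \<sigma>inj: "r = r'" if "\<sigma> r = \<sigma> r'" for r r' using injD[OF permutes_inj[OF s(1)] that] .
  have e: "(r, \<sigma> r) \<in> edges T" if r: "r \<in> A" for r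
  proof -
    have r': "r < n" "r \<noteq> i" "k \<le> \<kappa> r" "\<kappa> r \<le> \<kappa> i" using r mem_tail_rows by auto
    consider "\<sigma> r = \<pi> r" | r'' where "(r, r'') \<in> step \<pi>" "(r'', i) \<in> (step \<pi>)\<^sup>*" "\<sigma> r = \<pi> r''"
      using moves r' by blast
    then show ?thesis
    proof cases
      case 1
      then show ?thesis
        using r r' perfectD(3)[OF \<pi>, of r] perfect_in_component[OF \<pi>, of r] mem_tail_cols[of "\<kappa> r" "\<pi> r"]
        by (simp add: tail_edges)
    next
      case 2
      have "\<kappa> r \<le> \<kappa> r''" "\<kappa> r'' \<le> \<kappa> i"
        using comp_index_step[OF \<pi> 2(1)] comp_index_reach[OF \<pi> 2(2)] by auto
      moreover have "r'' < n" "(r, \<pi> r'') \<in> edges G" using 2(1) by (auto simp: step_def)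
      ultimately show ?thesis
        using r r' 2(3) perfect_in_component[OF \<pi>, of r''] mem_tail_cols[of "\<kappa> r''" "\<pi> r''"]
        by (simp add: tail_edges)
    qed
  qed
  have inj: "inj_on \<sigma> A" using \<sigma>inj by (rule inj_onI)
  let ?M = "(\<lambda>r. (r, \<sigma> r)) ` A"
  have max: "max_matching T ?M" using tail_max_iff graph_matching[OF inj e] by blast
  have "snd ` (?M \<inter> edges (component G D k)) \<subseteq> R k - {\<pi> r0}"
  proof
    fix c assume "c \<in> snd ` (?M \<inter> edges (component G D k))"
    then obtain r where r: "r \<in> A" "c = \<sigma> r" "\<sigma> r \<in> R k" unfolding edges_component by auto
    then have "r \<noteq> i" using mem_tail_rows by blast
    then have "\<sigma> r \<noteq> \<pi> r0" using \<sigma>inj[of r i] s(3) by auto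
    then show "c \<in> R k - {\<pi> r0}" using r by simp
  qed
  moreover have "inj_on snd (?M \<inter> edges (component G D k))"
    using max inj_on_subset[of snd ?M] by (auto simp: max_matching_def matching_def)
  ultimately have "card (?M \<inter> edges (component G D k)) \<le> card (R k - {\<pi> r0})"
    using finite_R[OF k] by (intro card_inj_on_le) auto
  also have "\<dots> < card (R k)"
  proof (rule psubset_card_mono[OF finite_R[OF k]])
    have "\<pi> r0 \<in> R k" using bij_betwE[OF perfect_bij_component[OF \<pi> k]] r0 by blast
    then show "R k - {\<pi> r0} \<subset> R k" by blast
  qed
  also have "\<dots> = card (L k)" using card_LR[OF k] by simp
  finally have small: "(\<Sum>e\<in>?M. W e) < card (L k)" using tail_weight_eq[OF max] by simp
  have "minWMM T W \<le> (\<Sum>e\<in>?M. W e)"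
    unfolding minWMM_def using finite_tail_matchings max by (intro Min_le) auto
  then show ?thesis using small by simp
qed

text \<open>
  A column of component \<open>k\<close> can be covered within the tail graph only by an edge of component \<open>k\<close>.
  So a matching that covers all these columns has weight equal to the size of the component, and
  any other maximum matching leaves one of them free.
\<close>

lemma missing_if_minWMM_neq:
  assumes neq: "minWMM T W \<noteq> card (L k)"
  shows "\<exists>c\<in>R k. \<exists>\<sigma>. missing i c \<sigma>"
proof -
  have k: "k < length D" using ki k_less by simp
  obtain \<pi> where \<pi>: "perfect \<pi>" using perfect_exists by blast
  have \<pi>inj: "r = r'" if "\<pi> r = \<pi> r'" for r r' using injD[OF permutes_inj[OF perfectD(1)[OF \<pi>]] that] .
  have inj: "inj_on \<pi> A" using \<pi>inj by (rule inj_onI)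
  have "(r, \<pi> r) \<in> edges T" if "r \<in> A" for r
    using that mem_tail_rows[of r] perfectD(3)[OF \<pi>, of r] perfect_in_component[OF \<pi>, of r]
      mem_tail_cols[of "\<kappa> r" "\<pi> r"] by (simp add: tail_edges)
  then have "max_matching T ((\<lambda>r. (r, \<pi> r)) ` A)"
    using tail_max_iff graph_matching[OF inj] by blast
  then have "{M. max_matching T M} \<noteq> {}" by blast
  then have "minWMM T W \<in> (\<lambda>M. \<Sum>e\<in>M. W e) ` {M. max_matching T M}"
    unfolding minWMM_def using finite_tail_matchings by (intro Min_in) auto
  then obtain M where M: "max_matching T M" "(\<Sum>e\<in>M. W e) \<noteq> card (L k)" using neq by auto
  then have wt: "card (M \<inter> edges (component G D k)) \<noteq> card (L k)" using tail_weight_eq by simp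
  have M': "matching T M" "card M = card A" using M(1) tail_max_iff by auto
  obtain g where g: "inj_on g A" "g ` A \<subseteq> B" "\<forall>r\<in>A. (r, g r) \<in> edges T" "M = (\<lambda>r. (r, g r)) ` A"
    using matching_graph[OF finite_tail tail_edges_sub M'] by blast
  have "\<exists>c\<in>R k. c \<notin> g ` A"
  proof (rule ccontr)
    assume "\<not> (\<exists>c\<in>R k. c \<notin> g ` A)"
    then have all: "c \<in> g ` A" if "c \<in> R k" for c using that by blast
    have "snd ` (M \<inter> edges (component G D k)) = R k"
    proof (intro equalityI subsetI)
      fix c assume c: "c \<in> R k"
      then obtain r where r: "r \<in> A" "c = g r" using all by blast
      then have e: "(r, g r) \<in> edges G" using g(3) by (simp add: tail_edges)
      have r': "r < n" "k \<le> \<kappa> r" using r mem_tail_rows by auto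
      have "edges G \<inter> L (\<kappa> r) \<times> R k \<noteq> {}" using e c r comp_index(2)[OF r'(1)] by blast
      then have "\<kappa> r = k" using block_order[OF comp_index(1)[OF r'(1)] k] r'(2) by simp
      then have "r \<in> L k" using comp_index(2)[OF r'(1)] by simp
      then have "(r, g r) \<in> M \<inter> edges (component G D k)"
        using g(4) r e c by (simp add: edges_component)
      then show "c \<in> snd ` (M \<inter> edges (component G D k))" using r(2) by force
    next
      fix c assume "c \<in> snd ` (M \<inter> edges (component G D k))"
      then show "c \<in> R k" by (auto simp: edges_component)
    qed
    moreover have "inj_on snd (M \<inter> edges (component G D k))"
      using M'(1) inj_on_subset[of snd M] by (auto simp: matching_def)
    ultimately have "card (M \<inter> edges (component G D k)) = card (R k)" using card_image by fastforce
    then show False using wt card_LR[OF k] by simp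
  qed
  then obtain c where c: "c \<in> R k" "c \<notin> g ` A" by blast
  let ?\<sigma> = "\<lambda>r. if r = i then c else if r \<in> A then g r else \<pi> r"
  have cB: "c \<in> B" using mem_tail_cols[of k c] ki c by simp
  have outB: "\<pi> r \<notin> B" if r: "r < n" "r \<noteq> i" "r \<notin> A" for r
  proof
    assume "\<pi> r \<in> B"
    then obtain l where l: "l \<in> {k..\<kappa> i}" "\<pi> r \<in> R l" unfolding tail_cols_def by blast
    then have "\<kappa> r = l"
      using R_unique[OF comp_index(1)[OF r(1)] k_less[of l] perfect_in_component[OF \<pi> r(1)]] by simp
    then show False using l r mem_tail_rows by simp
  qed
  have "missing i c ?\<sigma>"
  proof (rule missingI[OF i])
    show "inj_on ?\<sigma> {..<n}"
    proof (rule inj_onI)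
      fix r r' assume r: "r \<in> {..<n}" "r' \<in> {..<n}" and eq: "?\<sigma> r = ?\<sigma> r'"
      have gB: "g u \<in> B" "g u \<noteq> c" if "u \<in> A" for u using g(2) c(2) that by auto
      have gg: "u = v" if "u \<in> A" "v \<in> A" "g u = g v" for u v using inj_onD[OF g(1)] that by blast
      have iA: "i \<notin> A" using mem_tail_rows by simp
      show "r = r'"
        using eq r iA cB gB[of r] gB[of r'] gg[of r r'] outB[of r] outB[of r'] \<pi>inj[of r r']
        by (simp split: if_splits)
    qed
    show "(r, ?\<sigma> r) \<in> edges G" if "r < n" "r \<noteq> i" for r
      using that g(3) perfectD(3)[OF \<pi>, of r] by (simp add: tail_edges)
    show "?\<sigma> i = c" by simp
    show "c \<le> n" "c \<noteq> j" using c(1) R_sub[OF k] by auto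
    have "n \<notin> A" using mem_tail_rows by simp
    then show "?\<sigma> n = j" using i perfectD(2)[OF \<pi>] by simp
    show "?\<sigma> r = r" if "r > n" for r
      using that i mem_tail_rows[of r] perfectD(1)[OF \<pi>] by (simp add: permutes_def)
  qed
  then show ?thesis using c(1) by blast
qed

end

section \<open>Null vectors at nonzero eigenvalues\<close>

text \<open>
  A self-loop moves the root directly. Without self-loops, two perfect matchings with different
  numbers of diagonal edges give determinants of different order at \<open>z = 0\<close>.
\<close>

lemma moves_roots_in_component:
  assumes k: "k < length D" and nz: "gamma_nz Hbar (component G D k) = 1"
  shows "\<exists>r\<in>L k. \<exists>c\<in>R k. moves_roots n U {n} (\<lambda>_. j) (r, c)"
proof -
  obtain \<pi> where \<pi>: "perfect \<pi>" using perfect_exists by blast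
  let ?rep = "\<lambda>f r. if r \<in> L k then f r else \<pi> r"
  show ?thesis
  proof (cases "\<exists>l. (l, l) \<in> U \<and> (l, l) \<in> edges (component G D k)")
    case True
    then obtain l where l: "(l, l) \<in> U" "(l, l) \<in> edges (component G D k)" by blast
    then have lk: "l \<in> L k" "l \<in> R k" by (simp_all add: edges_component)
    obtain M where M: "max_matching (component G D k) M" "(l, l) \<in> M"
      using edge_in_matching[OF k l(2)] by blast
    obtain f where f: "bij_betw f (L k) (R k)" "\<forall>r\<in>L k. (r, f r) \<in> edges G"
      "M = (\<lambda>r. (r, f r)) ` L k"
      using iffD1[OF component_max_iff[OF k] M(1)] by blast
    have "f l = l" using M(2) f(3) by auto
    then have "moves_roots n U {n} (\<lambda>_. j) (l, l)"
      using moves_roots_self_loop[OF perfect_replace[OF \<pi> k f(1,2)], of l] lk L_sub[OF k] l(1) by auto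
    then show ?thesis using lk by blast
  next
    case False
    then obtain M M' where M: "max_matching (component G D k) M" "max_matching (component G D k) M'"
      and less: "card (M \<inter> lambda_edges Hbar) < card (M' \<inter> lambda_edges Hbar)"
      using nz unfolding gamma_nz_iff[OF k] by blast
    obtain f where f: "bij_betw f (L k) (R k)" "\<forall>r\<in>L k. (r, f r) \<in> edges G"
      "M = (\<lambda>r. (r, f r)) ` L k"
      using iffD1[OF component_max_iff[OF k] M(1)] by blast
    obtain g where g: "bij_betw g (L k) (R k)" "\<forall>r\<in>L k. (r, g r) \<in> edges G"
      "M' = (\<lambda>r. (r, g r)) ` L k"
      using iffD1[OF component_max_iff[OF k] M(2)] by blast
    have count: "card {r. r \<le> n \<and> r \<notin> {n} \<and> (r, ?rep h r) \<notin> U}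
        = card {r \<in> L k. h r = r} + card {r. r < n \<and> r \<notin> L k \<and> (r, \<pi> r) \<notin> U}"
      if h: "bij_betw h (L k) (R k)" "\<forall>r\<in>L k. (r, h r) \<in> edges G" for h
    proof -
      have "(r, h r) \<notin> U \<longleftrightarrow> h r = r" if r: "r \<in> L k" for r
      proof -
        have "h r \<in> R k" "(r, h r) \<in> edges G" using bij_betwE[OF h(1)] h(2) r by auto
        then show ?thesis using False r edges_G edges_component by auto
      qed
      then have "{r. r \<le> n \<and> r \<notin> {n} \<and> (r, ?rep h r) \<notin> U}
          = {r \<in> L k. h r = r} \<union> {r. r < n \<and> r \<notin> L k \<and> (r, \<pi> r) \<notin> U}"
        using L_sub[OF k] by auto
      then show ?thesis
        using finite_L[OF k] by (simp add: card_Un_disjoint disjoint_iff)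
    qed
    have "\<exists>x\<in>L k \<times> R k. moves_roots n U {n} (\<lambda>_. j) x"
    proof (rule moves_roots_if_order_differs)
      show "finite (L k \<times> R k)" using finite_L[OF k] finite_R[OF k] by simp
      show "perfect (?rep f)" by (rule perfect_replace[OF \<pi> k f(1,2)])
      show "perfect (?rep g)" by (rule perfect_replace[OF \<pi> k g(1,2)])
      show "indicator_of (?rep f) p = indicator_of (?rep g) p" if "p \<notin> L k \<times> R k" for p
      proof (cases p)
        case (Pair r c)
        have "r \<in> L k \<Longrightarrow> c \<noteq> f r \<and> c \<noteq> g r"
          using that Pair bij_betwE[OF f(1)] bij_betwE[OF g(1)] by auto
        then show ?thesis unfolding Pair by (simp add: indicator_of_def)
      qed
      show "card {r. r \<le> n \<and> r \<notin> {n} \<and> (r, ?rep f r) \<notin> U}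
          < card {r. r \<le> n \<and> r \<notin> {n} \<and> (r, ?rep g r) \<notin> U}"
        unfolding count[OF f(1,2)] count[OF g(1,2)]
        using less unfolding f(3) g(3) card_lambda_edges_graph[OF k] by simp
    qed
    then show ?thesis by blast
  qed
qed

text \<open>
  The column that is freed by a light matching and the column of the entry that moves the roots
  need not agree, but strong connectivity transfers the path to \<open>i\<close> from one to the other.
\<close>

theorem root_and_minor_if_condition_fails:
  assumes i: "i < n" and k: "k \<in> Omega Hbar D (i, j)"
    and neq: "minWMM (tail_graph Hbar D (i, j) k) (tail_weight Hbar D (i, j) k) \<noteq> card (L k)"
  shows "\<exists>r c \<sigma>. moves_roots n U {n} (\<lambda>_. j) (r, c) \<and> missing i c \<sigma>"
proof -
  have kk: "k < length D" "k \<le> \<kappa> i" "gamma_nz Hbar (component G D k) = 1"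
    using k by (auto simp: Omega_iff)
  obtain \<pi> where \<pi>: "perfect \<pi>" using perfect_exists by blast
  have onto: "\<exists>r\<in>L k. c = \<pi> r" if "c \<in> R k" for c
    using perfect_bij_component[OF \<pi> kk(1)] that by (auto simp: bij_betw_def)
  obtain r c where rc: "c \<in> R k" "moves_roots n U {n} (\<lambda>_. j) (r, c)"
    using moves_roots_in_component[OF kk(1,3)] by blast
  obtain c0 \<sigma>0 where c0: "c0 \<in> R k" "missing i c0 \<sigma>0"
    using missing_if_minWMM_neq[OF i kk(2) neq] by blast
  obtain r0 where r0: "r0 \<in> L k" "c0 = \<pi> r0" using onto[OF c0(1)] by blast
  obtain r1 where r1: "r1 \<in> L k" "c = \<pi> r1" using onto[OF rc(1)] by blast
  have "(r0, i) \<in> (step \<pi>)\<^sup>*"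
    using path_if_missing[OF \<pi> i c0(2)[unfolded r0(2)]] r0(1) L_sub[OF kk(1)] by auto
  then have "(r1, i) \<in> (step \<pi>)\<^sup>*"
    by (rule rtrancl_trans[OF reach_in_component[OF \<pi> kk(1) r1(1) r0(1)]])
  then obtain \<sigma> where "missing i c \<sigma>"
    using shift_along_path[OF \<pi> _ i, of r1] r1(2) by auto
  then show ?thesis using rc(2) by blast
qed

text \<open>
  The set \<open>S\<close> of rows that reach \<open>i\<close> satisfies the assumptions of
  \<open>left_null_vanishes_on_closed_rows\<close>: a component that meets \<open>S\<close> is not in \<open>Omega\<close>, as otherwise
  its weight could be reduced.
\<close>

theorem null_vectors_vanish_if_condition_holds:
  assumes i: "i < n"
    and cond: "\<And>k. k \<in> Omega Hbar D (i, j) \<Longrightarrow>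
      minWMM (tail_graph Hbar D (i, j) k) (tail_weight Hbar D (i, j) k) = card (L k)"
  shows "\<exists>g b. multi_poly g \<and> g b \<noteq> 0 \<and>
    (\<forall>a z q. g a \<noteq> 0 \<longrightarrow> z \<noteq> 0 \<longrightarrow> deleted_null n U j z a q \<longrightarrow> q i = 0)"
proof -
  obtain \<pi> where \<pi>: "perfect \<pi>" using perfect_exists by blast
  define S where "S = {r. (r, i) \<in> (step \<pi>)\<^sup>*}"
  have S: "S \<subseteq> {..<n}" using reach_less i unfolding S_def by blast
  have iS: "i \<in> S" by (simp add: S_def)
  have calm: "gamma_nz Hbar (component G D (\<kappa> r)) \<noteq> 1" if r: "r \<in> S" for r
  proof
    assume nz: "gamma_nz Hbar (component G D (\<kappa> r)) = 1"
    have path: "(r, i) \<in> (step \<pi>)\<^sup>*" using r by (simp add: S_def)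
    have rn: "r < n" using r S by blast
    have le: "\<kappa> r \<le> \<kappa> i" by (rule comp_index_reach[OF \<pi> path])
    have "\<kappa> r \<in> Omega Hbar D (i, j)" using nz le comp_index(1)[OF rn] by (simp add: Omega_iff)
    then show False
      using cond minWMM_less[OF i le \<pi> comp_index(2)[OF rn] path] by simp
  qed
  have fixed: "card {r \<in> L m. \<sigma> r = r} = card {r \<in> L m. \<pi> r = r}"
    if \<sigma>: "perfect \<sigma>" and off: "\<forall>r. r \<notin> S \<longrightarrow> \<sigma> r = \<pi> r" and m: "m < length D" for \<sigma> m
  proof (cases "L m \<inter> S = {}")
    case True
    then have "{r \<in> L m. \<sigma> r = r} = {r \<in> L m. \<pi> r = r}" using off by auto
    then show ?thesis by simp
  next
    case False
    then obtain r where r: "r \<in> L m" "r \<in> S" by blast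
    have nz: "gamma_nz Hbar (component G D m) \<noteq> 1" using calm[OF r(2)] comp_index_eq[OF m r(1)] by simp
    have max: "max_matching (component G D m) ((\<lambda>r. (r, \<tau> r)) ` L m)" if "perfect \<tau>" for \<tau>
    proof -
      have "\<forall>r\<in>L m. (r, \<tau> r) \<in> edges G" using perfectD(3)[OF that] L_sub[OF m] by blast
      then show ?thesis
        using iffD2[OF component_max_iff[OF m]] perfect_bij_component[OF that m] by blast
    qed
    have "\<not> card {r \<in> L m. \<sigma> r = r} < card {r \<in> L m. \<pi> r = r}"
      "\<not> card {r \<in> L m. \<pi> r = r} < card {r \<in> L m. \<sigma> r = r}"
      using nz max[OF \<sigma>] max[OF \<pi>] unfolding gamma_nz_iff[OF m] card_lambda_edges_graph[OF m, symmetric]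
      by blast+
    then show ?thesis by simp
  qed
  have total: "card {r. r < n \<and> \<sigma> r = r} = (\<Sum>m<length D. card {r \<in> L m. \<sigma> r = r})" for \<sigma> :: "nat \<Rightarrow> nat"
  proof -
    have "{r. r < n \<and> \<sigma> r = r} = (\<Union>m<length D. {r \<in> L m. \<sigma> r = r})"
      using rows by auto
    moreover have "card (\<Union>m<length D. {r \<in> L m. \<sigma> r = r}) = (\<Sum>m<length D. card {r \<in> L m. \<sigma> r = r})"
    proof (rule card_UN_disjoint)
      show "\<forall>m\<in>{..<length D}. finite {r \<in> L m. \<sigma> r = r}" using finite_L by simp
      show "\<forall>m\<in>{..<length D}. \<forall>m'\<in>{..<length D}. m \<noteq> m' \<longrightarrow>
          {r \<in> L m. \<sigma> r = r} \<inter> {r \<in> L m'. \<sigma> r = r} = {}"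
      proof (intro ballI impI)
        fix m m' assume "m \<in> {..<length D}" "m' \<in> {..<length D}" "m \<noteq> m'"
        then have "L m \<inter> L m' = {}" using disjoint by simp
        then show "{r \<in> L m. \<sigma> r = r} \<inter> {r \<in> L m'. \<sigma> r = r} = {}" by blast
      qed
    qed simp
    ultimately show ?thesis by simp
  qed
  have "\<exists>g b. multi_poly g \<and> g b \<noteq> 0 \<and>
    (\<forall>a z q. g a \<noteq> 0 \<longrightarrow> z \<noteq> 0 \<longrightarrow> deleted_null n U j z a q \<longrightarrow> (\<forall>r\<in>S. q r = 0))"
  proof (rule left_null_vanishes_on_closed_rows[OF \<pi> S])
    show "r \<in> S" if r: "r < n" and r': "r' \<in> S" and e: "(r, \<pi> r') \<in> U \<or> r = \<pi> r'" for r r'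
    proof -
      have rn': "r' < n" using S r' by blast
      have "\<pi> r' \<le> n" "\<pi> r' \<noteq> j" using perfectD(3)[OF \<pi> rn'] by (simp_all add: edges_G)
      then have "(r, r') \<in> step \<pi>" using r rn' e by (auto simp: step_def edges_G)
      then show "r \<in> S" using r' unfolding S_def by (simp add: converse_rtrancl_into_rtrancl)
    qed
  next
    fix \<sigma> r assume \<sigma>: "perfect \<sigma>" and r: "r \<in> S" "\<sigma> r = r"
    have rn: "r < n" using S r by blast
    have "(r, r) \<in> edges (component G D (\<kappa> r))"
      using perfectD(3)[OF \<sigma> rn] perfect_in_component[OF \<sigma> rn] comp_index(2)[OF rn] r(2)
      by (simp add: edges_component)
    then show "(r, r) \<notin> U"
      using calm[OF r(1)] unfolding gamma_nz_iff[OF comp_index(1)[OF rn]] by blast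
  next
    fix \<sigma> assume \<sigma>: "perfect \<sigma>" and off: "\<forall>r. r \<notin> S \<longrightarrow> \<sigma> r = \<pi> r"
    have split: "card {r. r < n \<and> \<tau> r = r} = card {r \<in> S. \<tau> r = r} + card {r. r < n \<and> r \<notin> S \<and> \<tau> r = r}"
      for \<tau> :: "nat \<Rightarrow> nat"
    proof -
      have "{r. r < n \<and> \<tau> r = r} = {r \<in> S. \<tau> r = r} \<union> {r. r < n \<and> r \<notin> S \<and> \<tau> r = r}" using S by auto
      moreover have "finite S" using S finite_subset by blast
      ultimately show ?thesis by (simp add: card_Un_disjoint disjoint_iff)
    qed
    have "card {r. r < n \<and> \<sigma> r = r} = card {r. r < n \<and> \<pi> r = r}"
      unfolding total using fixed[OF \<sigma> off] by simp
    moreover have "{r. r < n \<and> r \<notin> S \<and> \<sigma> r = r} = {r. r < n \<and> r \<notin> S \<and> \<pi> r = r}" using off by auto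
    ultimately show "card {r \<in> S. \<sigma> r = r} = card {r \<in> S. \<pi> r = r}"
      using split[of \<sigma>] split[of \<pi>] by simp
  qed
  then obtain g b where g: "multi_poly g" "g b \<noteq> 0"
    "\<forall>a z q. g a \<noteq> 0 \<longrightarrow> z \<noteq> 0 \<longrightarrow> deleted_null n U j z a q \<longrightarrow> (\<forall>r\<in>S. q r = 0)" by blast
  have "\<forall>a z q. g a \<noteq> 0 \<longrightarrow> z \<noteq> 0 \<longrightarrow> deleted_null n U j z a q \<longrightarrow> q i = 0"
    using g(3) iS by simp
  then show ?thesis using g(1,2) by (intro exI[of _ g] exI[of _ b] conjI)
qed

end

section \<open>Rank and left kernels\<close>

lemma maximal_independent_columns:
  fixes N :: "complex mat"
  assumes N: "N \<in> carrier_mat p q"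
  shows "\<exists>ss. distinct ss \<and> set ss \<subseteq> set (cols N) \<and> length ss = vec_space.rank p N \<and> length ss \<le> p \<and>
    \<not> module.lin_dep class_ring (module_vec TYPE(complex) p) (set ss) \<and>
    set (cols N) \<subseteq> LinearCombinations.module.span class_ring (module_vec TYPE(complex) p) (set ss)"
proof -
  interpret vec_space "TYPE(complex)" p .
  have car: "set (cols N) \<subseteq> carrier_vec p" using cols_dim N by blast
  obtain S where max: "maximal S (\<lambda>T. T \<subseteq> set (cols N) \<and> lin_indpt T)"
    using maximal_exists[of "(\<lambda>T. T \<subseteq> set (cols N) \<and> lin_indpt T)" "card (set (cols N))" "{}"]
    by (meson List.finite_set card_mono empty_iff empty_subsetI finite_lin_indpt2 rev_finite_subset)
  have S: "S \<subseteq> set (cols N)" "lin_indpt S" using max by (auto simp: maximal_def)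
  have fin: "finite S" using S(1) finite_subset by blast
  obtain ss where ss: "set ss = S" "distinct ss" using finite_distinct_list[OF fin] by blast
  have "length ss = rank N"
    using rank_card_indpt[OF N max] distinct_card[OF ss(2)] ss(1) by simp
  moreover have "card S \<le> p" using li_le_dim(2)[of S] S car dim_is_n by auto
  moreover have "v \<in> span S" if v: "v \<in> set (cols N)" for v
  proof (cases "v \<in> S")
    case True
    then show ?thesis using in_own_span[of S] S(1) car by auto
  next
    case False
    show ?thesis
    proof (rule ccontr)
      assume "v \<notin> span S"
      then have "lin_indpt (S \<union> {v})"
        using lin_dep_iff_in_span[of S v] S car v False by auto
      then have "S \<union> {v} \<subseteq> set (cols N) \<and> lin_indpt (S \<union> {v})" using S v by auto
      then have "S \<union> {v} = S" using max unfolding maximal_def by blast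
      then show False using False by blast
    qed
  qed
  ultimately show ?thesis
    using ss S distinct_card[OF ss(2)] by (intro exI[of _ ss]) auto
qed

lemma annihilator_exists:
  fixes cs :: "complex vec list"
  assumes "length cs < p"
  shows "\<exists>x. (\<exists>r<p. x r \<noteq> 0) \<and> (\<forall>v\<in>set cs. (\<Sum>r<p. x r * v $ r) = 0)"
proof -
  let ?f = "\<lambda>r k. if k < length cs then (cs ! k) $ r else 0"
  have "det (mat p p (\<lambda>(k, r). ?f r k)) = 0"
    unfolding det_zero_iff_left_kernel
    by (rule exI[of _ "\<lambda>k. if k = p - 1 then 1 else 0"]) (use assms in \<open>auto intro!: sum.neutral\<close>)
  then have "det (mat p p (\<lambda>(r, k). ?f r k)) = 0" unfolding det_swap[of p ?f] .
  then obtain x where x: "\<exists>r<p. x r \<noteq> 0" "\<forall>k<p. (\<Sum>r<p. x r * ?f r k) = 0"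
    unfolding det_zero_iff_left_kernel by blast
  have "(\<Sum>r<p. x r * v $ r) = 0" if v: "v \<in> set cs" for v
  proof -
    obtain k where k: "k < length cs" "cs ! k = v" using v by (metis in_set_conv_nth)
    then have "(\<Sum>r<p. x r * ?f r k) = 0" using x(2)[rule_format, of k] assms by linarith
    then show ?thesis using k by simp
  qed
  then show ?thesis using x(1) by blast
qed

text \<open>
  The columns are spanned by \<open>rank N\<close> of them. Fewer than \<open>p\<close> vectors have a common nonzero
  annihilator, even together with the additional vectors \<open>hs\<close>.
\<close>

lemma rank_deficient_annihilator:
  fixes N :: "complex mat"
  assumes N: "N \<in> carrier_mat p q" and less: "vec_space.rank p N + length hs < p"
  shows "\<exists>x. (\<exists>r<p. x r \<noteq> 0) \<and> (\<forall>c<q. (\<Sum>r<p. x r * N $$ (r, c)) = 0) \<and>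
    (\<forall>h\<in>set hs. (\<Sum>r<p. x r * h $ r) = 0)"
proof -
  interpret vec_space "TYPE(complex)" p .
  obtain ss where ss: "set ss \<subseteq> set (cols N)" "length ss = rank N" "set (cols N) \<subseteq> span (set ss)"
    using maximal_independent_columns[OF N] by blast
  obtain x where x: "\<exists>r<p. x r \<noteq> 0" "\<forall>v\<in>set (ss @ hs). (\<Sum>r<p. x r * v $ r) = 0"
    using annihilator_exists[of "ss @ hs" p] less ss(2) by auto
  have car: "set ss \<subseteq> carrier_vec p" using ss(1) cols_dim N by blast
  have "(\<Sum>r<p. x r * N $$ (r, c)) = 0" if c: "c < q" for c
  proof -
    have "col N c \<in> set (cols N)" using c N by (auto simp: cols_def)
    then have "col N c \<in> span (set ss)" using ss(3) by blast
    then obtain a A where A: "col N c = lincomb a A" "finite A" "A \<subseteq> set ss"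
      using in_spanE by blast
    have "(\<Sum>r<p. x r * N $$ (r, c)) = (\<Sum>r<p. x r * (\<Sum>v\<in>A. a v * v $ r))"
    proof (rule sum.cong)
      fix r assume "r \<in> {..<p}"
      then show "x r * N $$ (r, c) = x r * (\<Sum>v\<in>A. a v * v $ r)"
        using lincomb_index[of r A a] A car N c by (metis carrier_matD index_col lessThan_iff subset_trans)
    qed simp
    also have "\<dots> = (\<Sum>v\<in>A. a v * (\<Sum>r<p. x r * v $ r))"
      unfolding sum_distrib_left by (subst sum.swap) (simp add: mult_ac)
    also have "\<dots> = 0" using x(2) A(3) by (intro sum.neutral) auto
    finally show ?thesis .
  qed
  then show ?thesis using x by auto
qed

lemma full_rank_annihilator:
  fixes N :: "complex mat"
  assumes N: "N \<in> carrier_mat p q" and rank: "vec_space.rank p N = p"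
    and x: "\<forall>c<q. (\<Sum>r<p. x r * N $$ (r, c)) = 0" and r: "r < p"
  shows "x r = 0"
proof (rule ccontr)
  assume "x r \<noteq> 0"
  interpret vec_space "TYPE(complex)" p .
  obtain ss where ss: "distinct ss" "set ss \<subseteq> set (cols N)" "length ss = p" "lin_indpt (set ss)"
    using maximal_independent_columns[OF N] rank by metis
  have car: "set ss \<subseteq> carrier_vec p" using ss(2) cols_dim N by blast
  let ?M = "mat p p (\<lambda>(r, k). (ss ! k) $ r)"
  have cols: "cols ?M = ss"
  proof (rule nth_equalityI)
    fix k assume k: "k < length (cols ?M)"
    then have "ss ! k \<in> carrier_vec p" using car ss(3) by (metis cols_length dim_col_mat(1) nth_mem subsetD)
    then show "cols ?M ! k = ss ! k" using k by (intro eq_vecI) auto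
  qed (simp add: ss(3))
  have "rank ?M = p"
    by (rule lin_indpt_full_rank) (simp_all only: cols ss mat_carrier not_False_eq_True)
  then have "det ?M \<noteq> 0" using det_rank_iff[of ?M] by simp
  moreover have "(\<Sum>r<p. x r * (ss ! k) $ r) = 0" if k: "k < p" for k
  proof -
    have "ss ! k \<in> set (cols N)" using k ss(2,3) by (metis nth_mem subsetD)
    then obtain c where c: "c < q" "ss ! k = col N c" using N by (auto simp: cols_def)
    have "(\<Sum>r<p. x r * (ss ! k) $ r) = (\<Sum>r<p. x r * N $$ (r, c))"
      unfolding c(2) using N c(1) by (intro sum.cong) auto
    then show ?thesis using x c(1) by simp
  qed
  ultimately show False
    unfolding det_zero_iff_left_kernel using \<open>x r \<noteq> 0\<close> r by blast
qed

section \<open>Generic rank of a submatrix\<close>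

definition dependent_rows ::
  "(nat \<times> nat) set \<Rightarrow> nat set \<Rightarrow> nat set \<Rightarrow> (nat \<times> nat \<Rightarrow> complex) \<Rightarrow> bool" where
  "dependent_rows U I J a \<longleftrightarrow>
     (\<exists>q. (\<exists>r\<in>I. q r \<noteq> 0) \<and> (\<forall>c\<in>J. (\<Sum>r\<in>I. q r * star_fun U a r c) = 0))"

lemma bij_betw_pick:
  assumes "finite I" shows "bij_betw (pick I) {..<card I} I"
proof -
  have "inj_on (pick I) {..<card I}"
    by (rule linorder_inj_onI) (use pick_mono_le[of _ I] in fastforce)+
  moreover have "pick I ` {..<card I} \<subseteq> I" using pick_in_set_le by auto
  ultimately show ?thesis
    unfolding bij_betw_def using assms by (metis card_image card_lessThan card_subset_eq)
qed

text \<open>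
  The generic rank equals the number of rows iff the rows are independent for some parameters. The
  third part is used with a further column \<open>h\<close>: adding one column raises the rank by at most one.
\<close>

lemma grank_submatrix:
  assumes H: "Hbar \<in> carrier_mat n m" and I: "I \<subseteq> {..<n}" and J: "J \<subseteq> {..<m}"
  defines "M \<equiv> submatrix Hbar I J"
  shows "\<exists>a. grank M = card I \<longrightarrow> \<not> dependent_rows (stars Hbar) I J a"
    and "grank M \<noteq> card I \<Longrightarrow> dependent_rows (stars Hbar) I J a"
    and "grank M + 1 < card I \<Longrightarrow>
      \<exists>q. (\<exists>r\<in>I. q r \<noteq> 0) \<and> (\<forall>c\<in>J. (\<Sum>r\<in>I. q r * star_fun (stars Hbar) a r c) = 0) \<and>
        (\<Sum>r\<in>I. q r * h r) = 0"
    and "grank M \<le> card I"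
proof -
  let ?U = "stars Hbar" and ?p = "card I" and ?q = "card J"
  have fin: "finite I" "finite J" using I J finite_subset by blast+
  have bI: "bij_betw (pick I) {..<?p} I" and bJ: "bij_betw (pick J) {..<?q} J"
    using bij_betw_pick fin by blast+
  have eqI: "{i. i < dim_row Hbar \<and> i \<in> I} = I" and eqJ: "{j. j < dim_col Hbar \<and> j \<in> J} = J"
    using H I J by auto
  have M: "M \<in> carrier_mat ?p ?q" "\<And>r c. r < ?p \<Longrightarrow> c < ?q \<Longrightarrow> M $$ (r, c) = Hbar $$ (pick I r, pick J c)"
    unfolding M_def submatrix_def eqI eqJ by auto
  have mem: "pick I r \<in> I" if "r < ?p" for r using bij_betwE[OF bI] that by blast
  have memJ: "pick J c \<in> J" if "c < ?q" for c using bij_betwE[OF bJ] that by blast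
  have U: "M $$ (r, c) \<longleftrightarrow> (pick I r, pick J c) \<in> ?U" if "r < ?p" "c < ?q" for r c
    using M(2)[OF that] mem[OF that(1)] memJ[OF that(2)] I J H by (auto simp: stars_def)
  have onto: "\<exists>s<?p. pick I s = r" if "r \<in> I" for r
    using bI that unfolding bij_betw_def by (metis imageE lessThan_iff)
  have ontoJ: "\<exists>d<?q. pick J d = c" if "c \<in> J" for c
    using bJ that unfolding bij_betw_def by (metis imageE lessThan_iff)
  define N where "N a = mat ?p ?q (\<lambda>(r, c). star_fun ?U a (pick I r) (pick J c))" for a
  have Ncar: "N a \<in> carrier_mat ?p ?q" for a by (simp add: N_def)
  have Nre: "N a \<in> realizations M" for a
    using M(1) U by (auto simp: realizations_def N_def star_fun_def)
  have re_N: "\<exists>a. X = N a" if X: "X \<in> realizations M" for X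
  proof -
    let ?i = "inv_into {..<?p} (pick I)" and ?j = "inv_into {..<?q} (pick J)"
    have inv: "?i (pick I r) = r" if "r < ?p" for r
      using bI that by (intro inv_into_f_f) (auto simp: bij_betw_def)
    have invJ: "?j (pick J c) = c" if "c < ?q" for c
      using bJ that by (intro inv_into_f_f) (auto simp: bij_betw_def)
    have "X = N (\<lambda>(r, c). X $$ (?i r, ?j c))"
    proof (rule eq_matI)
      fix r c assume "r < dim_row (N (\<lambda>(r, c). X $$ (?i r, ?j c)))" "c < dim_col (N (\<lambda>(r, c). X $$ (?i r, ?j c)))"
      then have rc: "r < ?p" "c < ?q" by (auto simp: N_def)
      then show "X $$ (r, c) = N (\<lambda>(r, c). X $$ (?i r, ?j c)) $$ (r, c)"
        using X U[OF rc] M(1) inv invJ by (auto simp: realizations_def N_def star_fun_def)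
    qed (use X M(1) in \<open>auto simp: realizations_def N_def\<close>)
    then show ?thesis by blast
  qed
  let ?R = "(\<lambda>X. vec_space.rank (dim_row M) X) ` realizations M"
  have R: "?R = range (\<lambda>a. vec_space.rank ?p (N a))"
    using M(1) Nre re_N by auto blast+
  have le: "vec_space.rank ?p (N a) \<le> ?p" for a
    using maximal_independent_columns[OF Ncar[of a]] by metis
  have finR: "finite ?R" by (rule finite_subset[of _ "{..?p}"]) (use le R in auto)
  have inR: "vec_space.rank ?p (N a) \<in> ?R" for a unfolding R by (rule rangeI)
  have gr: "grank M \<in> ?R" "vec_space.rank ?p (N a) \<le> grank M" for a
  proof -
    have "?R \<noteq> {}" using inR by blast
    then show "grank M \<in> ?R" unfolding grank_def by (rule Max_in[OF finR])
    show "vec_space.rank ?p (N a) \<le> grank M" unfolding grank_def by (rule Max_ge[OF finR inR])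
  qed
  obtain a0 where a0: "grank M = vec_space.rank ?p (N a0)" using gr(1) R by auto
  show "grank M \<le> card I" using le a0 by simp
  have sumI: "(\<Sum>r\<in>I. g r) = (\<Sum>r<?p. g (pick I r))" for g :: "nat \<Rightarrow> complex"
    using sum.reindex_bij_betw[OF bI, of g] by simp
  have dep: "\<not> dependent_rows ?U I J a" if rk: "vec_space.rank ?p (N a) = ?p" for a
  proof
    assume "dependent_rows ?U I J a"
    then obtain q r where q: "r \<in> I" "q r \<noteq> 0" "\<forall>c\<in>J. (\<Sum>r\<in>I. q r * star_fun ?U a r c) = 0"
      unfolding dependent_rows_def by blast
    obtain s where s: "s < ?p" "pick I s = r" using onto[OF q(1)] by blast
    have "\<forall>c<?q. (\<Sum>r<?p. q (pick I r) * N a $$ (r, c)) = 0"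
      using q(3) memJ unfolding sumI by (auto simp: N_def)
    from full_rank_annihilator[OF Ncar rk this s(1)] show False using q(2) s(2) by simp
  qed
  have ann: "\<exists>q. (\<exists>r\<in>I. q r \<noteq> 0) \<and> (\<forall>c\<in>J. (\<Sum>r\<in>I. q r * star_fun ?U a r c) = 0) \<and>
        (\<forall>h\<in>set hs. (\<Sum>r\<in>I. q r * h r) = 0)"
    if less: "vec_space.rank ?p (N a) + length hs < ?p" for a hs
  proof -
    let ?hs = "map (\<lambda>h. vec ?p (\<lambda>r. h (pick I r))) hs"
    have "vec_space.rank ?p (N a) + length ?hs < ?p" using less by simp
    from rank_deficient_annihilator[OF Ncar this] obtain x where x: "\<exists>r<?p. x r \<noteq> 0"
      "\<forall>c<?q. (\<Sum>r<?p. x r * N a $$ (r, c)) = 0" "\<forall>h\<in>set ?hs. (\<Sum>r<?p. x r * h $ r) = 0" by blast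
    let ?i = "inv_into {..<?p} (pick I)"
    have inv: "?i (pick I r) = r" if "r < ?p" for r
      using bI that by (intro inv_into_f_f) (auto simp: bij_betw_def)
    define q where "q r = x (?i r)" for r
    have "\<exists>r\<in>I. q r \<noteq> 0" using x(1) mem inv by (metis q_def)
    moreover have "(\<Sum>r\<in>I. q r * star_fun ?U a r c) = 0" if c: "c \<in> J" for c
    proof -
      obtain d where d: "d < ?q" "pick J d = c" using ontoJ[OF c] by blast
      have "(\<Sum>r\<in>I. q r * star_fun ?U a r c) = (\<Sum>r<?p. x r * N a $$ (r, d))"
        unfolding sumI using d inv by (intro sum.cong) (auto simp: N_def q_def)
      then show ?thesis using x(2) d(1) by simp
    qed
    moreover have "(\<Sum>r\<in>I. q r * h r) = 0" if "h \<in> set hs" for h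
    proof -
      have "(\<Sum>r\<in>I. q r * h r) = (\<Sum>r<?p. x r * vec ?p (\<lambda>r. h (pick I r)) $ r)"
        unfolding sumI using inv by (intro sum.cong) (auto simp: q_def)
      then show ?thesis using x(3) that by simp
    qed
    ultimately show ?thesis by blast
  qed
  show "\<exists>a. grank M = card I \<longrightarrow> \<not> dependent_rows (stars Hbar) I J a"
    using dep[of a0] a0 by auto
  have dep_if: "dependent_rows ?U I J a" if "vec_space.rank ?p (N a) \<noteq> ?p" for a
    using ann[of a "[]"] le[of a] that unfolding dependent_rows_def by auto
  show "grank M \<noteq> card I \<Longrightarrow> dependent_rows (stars Hbar) I J a"
    using dep_if[of a] gr(2)[of a] le[of a] le[of a0] a0 by linarith
  show "grank M + 1 < card I \<Longrightarrow>
      \<exists>q. (\<exists>r\<in>I. q r \<noteq> 0) \<and> (\<forall>c\<in>J. (\<Sum>r\<in>I. q r * star_fun (stars Hbar) a r c) = 0) \<and>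
        (\<Sum>r\<in>I. q r * h r) = 0"
    using ann[of a "[h]"] gr(2)[of a] by simp
qed

text \<open>
  If the rows other than \<open>i\<close> are independent, they remain so on a generic set of parameters. The
  polynomial \<open>f\<close> that witnesses this is the determinant in which row \<open>i\<close> is replaced by the conjugate
  of a vector \<open>w\<close> orthogonal to the other rows at \<open>b\<close>; it is nonzero there because \<open>w\<close> is not
  orthogonal to itself.
\<close>

lemma row_completion:
  assumes i: "i < n" and j: "j \<le> n" and indep: "\<not> dependent_rows U ({..<n} - {i}) ({..n} - {j}) b"
  shows "\<exists>f. multi_poly f \<and> f b \<noteq> 0 \<and>
    (\<forall>a q. f a \<noteq> 0 \<longrightarrow> deleted_null n U j 0 a q \<longrightarrow> q i = 0 \<longrightarrow> (\<forall>r<n. q r = 0))"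
proof -
  let ?B = "bordered U {n} (\<lambda>_. j) 0"
  let ?I = "{..<n} - {i}"
  have B: "?B a r c = star_fun U a r c" if "r < n" for a r c
    using that by (simp add: bordered_def pencil_def)
  have Bn: "?B a n c = (if c = j then 1 else 0)" for a c by (simp add: bordered_def)
  have I_sum: "(\<Sum>r<n. q r * ?B a r c) = (\<Sum>r\<in>?I. q r * star_fun U a r c)" if "q i = 0" for q a c
    using i that by (subst sum.remove[of _ i]) (auto intro!: sum.cong simp: B)
  \<comment> \<open>A vector orthogonal to all the other rows completes them to a nonsingular matrix.\<close>
  obtain w where w: "\<exists>c<Suc n. w c \<noteq> 0" "\<forall>r<Suc n. (\<Sum>c<Suc n. w c * (if r = i then 0 else ?B b r c)) = 0"
  proof -
    let ?Z = "\<lambda>r c. if r = i then 0 else ?B b r c"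
    have "det (mat (Suc n) (Suc n) (\<lambda>(r, c). ?Z r c)) = 0"
      unfolding det_zero_iff_left_kernel
      by (rule exI[of _ "\<lambda>r. if r = i then 1 else 0"]) (use i in \<open>auto intro!: sum.neutral exI[of _ i]\<close>)
    then have "det (mat (Suc n) (Suc n) (\<lambda>(c, r). ?Z r c)) = 0" unfolding det_swap[of "Suc n" ?Z] .
    then show thesis using that unfolding det_zero_iff_left_kernel by blast
  qed
  define F where "F a r c = (if r = i then cnj (w c) else ?B a r c)" for a r c
  define f where "f a = det (mat (Suc n) (Suc n) (\<lambda>(r, c). F a r c))" for a
  have mp: "multi_poly f"
    unfolding f_def
  proof (rule poly_expr_det)
    fix r c assume "r < Suc n" "c < Suc n"
    moreover have "multi_poly (\<lambda>a. F a r c)"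
      unfolding F_def bordered_def pencil_def
      by (intro poly_expr_if poly_expr_const poly_expr_diff multi_poly_star_fun)
    ultimately show "multi_poly (\<lambda>a. mat (Suc n) (Suc n) (\<lambda>(r, c). F a r c) $$ (r, c))" by simp
  qed simp
  have zero: "f a = 0 \<longleftrightarrow> (\<exists>q. (\<exists>r<Suc n. q r \<noteq> 0) \<and> (\<forall>c<Suc n. (\<Sum>r<Suc n. q r * F a r c) = 0))" for a
    unfolding f_def by (rule det_zero_iff_left_kernel)
  have Fi: "(\<Sum>r<Suc n. q r * F a r c) = (\<Sum>r\<in>?I. q r * star_fun U a r c) + (if c = j then q n else 0)"
    if "q i = 0" for q a c
  proof -
    have "(\<Sum>r<Suc n. q r * F a r c) = (\<Sum>r<Suc n. q r * ?B a r c)"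
      using that by (intro sum.cong) (auto simp: F_def)
    then show ?thesis using I_sum[of q, OF that] by (simp add: Bn)
  qed
  have "f b \<noteq> 0"
  proof
    assume "f b = 0"
    then obtain q where q: "\<exists>r<Suc n. q r \<noteq> 0" "\<forall>c<Suc n. (\<Sum>r<Suc n. q r * F b r c) = 0"
      unfolding zero by blast
    have rowsum: "(\<Sum>c<Suc n. F b r c * w c) = (if r = i then (\<Sum>c<Suc n. cnj (w c) * w c) else 0)"
      if "r < Suc n" for r
    proof (cases "r = i")
      case False
      have "(\<Sum>c<Suc n. w c * (if r = i then 0 else ?B b r c)) = 0" using w(2) that by blast
      then show ?thesis using False by (simp add: F_def mult.commute del: sum.lessThan_Suc)
    qed (simp add: F_def del: sum.lessThan_Suc)
    have "0 = (\<Sum>c<Suc n. (\<Sum>r<Suc n. q r * F b r c) * w c)" using q(2) by (simp del: sum.lessThan_Suc)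
    also have "\<dots> = (\<Sum>r<Suc n. q r * (\<Sum>c<Suc n. F b r c * w c))"
      unfolding sum_distrib_left sum_distrib_right by (subst sum.swap) (simp add: mult.assoc del: sum.lessThan_Suc)
    also have "\<dots> = (\<Sum>r<Suc n. if r = i then q i * (\<Sum>c<Suc n. cnj (w c) * w c) else 0)"
      using rowsum by (intro sum.cong) auto
    also have "\<dots> = q i * (\<Sum>c<Suc n. cnj (w c) * w c)"
      using i by (simp del: sum.lessThan_Suc)
    finally have "q i * (\<Sum>c<Suc n. cnj (w c) * w c) = 0" by simp
    moreover have "(\<Sum>c<Suc n. cnj (w c) * w c) = of_real (\<Sum>c<Suc n. (cmod (w c))\<^sup>2)"
      unfolding of_real_sum by (intro sum.cong refl) (metis complex_norm_square mult.commute)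
    moreover have "(\<Sum>c<Suc n. (cmod (w c))\<^sup>2) \<noteq> 0"
      using w(1) by (subst sum_nonneg_eq_0_iff) auto
    ultimately have qi: "q i = 0" by (metis mult_eq_0_iff of_real_eq_0_iff)
    have null: "\<forall>c<Suc n. (\<Sum>r\<in>?I. q r * star_fun U b r c) + (if c = j then q n else 0) = 0"
      using q(2) unfolding Fi[of q, OF qi] by blast
    have "\<forall>c\<in>{..n} - {j}. (\<Sum>r\<in>?I. q r * star_fun U b r c) = 0"
    proof
      fix c assume "c \<in> {..n} - {j}"
      then show "(\<Sum>r\<in>?I. q r * star_fun U b r c) = 0" using null[rule_format, of c] by simp
    qed
    then have qI: "q r = 0" if "r \<in> ?I" for r
      using indep that unfolding dependent_rows_def by blast
    then have "(\<Sum>r\<in>?I. q r * star_fun U b r j) = 0" by (intro sum.neutral) simp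
    then have "q n = 0" using null[rule_format, of j] j by simp
    then show False using q(1) qi qI by (auto simp: less_Suc_eq)
  qed
  moreover have "q r = 0" if fa: "f a \<noteq> 0" and null: "deleted_null n U j 0 a q" and qi: "q i = 0" and r: "r < n"
    for a q r
  proof (rule ccontr)
    assume "q r \<noteq> 0"
    let ?q = "q(n := - (\<Sum>r\<in>?I. q r * star_fun U a r j))"
    have qi': "?q i = 0" using qi i by simp
    have same: "(\<Sum>r\<in>?I. ?q r * star_fun U a r c) = (\<Sum>r\<in>?I. q r * star_fun U a r c)" for c
      by (intro sum.cong) auto
    have "(\<Sum>r<Suc n. ?q r * F a r c) = 0" if c: "c < Suc n" for c
    proof (cases "c = j")
      case True
      then show ?thesis unfolding Fi[of ?q, OF qi'] same by simp
    next
      case False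
      then have "(\<Sum>r<n. q r * pencil U 0 a r c) = 0" using null c unfolding left_null_pencil by auto
      moreover have "(\<Sum>r<n. q r * pencil U 0 a r c) = (\<Sum>r<n. q r * ?B a r c)"
        by (intro sum.cong) (auto simp: bordered_def)
      ultimately show ?thesis unfolding Fi[of ?q, OF qi'] same using False I_sum[of q, OF qi] by simp
    qed
    moreover have "r < Suc n \<and> ?q r \<noteq> 0" using \<open>q r \<noteq> 0\<close> r by simp
    ultimately have "f a = 0" unfolding zero by blast
    then show False using fa by simp
  qed
  ultimately show ?thesis using mp by (intro exI[of _ f]) simp
qed

section \<open>One perturbed entry\<close>

lemma ctrb_det_zeroI:
  assumes "left_null n H z {..n} q" "\<exists>r<n. q r \<noteq> 0" shows "ctrb_det n H = 0"
  using assms ctrb_det_nonzero_iff[of n H] by auto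

lemma ctrb_det_zeroE:
  assumes "ctrb_det n H = 0"
  obtains z q where "left_null n H z {..n} q" "\<exists>r<n. q r \<noteq> 0"
  using assms ctrb_det_nonzero_iff[of n H] by auto

lemma left_null_cong:
  assumes "\<And>r c. r < n \<Longrightarrow> c \<in> C \<Longrightarrow> H r c = H' r c"
  shows "left_null n H z C q \<longleftrightarrow> left_null n H' z C q"
  using assms unfolding left_null_def by (intro ball_cong refl arg_cong2[of _ _ _ _ "(=)"] sum.cong) auto

lemma star_fun_other_column:
  assumes "c \<noteq> j"
  shows "star_fun (insert (i, j) U) (a((i, j) := y)) r c = star_fun U a r c"
  using assms by (simp add: star_fun_def)

lemma deleted_null_insert:
  "left_null n (star_fun (insert (i, j) U) (a((i, j) := y))) z ({..n} - {j}) q \<longleftrightarrow> deleted_null n U j z a q"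
  by (rule left_null_cong) (simp add: star_fun_other_column)

lemma left_null_subset: "left_null n H z C q \<Longrightarrow> C' \<subseteq> C \<Longrightarrow> left_null n H z C' q"
  unfolding left_null_def by blast

lemma left_null_insert:
  "left_null n H z (insert j C) q \<longleftrightarrow>
     left_null n H z C q \<and> (\<Sum>r<n. q r * (H r j - (if r = j then z else 0))) = 0"
  unfolding left_null_def by blast

text \<open>
  If \<open>q i \<noteq> 0\<close>, the entry \<open>(i, j)\<close> can be chosen such that \<open>q\<close> annihilates column \<open>j\<close> as well.
\<close>

lemma independent_forces_zero:
  assumes j: "j \<le> n" and i: "i < n"
    and ind: "\<And>a y. ctrb_poly n (insert (i, j) U) (a((i, j) := y)) = ctrb_poly n (insert (i, j) U) a"
    and P: "ctrb_poly n (insert (i, j) U) a \<noteq> 0" and null: "deleted_null n U j z a q"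
  shows "q i = 0"
proof (rule ccontr)
  assume qi: "q i \<noteq> 0"
  let ?V = "insert (i, j) U"
  let ?e = "\<lambda>r. if r = j then z else 0"
  define rest where "rest = (\<Sum>r\<in>{..<n} - {i}. q r * (star_fun ?V a r j - ?e r))"
  define y where "y = ?e i - rest / q i"
  let ?a = "a((i, j) := y)"
  have "(\<Sum>r<n. q r * (star_fun ?V ?a r j - ?e r))
      = q i * (star_fun ?V ?a i j - ?e i) + (\<Sum>r\<in>{..<n} - {i}. q r * (star_fun ?V ?a r j - ?e r))"
    using i by (intro sum.remove) auto
  also have "(\<Sum>r\<in>{..<n} - {i}. q r * (star_fun ?V ?a r j - ?e r)) = rest"
    unfolding rest_def by (intro sum.cong) (auto simp: star_fun_def)
  also have "star_fun ?V ?a i j = y" by (simp add: star_fun_def)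
  also have "q i * (y - ?e i) + rest = 0" using qi by (simp add: y_def)
  finally have "left_null n (star_fun ?V ?a) z (insert j ({..n} - {j})) q"
    unfolding left_null_insert using null by (simp only: deleted_null_insert)
  moreover have "insert j ({..n} - {j}) = {..n}" using j by auto
  ultimately have "left_null n (star_fun ?V ?a) z {..n} q" by simp
  moreover have "\<exists>r<n. q r \<noteq> 0" using qi i by blast
  ultimately have "ctrb_poly n ?V ?a = 0" by (rule ctrb_det_zeroI)
  then show False using ind P by simp
qed

text \<open>
  If \<open>q i = 0\<close> for all null vectors without column \<open>j\<close>, then changing the entry \<open>(i, j)\<close> creates no new
  null vector. So \<open>P\<close> has no zero as a polynomial in this entry and is constant in it.
\<close>

lemma independent_if_forced_zero:
  assumes j: "j \<le> n" and i: "i < n"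
    and P: "ctrb_poly n (insert (i, j) U) a0 \<noteq> 0"
    and g: "multi_poly g" "g b \<noteq> 0"
    and forced: "\<And>a z q. g a \<noteq> 0 \<Longrightarrow> ctrb_poly n (insert (i, j) U) a \<noteq> 0 \<Longrightarrow>
      deleted_null n U j z a q \<Longrightarrow> q i = 0"
  shows "ctrb_poly n (insert (i, j) U) (a((i, j) := y)) = ctrb_poly n (insert (i, j) U) a"
proof -
  let ?V = "insert (i, j) U"
  let ?P = "ctrb_poly n ?V"
  have const: "?P (a((i, j) := y)) - ?P a = 0" if ga: "g a * ?P a \<noteq> 0" for a
  proof -
    have nz: "?P (a((i, j) := y)) \<noteq> 0" for y
    proof
      assume "?P (a((i, j) := y)) = 0"
      then obtain z q where zq: "left_null n (star_fun ?V (a((i, j) := y))) z {..n} q" "\<exists>r<n. q r \<noteq> 0"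
        by (rule ctrb_det_zeroE)
      have "left_null n (star_fun ?V (a((i, j) := y))) z ({..n} - {j}) q"
        by (rule left_null_subset[OF zq(1)]) blast
      then have "deleted_null n U j z a q" by (simp only: deleted_null_insert)
      then have qi: "q i = 0" using forced ga by auto
      have "left_null n (star_fun ?V a) z {..n} q"
        unfolding left_null_def
      proof
        fix c assume c: "c \<in> {..n}"
        have "(\<Sum>r<n. q r * (star_fun ?V a r c - (if r = c then z else 0)))
            = (\<Sum>r<n. q r * (star_fun ?V (a((i, j) := y)) r c - (if r = c then z else 0)))"
          using qi by (intro sum.cong) (auto simp: star_fun_def)
        also have "\<dots> = 0" using zq(1) c unfolding left_null_def by blast
        finally show "(\<Sum>r<n. q r * (star_fun ?V a r c - (if r = c then z else 0))) = 0" .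
      qed
      then have "?P a = 0" using zq(2) by (rule ctrb_det_zeroI)
      then show False using ga by simp
    qed
    have "?P (a((i, j) := y)) = ?P (a((i, j) := a (i, j)))"
    proof (rule ccontr)
      assume "?P (a((i, j) := y)) \<noteq> ?P (a((i, j) := a (i, j)))"
      from uni_poly_has_zero[of "\<lambda>y. ?P (a((i, j) := y))", OF uni_poly_upd[OF multi_poly_ctrb_poly] this]
      show False using nz by blast
    qed
    then show ?thesis by simp
  qed
  have mg: "multi_poly (\<lambda>a. g a * ?P a)" using g(1) multi_poly_ctrb_poly by (rule poly_expr_mult)
  obtain w where "g w \<noteq> 0" "?P w \<noteq> 0"
    using multi_poly_common_nonzero[of g ?P b a0] g multi_poly_ctrb_poly P by blast
  then have w: "g w * ?P w \<noteq> 0" by simp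
  have mf: "multi_poly (\<lambda>a. ?P (a((i, j) := y)) - ?P a)"
    by (intro poly_expr_diff multi_poly_upd multi_poly_ctrb_poly)
  have "?P (a((i, j) := y)) - ?P a = 0"
    using multi_poly_zero_if_product_zero[of "\<lambda>a. ?P (a((i, j) := y)) - ?P a" "\<lambda>a. g a * ?P a" w a]
      mf mg w const by blast
  then show ?thesis by simp
qed

lemma deleted_null_0:
  "deleted_null n U j 0 a q \<longleftrightarrow> (\<forall>c\<in>{..n} - {j}. (\<Sum>r<n. q r * star_fun U a r c) = 0)"
  by (simp add: left_null_def)

lemma dependent_rows_all:
  "dependent_rows U {..<n} ({..n} - {j}) a \<longleftrightarrow> (\<exists>q. (\<exists>r<n. q r \<noteq> 0) \<and> deleted_null n U j 0 a q)"
  unfolding dependent_rows_def deleted_null_0 by auto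

lemma sum_extend_zero:
  fixes i n :: nat
  assumes "i < n" "q i = (0::complex)"
  shows "(\<Sum>r<n. q r * h r) = (\<Sum>r\<in>{..<n} - {i}. q r * h r)"
  using assms by (subst sum.remove[of _ i]) auto

text \<open>
  Two independent null vectors \<open>q\<close> and \<open>p'\<close> of the matrix without column \<open>j\<close> have a nontrivial
  combination that annihilates column \<open>j\<close> as well, which controllability excludes. Since \<open>p' i = 0\<close>,
  they are independent if \<open>q i \<noteq> 0\<close>.
\<close>

lemma not_forced_zero_at_0:
  assumes j: "j \<le> n" and i: "i < n" and V: "V = insert (i, j) U"
    and P: "ctrb_poly n V a \<noteq> 0"
    and dep: "dependent_rows U ({..<n} - {i}) ({..n} - {j}) a"
    and null: "deleted_null n U j 0 a q"
  shows "q i = 0"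
proof (rule ccontr)
  assume qi: "q i \<noteq> 0"
  obtain p where p: "\<exists>r\<in>{..<n} - {i}. p r \<noteq> 0"
    "\<forall>c\<in>{..n} - {j}. (\<Sum>r\<in>{..<n} - {i}. p r * star_fun U a r c) = 0"
    using dep unfolding dependent_rows_def by blast
  define p' where "p' = p(i := 0)"
  have p': "p' i = 0" "\<exists>r<n. p' r \<noteq> 0" using p(1) by (auto simp: p'_def)
  have "(\<Sum>r<n. p' r * star_fun U a r c) = (\<Sum>r\<in>{..<n} - {i}. p r * star_fun U a r c)" for c
    unfolding sum_extend_zero[of i n p', OF i p'(1)] by (intro sum.cong) (auto simp: p'_def)
  then have pnull: "deleted_null n U j 0 a p'" unfolding deleted_null_0 using p(2) by simp
  have other: "star_fun V a r c = star_fun U a r c" if "c \<noteq> j" for r c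
    using that by (auto simp: star_fun_def V)
  have full: "ctrb_poly n V a = 0"
    if u: "deleted_null n U j 0 a u" "(\<Sum>r<n. u r * star_fun V a r j) = 0" "\<exists>r<n. u r \<noteq> 0" for u
  proof -
    have "left_null n (star_fun V a) 0 {..n} u"
      unfolding left_null_def
    proof
      fix c assume c: "c \<in> {..n}"
      show "(\<Sum>r<n. u r * (star_fun V a r c - (if r = c then 0 else 0))) = 0"
        using u(1,2) c other unfolding deleted_null_0 by (cases "c = j") auto
    qed
    then show ?thesis using u(3) by (rule ctrb_det_zeroI)
  qed
  define t where "t = (\<Sum>r<n. q r * star_fun V a r j)"
  define s where "s = (\<Sum>r<n. p' r * star_fun V a r j)"
  have s: "s \<noteq> 0" using full[OF pnull _ p'(2)] P unfolding s_def by blast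
  define u where "u r = s * q r - t * p' r" for r
  have lin: "(\<Sum>r<n. u r * h r) = s * (\<Sum>r<n. q r * h r) - t * (\<Sum>r<n. p' r * h r)" for h
    unfolding u_def by (simp add: algebra_simps sum_subtractf sum_distrib_left)
  have "deleted_null n U j 0 a u" using null pnull unfolding deleted_null_0 lin by simp
  moreover have "(\<Sum>r<n. u r * star_fun V a r j) = 0" unfolding lin t_def s_def by simp
  moreover have "u i \<noteq> 0" using s qi p'(1) by (simp add: u_def)
  ultimately have "ctrb_poly n V a = 0" using full[of u] i by blast
  then show False using P by simp
qed

context deleted_graph
begin

text \<open>
  The rank condition accounts for the null vectors at \<open>z = 0\<close>, the condition on \<open>Omega\<close> for those at
  \<open>z \<noteq> 0\<close>. The point \<open>a0\<close> has the value zero at \<open>(i, j)\<close> unless this entry is a star of \<open>Hbar\<close>.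
\<close>

theorem independent_of_entry_iff:
  assumes i: "i < n"
    and a0: "ctrb_poly n (insert (i, j) U) a0 \<noteq> 0"
      "star_fun (insert (i, j) U) a0 = star_fun U a0"
  shows "(\<forall>a y. ctrb_poly n (insert (i, j) U) (a((i, j) := y)) = ctrb_poly n (insert (i, j) U) a) \<longleftrightarrow>
    (grank (submatrix Hbar {..<n} ({..<n + 1} - {j})) = n \<or>
     int (grank (submatrix Hbar ({..<n} - {i}) ({..<n + 1} - {j}))) = int n - 2) \<and>
    (Omega Hbar D (i, j) = {} \<or>
     (\<forall>k\<in>Omega Hbar D (i, j).
        minWMM (tail_graph Hbar D (i, j) k) (tail_weight Hbar D (i, j) k) = card (L k)))"
proof -
  let ?V = "insert (i, j) U"
  let ?P = "ctrb_poly n ?V"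
  let ?I = "{..<n} - {i}" and ?J = "{..n} - {j}"
  have J: "{..<n + 1} - {j} = ?J" by auto
  define g1 g2 where "g1 = grank (submatrix Hbar {..<n} ?J)" and "g2 = grank (submatrix Hbar ?I ?J)"
  have subI: "?I \<subseteq> {..<n}" and subJ: "?J \<subseteq> {..<n + 1}" by auto
  have cardI: "card ?I = n - 1" using i by simp
  note rank1 = grank_submatrix[OF Hbar subset_refl subJ, folded g1_def, unfolded card_lessThan]
  note rank2 = grank_submatrix[OF Hbar subI subJ, folded g2_def, unfolded cardI]
  have core: "(\<forall>a y. ?P (a((i, j) := y)) = ?P a) \<longleftrightarrow>
    (g1 = n \<or> int g2 = int n - 2) \<and>
    (\<forall>k\<in>Omega Hbar D (i, j).
        minWMM (tail_graph Hbar D (i, j) k) (tail_weight Hbar D (i, j) k) = card (L k))"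
  proof
    assume ind: "\<forall>a y. ?P (a((i, j) := y)) = ?P a"
    have forced: "q i = 0" if "?P a \<noteq> 0" "deleted_null n U j z a q" for a z q
      using independent_forces_zero[OF j i, of U a z q] ind that by blast
    have "g1 = n \<or> int g2 = int n - 2"
    proof (rule ccontr)
      assume no: "\<not> (g1 = n \<or> int g2 = int n - 2)"
      \<comment> \<open>The deletion of one row and one column loses at most two from the full rank \<open>n\<close>.\<close>
      have "\<not> g2 + 1 < n - 1"
      proof
        assume "g2 + 1 < n - 1"
        then obtain q where q: "\<exists>r\<in>?I. q r \<noteq> 0" "\<forall>c\<in>?J. (\<Sum>r\<in>?I. q r * star_fun U a0 r c) = 0"
          "(\<Sum>r\<in>?I. q r * star_fun U a0 r j) = 0"
          using rank2(3)[of a0 "\<lambda>r. star_fun U a0 r j"] by blast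
        define q' where "q' = q(i := 0)"
        have q'i: "q' i = 0" by (simp add: q'_def)
        have sum: "(\<Sum>r<n. q' r * star_fun U a0 r c) = (\<Sum>r\<in>?I. q r * star_fun U a0 r c)" for c
          unfolding sum_extend_zero[of i n q', OF i q'i] by (intro sum.cong) (auto simp: q'_def)
        have "left_null n (star_fun U a0) 0 {..n} q'"
          unfolding left_null_def
        proof
          fix c assume "c \<in> {..n}"
          then show "(\<Sum>r<n. q' r * (star_fun U a0 r c - (if r = c then 0 else 0))) = 0"
            using q(2,3) sum by (cases "c = j") simp_all
        qed
        moreover have "\<exists>r<n. q' r \<noteq> 0" using q(1) by (auto simp: q'_def)
        ultimately have "ctrb_det n (star_fun U a0) = 0" by (rule ctrb_det_zeroI)
        then show False using a0 by simp
      qed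
      then have "g2 = n - 1" using no rank2(4) i by linarith
      then obtain b where b: "\<not> dependent_rows U ?I ?J b" using rank2(1) by blast
      obtain f where f: "multi_poly f" "f b \<noteq> 0"
        "\<forall>a q. f a \<noteq> 0 \<longrightarrow> deleted_null n U j 0 a q \<longrightarrow> q i = 0 \<longrightarrow> (\<forall>r<n. q r = 0)"
        using row_completion[OF i j b] by blast
      obtain a where a: "f a \<noteq> 0" "?P a \<noteq> 0"
        using multi_poly_common_nonzero[of f ?P b a0] f(1,2) multi_poly_ctrb_poly a0(1) by blast
      have "dependent_rows U {..<n} ?J a" using rank1(2) no by blast
      then obtain q where q: "\<exists>r<n. q r \<noteq> 0" "deleted_null n U j 0 a q"
        unfolding dependent_rows_all by blast
      have "q i = 0" by (rule forced[OF a(2) q(2)])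
      then show False using f(3) a(1) q by blast
    qed
    moreover have "minWMM (tail_graph Hbar D (i, j) k) (tail_weight Hbar D (i, j) k) = card (L k)"
      if k: "k \<in> Omega Hbar D (i, j)" for k
    proof (rule ccontr)
      assume "minWMM (tail_graph Hbar D (i, j) k) (tail_weight Hbar D (i, j) k) \<noteq> card (L k)"
      then obtain r c \<sigma> where mv: "moves_roots n U {n} (\<lambda>_. j) (r, c)" and \<sigma>: "missing i c \<sigma>"
        using root_and_minor_if_condition_fails[OF i k] by blast
      obtain z where z: "deleted_minor n U j i c z (indicator_of \<sigma>) \<noteq> 0"
        using bdet_nonzero_somewhere[OF \<sigma>, of "{}"] by blast
      show False
      proof (rule forced_zero_contradiction[where P = ?P and U = U and n = n and i = i and j = j and r = r and c = c])
        show "multi_poly ?P" by (rule multi_poly_ctrb_poly)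
        show "q i = 0" if "?P a \<noteq> 0" "deleted_null n U j z a q" for a z q by (rule forced[OF that])
      qed (rule j i a0(1) mv z)+
    qed
    ultimately show "(g1 = n \<or> int g2 = int n - 2) \<and>
      (\<forall>k\<in>Omega Hbar D (i, j).
        minWMM (tail_graph Hbar D (i, j) k) (tail_weight Hbar D (i, j) k) = card (L k))" by blast
  next
    assume cond: "(g1 = n \<or> int g2 = int n - 2) \<and>
      (\<forall>k\<in>Omega Hbar D (i, j).
        minWMM (tail_graph Hbar D (i, j) k) (tail_weight Hbar D (i, j) k) = card (L k))"
    obtain g b where g: "multi_poly g" "g b \<noteq> 0"
      and gz: "\<forall>a z q. g a \<noteq> 0 \<longrightarrow> z \<noteq> 0 \<longrightarrow> deleted_null n U j z a q \<longrightarrow> q i = 0"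
      using null_vectors_vanish_if_condition_holds[OF i] cond by blast
    obtain h b' where h: "multi_poly h" "h b' \<noteq> 0"
      and hz: "\<And>a q. h a \<noteq> 0 \<Longrightarrow> ?P a \<noteq> 0 \<Longrightarrow> deleted_null n U j 0 a q \<Longrightarrow> q i = 0"
    proof (cases "g1 = n")
      case True
      then obtain b1 where "\<not> dependent_rows U {..<n} ?J b1" using rank1(1) by blast
      then have "deleted_det n U j 0 b1 \<noteq> 0"
        unfolding dependent_rows_all using deleted_det_zero_iff[OF j] by blast
      moreover have "q i = 0" if "deleted_det n U j 0 a \<noteq> 0" "deleted_null n U j 0 a q" for a q
        using that deleted_det_zero_iff[OF j] i by blast
      ultimately show ?thesis using that[of "deleted_det n U j 0" b1] multi_poly_bdet by blast
    next
      case False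
      then have "g2 \<noteq> n - 1" using cond i by auto
      then have "dependent_rows U ?I ?J a" for a using rank2(2) by blast
      then have zero: "q i = 0" if "?P a \<noteq> 0" "deleted_null n U j 0 a q" for a q
        using not_forced_zero_at_0[OF j i refl that(1) _ that(2)] by blast
      show ?thesis
      proof (rule that[of "\<lambda>_. 1" a0])
        show "multi_poly (\<lambda>_. 1)" by (rule poly_expr_const)
        show "q i = 0" if "?P a \<noteq> 0" "deleted_null n U j 0 a q" for a q by (rule zero[OF that])
      qed simp
    qed
    obtain w where w: "g w \<noteq> 0" "h w \<noteq> 0"
      using multi_poly_common_nonzero[of g h b b'] g h by blast
    have m: "multi_poly (\<lambda>a. g a * h a)" using g(1) h(1) by (rule poly_expr_mult)
    have "q i = 0" if "g a * h a \<noteq> 0" "?P a \<noteq> 0" "deleted_null n U j z a q" for a z q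
      using that gz hz by (cases "z = 0") auto
    then show "\<forall>a y. ?P (a((i, j) := y)) = ?P a"
      using independent_if_forced_zero[of j n i U a0 "\<lambda>a. g a * h a" w, OF j i a0(1) m] w by simp
  qed
  show ?thesis unfolding J g1_def[symmetric] g2_def[symmetric] core by blast
qed

end

section \<open>The criterion\<close>

lemma stars_edge_mat:
  assumes "Abar \<in> carrier_mat n n" "Fbar \<in> carrier_mat n (n + 1)"
  shows "edge_mat Abar bbar Fbar (j, i) \<in> carrier_mat n (n + 1)"
    and "stars (edge_mat Abar bbar Fbar (j, i)) = stars (pair_mat Abar bbar) \<union> (stars Fbar - {(i, j)})"
proof -
  have P: "pair_mat Abar bbar \<in> carrier_mat n (n + 1)" by (rule pair_mat_carrier[OF assms(1)])
  then show "edge_mat Abar bbar Fbar (j, i) \<in> carrier_mat n (n + 1)"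
    by (simp add: edge_mat_def struct_or_def)
  show "stars (edge_mat Abar bbar Fbar (j, i)) = stars (pair_mat Abar bbar) \<union> (stars Fbar - {(i, j)})"
    using P assms(2) by (auto simp: stars_def edge_mat_def struct_or_def remove_edge_def)
qed

theorem theorem2:
  fixes n :: nat
    and Abar :: struct_mat and bbar :: struct_vec and Fbar :: struct_mat
    and DM :: "nat \<times> nat \<Rightarrow> decomposition"
  assumes "Abar \<in> carrier_mat n n"
    and "bbar \<in> carrier_vec n"
    and "Fbar \<in> carrier_mat n (n + 1)"
    and "struct_controllable Abar bbar"
    and "\<And>j i. (j, i) \<in> pert_edges Fbar \<Longrightarrow>
           DM_decomposition (pencil_graph_del (edge_mat Abar bbar Fbar (j, i)) j) (DM (j, i))"
  shows "PTSC Abar bbar Fbar \<longleftrightarrow>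
    (\<forall>(j, i) \<in> pert_edges Fbar.
      let Hbar = edge_mat Abar bbar Fbar (j, i); D = DM (j, i) in
        (grank (submatrix Hbar {..<n} ({..<n + 1} - {j})) = n \<or>
         int (grank (submatrix Hbar ({..<n} - {i}) ({..<n + 1} - {j}))) = int n - 2) \<and>
        (Omega Hbar D (i, j) = {} \<or>
         (\<forall>k \<in> Omega Hbar D (i, j).
            minWMM (tail_graph Hbar D (i, j) k) (tail_weight Hbar D (i, j) k)
              = card (fst (D ! k)))))"
proof -
  define S F where "S = stars (pair_mat Abar bbar)" and "F = stars Fbar"
  let ?P = "ctrb_poly n (S \<union> F)"
  let ?cond = "\<lambda>j i. let Hbar = edge_mat Abar bbar Fbar (j, i); D = DM (j, i) in
        (grank (submatrix Hbar {..<n} ({..<n + 1} - {j})) = n \<or>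
         int (grank (submatrix Hbar ({..<n} - {i}) ({..<n + 1} - {j}))) = int n - 2) \<and>
        (Omega Hbar D (i, j) = {} \<or>
         (\<forall>k \<in> Omega Hbar D (i, j).
            minWMM (tail_graph Hbar D (i, j) k) (tail_weight Hbar D (i, j) k)
              = card (fst (D ! k))))"
  obtain a1 where a1: "ctrb_poly n S a1 \<noteq> 0"
    using struct_controllable_iff[OF assms(1,2)] assms(4) unfolding S_def by blast
  define a0 where "a0 = overwrite (\<lambda>_. 0) S a1"
  have "star_fun (S \<union> F) a0 = star_fun S a1"
    by (auto simp: a0_def star_fun_def overwrite_def fun_eq_iff)
  then have Pa0: "?P a0 \<noteq> 0" using a1 by simp
  have edge: "(\<forall>a y. ?P (a((i, j) := y)) = ?P a) \<longleftrightarrow> ?cond j i" if e: "(i, j) \<in> F" for i j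
  proof -
    define Hbar where "Hbar = edge_mat Abar bbar Fbar (j, i)"
    have ij: "i < n" "j \<le> n" using e stars_carrier(1)[OF assms(3)] unfolding F_def by auto
    have "(j, i) \<in> pert_edges Fbar" using e by (simp add: pert_edges_def F_def)
    then have DM: "DM_decomposition (pencil_graph_del Hbar j) (DM (j, i))"
      unfolding Hbar_def by (rule assms(5))
    interpret deleted_graph n Hbar j "DM (j, i)"
      by unfold_locales (use DM ij stars_edge_mat(1)[OF assms(1,3)] in \<open>simp_all add: Hbar_def\<close>)
    have stars: "stars Hbar = S \<union> (F - {(i, j)})"
      unfolding Hbar_def S_def F_def by (rule stars_edge_mat(2)[OF assms(1,3)])
    have V: "S \<union> F = insert (i, j) (stars Hbar)" using e stars by auto
    have "star_fun (insert (i, j) (stars Hbar)) a0 = star_fun (stars Hbar) a0"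
      by (auto simp: star_fun_def fun_eq_iff stars a0_def overwrite_def)
    from independent_of_entry_iff[OF ij(1) _ this, folded V, OF Pa0]
    show ?thesis unfolding Let_def Hbar_def by simp
  qed
  have "PTSC Abar bbar Fbar \<longleftrightarrow> (\<forall>e\<in>F. \<forall>a y. ?P (a(e := y)) = ?P a)"
    by (rule PTSC_iff_independent[OF assms(1-4) S_def F_def])
  also have "\<dots> \<longleftrightarrow> (\<forall>(j, i)\<in>pert_edges Fbar. \<forall>a y. ?P (a((i, j) := y)) = ?P a)"
    by (auto simp: pert_edges_def F_def)
  also have "\<dots> \<longleftrightarrow> (\<forall>(j, i)\<in>pert_edges Fbar. ?cond j i)"
  proof (rule ball_cong)
    fix x assume x: "x \<in> pert_edges Fbar"
    obtain j i where ji: "x = (j, i)" by fastforce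
    then have "(i, j) \<in> F" using x by (simp add: pert_edges_def F_def)
    then show "(case x of (j, i) \<Rightarrow> \<forall>a y. ?P (a((i, j) := y)) = ?P a) \<longleftrightarrow> (case x of (j, i) \<Rightarrow> ?cond j i)"
      unfolding ji prod.case by (rule edge)
  qed simp
  finally show ?thesis .
qed

end
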